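(* Let $G=\langle x_1,\dots,x_n\mid r_1,\dots,r_m\rangle$ be a commutator-relators group, i.e. each $r_j$ lies in the commutator subgroup of the free group $\mathbf{F}_n=\langle x_1,\dots,x_n\rangle$. Let $\overline r_j\in\mathbf{L}^2(y_1,\dots,y_n)$ be the image of $r_j$ modulo $\Gamma_3\mathbf{F}_n$. Then the integral holonomy Lie algebra of $G$ is $$\mathfrak{H}(G)=\mathbf{L}(y_1,\dots,y_n)/\,\text{ideal}(\overline r_1,\dots,\overline r_m).$$
   Context: Here $G/G'=H_1G=\mathbb{Z}^n$ with basis $y_1,\dots,y_n$ given by the classes of $x_1,\dots,x_n$; $\mathbf{L}(y_1,\dots,y_n)=\mathbf{L}^*(H_1G)$ is the free $\mathbb{Z}$-Lie algebra on the $y_i$ in degree $1$, graded by bracket length, identified with $\operatorname{gr}(\mathbf{F}_n)=\bigoplus_k\Gamma_k\mathbf{F}_n/\Gamma_{k+1}\mathbf{F}_n$ (lower central series $\Gamma_1=\mathbf{F}_n$, $\Gamma_{k+1}=(\Gamma_k,\mathbf{F}_n)$, bracket induced by $(x,y)=xyx^{-1}y^{-1}$), so that $\mathbf{L}^2=\Gamma_2\mathbf{F}_n/\Gamma_3\mathbf{F}_n$. Integral holonomy Lie algebra of a finitely presented group $G$ with torsion-free $H_1G$: let $X$ be a $K(G,1)$ with finite $2$-skeleton; $\mathfrak{H}(G)=\mathbf{L}^*(H_1X)/\text{ideal}(\operatorname{im}\overline\partial_X)$, where $\overline\partial_X=\partial_X\circ\kappa$, $\kappa\colon H_2X\to\operatorname{Hom}(H^2X,\mathbb{Z})$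 is the Kronecker surjection, and $\partial_X\colon\operatorname{Hom}(H^2X,\mathbb{Z})\to\bigwedge^2H_1X=\mathbf{L}^2(H_1X)$ (with $x\wedge y\leftrightarrow[x,y]$) is dual to the cup product $\bigwedge^2H^1X\to H^2X$ (integer coefficients). *)

theory Defs
  imports "HOL-Homology.Homology"
begin

text \<open>
  All groups are HOL-Algebra groups.  Following the convention of HOL-Homology, additive groups
  (homology, cohomology, the additive group of a Lie algebra) use the fields \<open>\<otimes>\<close> and
  \<open>\<one>\<close> of the monoid record for addition and zero.
\<close>


section \<open>Free groups, presentations, lower central series\<close>

text \<open>A letter \<open>(i, True)\<close> stands for the generator \<open>i\<close>, and \<open>(i, False)\<close> for its inverse.\<close>

type_synonym 'i word = "('i \<times> bool) list"

inductive word_eq :: "'i word \<Rightarrow> 'i word \<Rightarrow> bool" where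
  refl: "word_eq u u"
| sym: "word_eq u v \<Longrightarrow> word_eq v u"
| trans: "word_eq u v \<Longrightarrow> word_eq v w \<Longrightarrow> word_eq u w"
| cancel: "word_eq (u @ [(i, b), (i, \<not> b)] @ v) (u @ v)"

definition word_class :: "'i word \<Rightarrow> 'i word set" where
  "word_class u = {v. word_eq u v}"

text \<open>The free group on \<open>I\<close> is realized inside the free group on the whole type \<open>'i\<close>: its elements
  are the classes that have a representative with all letters from \<open>I\<close>.\<close>

definition free_group :: "'i set \<Rightarrow> 'i word set monoid" where
  "free_group I =
     \<lparr>carrier = word_class ` lists (I \<times> UNIV),
      monoid.mult = (\<lambda>C D. \<Union>u\<in>C. \<Union>v\<in>D. word_class (u @ v)),
      one = word_class []\<rparr>"

definition free_group_gen :: "'i \<Rightarrow> 'i word set" where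
  "free_group_gen i = word_class [(i, True)]"

definition normal_closure :: "('a, 'b) monoid_scheme \<Rightarrow> 'a set \<Rightarrow> 'a set" where
  "normal_closure G R = \<Inter>{N. N \<lhd> G \<and> R \<subseteq> N}"

definition presented_group :: "'i set \<Rightarrow> 'i word set set \<Rightarrow> 'i word set set monoid" where
  "presented_group I R = free_group I Mod normal_closure (free_group I) R"

definition presented_gen :: "'i set \<Rightarrow> 'i word set set \<Rightarrow> 'i \<Rightarrow> 'i word set set" where
  "presented_gen I R i = normal_closure (free_group I) R #>\<^bsub>free_group I\<^esub> free_group_gen i"

definition commutator :: "('a, 'b) monoid_scheme \<Rightarrow> 'a \<Rightarrow> 'a \<Rightarrow> 'a" where
  "commutator G x y = x \<otimes>\<^bsub>G\<^esub> y \<otimes>\<^bsub>G\<^esub> inv\<^bsub>G\<^esub> x \<otimes>\<^bsub>G\<^esub> inv\<^bsub>G\<^esub> y"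

text \<open>The indexing starts at 1; the value at 0 is junk.\<close>

fun lower_central :: "('a, 'b) monoid_scheme \<Rightarrow> nat \<Rightarrow> 'a set" where
  "lower_central G 0 = carrier G"
| "lower_central G (Suc 0) = carrier G"
| "lower_central G (Suc (Suc k)) =
     generate G {commutator G x y | x y. x \<in> lower_central G (Suc k) \<and> y \<in> carrier G}"

definition lower_central_quotient :: "('a, 'b) monoid_scheme \<Rightarrow> nat \<Rightarrow> 'a set monoid" where
  "lower_central_quotient G k = (G\<lparr>carrier := lower_central G k\<rparr>) Mod lower_central G (Suc k)"


section \<open>Graded Lie algebras over the integers\<close>

text \<open>The record carries no axioms: it is also used for the free nonassociative algebra below, of
  which the free Lie algebra is a quotient.\<close>

record 'a graded_lie = "'a monoid" +
  bracket :: "'a \<Rightarrow> 'a \<Rightarrow> 'a"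
  degree_part :: "nat \<Rightarrow> 'a set"

definition lie_ideal :: "'a set \<Rightarrow> ('a, 'b) graded_lie_scheme \<Rightarrow> bool" where
  "lie_ideal J L \<longleftrightarrow>
     subgroup J L \<and> (\<forall>x\<in>carrier L. \<forall>y\<in>J. bracket L x y \<in> J \<and> bracket L y x \<in> J)"

definition ideal_generated :: "('a, 'b) graded_lie_scheme \<Rightarrow> 'a set \<Rightarrow> 'a set" where
  "ideal_generated L S = \<Inter>{J. lie_ideal J L \<and> S \<subseteq> J}"

definition lie_quotient :: "('a, 'b) graded_lie_scheme \<Rightarrow> 'a set \<Rightarrow> 'a set graded_lie" where
  "lie_quotient L J =
     \<lparr>carrier = carrier (L Mod J), monoid.mult = monoid.mult (L Mod J), one = one (L Mod J),
      bracket = (\<lambda>A B. \<Union>a\<in>A. \<Union>b\<in>B. J #>\<^bsub>L\<^esub> bracket L a b),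
      degree_part = (\<lambda>k. (\<lambda>x. J #>\<^bsub>L\<^esub> x) ` degree_part L k)\<rparr>"

definition graded_lie_iso :: "('a, 'c) graded_lie_scheme \<Rightarrow> ('b, 'd) graded_lie_scheme \<Rightarrow> ('a \<Rightarrow> 'b) set" where
  "graded_lie_iso L M =
     {f \<in> iso L M. (\<forall>x\<in>carrier L. \<forall>y\<in>carrier L. f (bracket L x y) = bracket M (f x) (f y)) \<and>
                   (\<forall>k. f ` degree_part L k = degree_part M k)}"


subsection \<open>Free Lie algebra on a set\<close>

datatype 'i bracketing = Leaf 'i | Br "'i bracketing" "'i bracketing"

primrec bracket_length :: "'i bracketing \<Rightarrow> nat" where
  "bracket_length (Leaf i) = 1"
| "bracket_length (Br s t) = bracket_length s + bracket_length t"

text \<open>Free nonassociative ring: free abelian group on the iterated bracketings of elements of \<open>I\<close>.\<close>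

definition free_nonassoc :: "'i set \<Rightarrow> ('i bracketing \<Rightarrow>\<^sub>0 int) graded_lie" where
  "free_nonassoc I =
     \<lparr>carrier = {c. Poly_Mapping.keys c \<subseteq> {t. set_bracketing t \<subseteq> I}},
      monoid.mult = (+), one = 0,
      bracket = (\<lambda>c d. frag_extend (\<lambda>s. frag_extend (\<lambda>t. frag_of (Br s t)) d) c),
      degree_part = (\<lambda>k. {c. Poly_Mapping.keys c \<subseteq> {t. set_bracketing t \<subseteq> I \<and> bracket_length t = k}})\<rparr>"

definition lie_identities :: "'i set \<Rightarrow> ('i bracketing \<Rightarrow>\<^sub>0 int) set" where
  "lie_identities I = (let N = free_nonassoc I in
     {bracket N u u | u. u \<in> carrier N} \<union>
     {bracket N u (bracket N v w) + bracket N v (bracket N w u) + bracket N w (bracket N u v)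
        | u v w. u \<in> carrier N \<and> v \<in> carrier N \<and> w \<in> carrier N})"

definition free_lie :: "'i set \<Rightarrow> ('i bracketing \<Rightarrow>\<^sub>0 int) set graded_lie" where
  "free_lie I = lie_quotient (free_nonassoc I) (ideal_generated (free_nonassoc I) (lie_identities I))"

definition free_lie_gen :: "'i set \<Rightarrow> 'i \<Rightarrow> ('i bracketing \<Rightarrow>\<^sub>0 int) set" where
  "free_lie_gen I i =
     ideal_generated (free_nonassoc I) (lie_identities I) #>\<^bsub>free_nonassoc I\<^esub> frag_of (Leaf i)"


subsection \<open>Free Lie algebra on an abelian group\<close>

text \<open>\<open>lie_of A\<close> is the free Lie algebra on the abelian group \<open>A\<close>, placed in degree 1: the left
  adjoint of the functor forgetting the bracket.\<close>

definition additivity :: "('a, 'b) monoid_scheme \<Rightarrow> ('a bracketing \<Rightarrow>\<^sub>0 int) set set" where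
  "additivity A = (let L = free_lie (carrier A); g = free_lie_gen (carrier A) in
     {g (x \<otimes>\<^bsub>A\<^esub> y) \<otimes>\<^bsub>L\<^esub> inv\<^bsub>L\<^esub> (g x \<otimes>\<^bsub>L\<^esub> g y) | x y. x \<in> carrier A \<and> y \<in> carrier A})"

definition lie_of :: "('a, 'b) monoid_scheme \<Rightarrow> ('a bracketing \<Rightarrow>\<^sub>0 int) set set graded_lie" where
  "lie_of A = lie_quotient (free_lie (carrier A)) (ideal_generated (free_lie (carrier A)) (additivity A))"

definition lie_of_gen :: "('a, 'b) monoid_scheme \<Rightarrow> 'a \<Rightarrow> ('a bracketing \<Rightarrow>\<^sub>0 int) set set" where
  "lie_of_gen A x =
     ideal_generated (free_lie (carrier A)) (additivity A) #>\<^bsub>free_lie (carrier A)\<^esub> free_lie_gen (carrier A) x"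


subsection \<open>Identification with the associated graded of the free group\<close>

primrec bracketing_commutator :: "('a, 'b) monoid_scheme \<Rightarrow> ('i \<Rightarrow> 'a) \<Rightarrow> 'i bracketing \<Rightarrow> 'a" where
  "bracketing_commutator G x (Leaf i) = x i"
| "bracketing_commutator G x (Br s t) =
     commutator G (bracketing_commutator G x s) (bracketing_commutator G x t)"

definition frag_lift :: "('a, 'b) monoid_scheme \<Rightarrow> ('s \<Rightarrow> 'a) \<Rightarrow> ('s \<Rightarrow>\<^sub>0 int) \<Rightarrow> 'a" where
  "frag_lift M f c = finprod M (\<lambda>s. f s [^]\<^bsub>M\<^esub> Poly_Mapping.lookup c s) (Poly_Mapping.keys c)"

text \<open>The identification of the degree \<open>k\<close> part of the free Lie algebra with the quotient of the
  \<open>k\<close>-th by the \<open>(k+1)\<close>-st term of the lower central series: a bracketing of length \<open>k\<close> goes to the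
  class of the corresponding iterated commutator.  Only representatives that are homogeneous of
  degree \<open>k\<close> are evaluated.\<close>

definition free_lie_to_gr :: "'i set \<Rightarrow> nat \<Rightarrow> ('i bracketing \<Rightarrow>\<^sub>0 int) set \<Rightarrow> 'i word set set" where
  "free_lie_to_gr I k C =
     the_elem (frag_lift (lower_central_quotient (free_group I) k)
         (\<lambda>t. lower_central (free_group I) (Suc k)
                #>\<^bsub>free_group I\<^esub> bracketing_commutator (free_group I) free_group_gen t)
       ` (C \<inter> degree_part (free_nonassoc I) k))"

definition quadratic_part :: "'i set \<Rightarrow> 'i word set \<Rightarrow> ('i bracketing \<Rightarrow>\<^sub>0 int) set" where
  "quadratic_part I r =
     the_inv_into (degree_part (free_lie I) 2) (free_lie_to_gr I 2)
       (lower_central (free_group I) 3 #>\<^bsub>free_group I\<^esub> r)"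


section \<open>Exterior square of an abelian group\<close>

definition wedge_relations :: "('a, 'b) monoid_scheme \<Rightarrow> ('a \<times> 'a \<Rightarrow>\<^sub>0 int) set" where
  "wedge_relations A =
     {frag_of (x \<otimes>\<^bsub>A\<^esub> x', y) - frag_of (x, y) - frag_of (x', y)
        | x x' y. x \<in> carrier A \<and> x' \<in> carrier A \<and> y \<in> carrier A} \<union>
     {frag_of (x, y \<otimes>\<^bsub>A\<^esub> y') - frag_of (x, y) - frag_of (x, y')
        | x y y'. x \<in> carrier A \<and> y \<in> carrier A \<and> y' \<in> carrier A} \<union>
     {frag_of (x, x) | x. x \<in> carrier A}"

definition ext_square :: "('a, 'b) monoid_scheme \<Rightarrow> ('a \<times> 'a \<Rightarrow>\<^sub>0 int) set monoid" where
  "ext_square A =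
     (let P = free_Abelian_group (carrier A \<times> carrier A) in P Mod generate P (wedge_relations A))"

definition wedge_to_lie ::
    "('a, 'b) monoid_scheme \<Rightarrow> ('a \<times> 'a \<Rightarrow>\<^sub>0 int) set \<Rightarrow> ('a bracketing \<Rightarrow>\<^sub>0 int) set set" where
  "wedge_to_lie A C =
     the_elem (frag_lift (lie_of A)
       (\<lambda>(x, y). bracket (lie_of A) (lie_of_gen A x) (lie_of_gen A y)) ` C)"


section \<open>Singular cohomology with integer coefficients\<close>

definition cochain_group :: "nat \<Rightarrow> 'a topology \<Rightarrow> (((nat \<Rightarrow> real) \<Rightarrow> 'a) \<Rightarrow> int) monoid" where
  "cochain_group p X =
     \<lparr>carrier = {\<phi>. \<forall>f. \<not> singular_simplex p X f \<longrightarrow> \<phi> f = 0},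
      monoid.mult = (\<lambda>\<phi> \<psi> f. \<phi> f + \<psi> f), one = (\<lambda>f. 0)\<rparr>"

definition cochain_eval :: "(((nat \<Rightarrow> real) \<Rightarrow> 'a) \<Rightarrow> int) \<Rightarrow> 'a chain \<Rightarrow> int" where
  "cochain_eval \<phi> c = (\<Sum>f\<in>Poly_Mapping.keys c. Poly_Mapping.lookup c f * \<phi> f)"

definition coboundary ::
    "nat \<Rightarrow> 'a topology \<Rightarrow> (((nat \<Rightarrow> real) \<Rightarrow> 'a) \<Rightarrow> int) \<Rightarrow> ((nat \<Rightarrow> real) \<Rightarrow> 'a) \<Rightarrow> int" where
  "coboundary p X \<phi> =
     (\<lambda>f. if singular_simplex (Suc p) X f then cochain_eval \<phi> (chain_boundary (Suc p) (frag_of f)) else 0)"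

definition cocycle_set :: "nat \<Rightarrow> 'a topology \<Rightarrow> (((nat \<Rightarrow> real) \<Rightarrow> 'a) \<Rightarrow> int) set" where
  "cocycle_set p X = {\<phi> \<in> carrier (cochain_group p X). coboundary p X \<phi> = (\<lambda>f. 0)}"

definition coboundary_set :: "nat \<Rightarrow> 'a topology \<Rightarrow> (((nat \<Rightarrow> real) \<Rightarrow> 'a) \<Rightarrow> int) set" where
  "coboundary_set p X =
     (case p of 0 \<Rightarrow> {\<lambda>f. 0} | Suc q \<Rightarrow> coboundary q X ` carrier (cochain_group q X))"

definition cohomology_group :: "nat \<Rightarrow> 'a topology \<Rightarrow> (((nat \<Rightarrow> real) \<Rightarrow> 'a) \<Rightarrow> int) set monoid" where
  "cohomology_group p X = ((cochain_group p X)\<lparr>carrier := cocycle_set p X\<rparr>) Mod coboundary_set p X"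

text \<open>Alexander--Whitney: evaluate on the front \<open>p\<close>-face and on the back \<open>q\<close>-face.\<close>

definition front_face :: "nat \<Rightarrow> ((nat \<Rightarrow> real) \<Rightarrow> 'a) \<Rightarrow> (nat \<Rightarrow> real) \<Rightarrow> 'a" where
  "front_face p f = restrict f (standard_simplex p)"

definition back_face :: "nat \<Rightarrow> nat \<Rightarrow> ((nat \<Rightarrow> real) \<Rightarrow> 'a) \<Rightarrow> (nat \<Rightarrow> real) \<Rightarrow> 'a" where
  "back_face p q f = restrict (\<lambda>x. f (\<lambda>i. if i < p then 0 else x (i - p))) (standard_simplex q)"

definition cochain_cup ::
    "nat \<Rightarrow> nat \<Rightarrow> 'a topology \<Rightarrow> (((nat \<Rightarrow> real) \<Rightarrow> 'a) \<Rightarrow> int) \<Rightarrow> (((nat \<Rightarrow> real) \<Rightarrow> 'a) \<Rightarrow> int)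
       \<Rightarrow> ((nat \<Rightarrow> real) \<Rightarrow> 'a) \<Rightarrow> int" where
  "cochain_cup p q X \<phi> \<psi> =
     (\<lambda>f. if singular_simplex (p + q) X f then \<phi> (front_face p f) * \<psi> (back_face p q f) else 0)"

definition cup_product ::
    "nat \<Rightarrow> nat \<Rightarrow> 'a topology \<Rightarrow> (((nat \<Rightarrow> real) \<Rightarrow> 'a) \<Rightarrow> int) set \<Rightarrow> (((nat \<Rightarrow> real) \<Rightarrow> 'a) \<Rightarrow> int) set
       \<Rightarrow> (((nat \<Rightarrow> real) \<Rightarrow> 'a) \<Rightarrow> int) set" where
  "cup_product p q X a b =
     (\<Union>\<phi>\<in>a. \<Union>\<psi>\<in>b. coboundary_set (p + q) X #>\<^bsub>cochain_group (p + q) X\<^esub> cochain_cup p q X \<phi> \<psi>)"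

definition kronecker ::
    "nat \<Rightarrow> 'a topology \<Rightarrow> 'a chain set \<Rightarrow> (((nat \<Rightarrow> real) \<Rightarrow> 'a) \<Rightarrow> int) set \<Rightarrow> int" where
  "kronecker p X z =
     restrict (\<lambda>a. the_elem {cochain_eval \<phi> c | \<phi> c. \<phi> \<in> a \<and> c \<in> z}) (carrier (cohomology_group p X))"


section \<open>The holonomy Lie algebra of a space\<close>

text \<open>The pairing of \<open>w\<close> in the exterior square of first homology with the wedge of two classes
  \<open>a\<close>, \<open>b\<close> in first cohomology, through which the exterior square of first homology is identified
  with the dual of that of first cohomology.\<close>

definition wedge_pairing ::
    "'a topology \<Rightarrow> (((nat \<Rightarrow> real) \<Rightarrow> 'a) \<Rightarrow> int) set \<Rightarrow> (((nat \<Rightarrow> real) \<Rightarrow> 'a) \<Rightarrow> int) set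
       \<Rightarrow> ('a chain set \<times> 'a chain set \<Rightarrow>\<^sub>0 int) set \<Rightarrow> int" where
  "wedge_pairing X a b w =
     the_elem ((\<lambda>c. \<Sum>(x, y)\<in>Poly_Mapping.keys c. Poly_Mapping.lookup c (x, y) *
                  (kronecker 1 X x a * kronecker 1 X y b - kronecker 1 X y a * kronecker 1 X x b)) ` w)"

text \<open>The dual of the cup product.  It is well defined if first homology is free of finite rank.\<close>

definition cup_dual ::
    "'a topology \<Rightarrow> ((((nat \<Rightarrow> real) \<Rightarrow> 'a) \<Rightarrow> int) set \<Rightarrow> int) \<Rightarrow> ('a chain set \<times> 'a chain set \<Rightarrow>\<^sub>0 int) set" where
  "cup_dual X h =
     (THE w. w \<in> carrier (ext_square (homology_group 1 X)) \<and>
        (\<forall>a\<in>carrier (cohomology_group 1 X). \<forall>b\<in>carrier (cohomology_group 1 X).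
           wedge_pairing X a b w = h (cup_product 1 1 X a b)))"

definition holonomy_boundary :: "'a topology \<Rightarrow> 'a chain set \<Rightarrow> ('a chain set \<times> 'a chain set \<Rightarrow>\<^sub>0 int) set" where
  "holonomy_boundary X z = cup_dual X (kronecker 2 X z)"

definition holonomy_ideal :: "'a topology \<Rightarrow> ('a chain set bracketing \<Rightarrow>\<^sub>0 int) set set set" where
  "holonomy_ideal X = ideal_generated (lie_of (homology_group 1 X))
     (wedge_to_lie (homology_group 1 X) ` holonomy_boundary X ` carrier (homology_group 2 X))"

definition holonomy_lie :: "'a topology \<Rightarrow> ('a chain set bracketing \<Rightarrow>\<^sub>0 int) set set set graded_lie" where
  "holonomy_lie X = lie_quotient (lie_of (homology_group 1 X)) (holonomy_ideal X)"


section \<open>Eilenberg--MacLane complexes\<close>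

definition fundamental_group :: "'a::topological_space set \<Rightarrow> 'a \<Rightarrow> (real \<Rightarrow> 'a) set monoid" where
  "fundamental_group X x0 =
     \<lparr>carrier = {{q. homotopic_paths X p q} | p.
        path p \<and> path_image p \<subseteq> X \<and> pathstart p = x0 \<and> pathfinish p = x0},
      monoid.mult = (\<lambda>P Q. \<Union>p\<in>P. \<Union>q\<in>Q. {s. homotopic_paths X (p +++ q) s}),
      one = {q. homotopic_paths X (\<lambda>t. x0) q}\<rparr>"

text \<open>Points of the standard 1-simplex are functions \<open>t\<close> with \<open>t 0 + t 1 = 1\<close>.\<close>

definition hurewicz :: "'a::topological_space set \<Rightarrow> (real \<Rightarrow> 'a) set \<Rightarrow> 'a chain set" where
  "hurewicz X P =
     (\<Union>p\<in>P. homologous_rel_set 1 (top_of_set X) {} (frag_of (restrict (\<lambda>t. p (t 1)) (standard_simplex 1))))"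

text \<open>The condition for \<open>k \<ge> 2\<close> says that the \<open>k\<close>-th homotopy group is trivial.\<close>

definition eilenberg_maclane_1 ::
    "('g, 'b) monoid_scheme \<Rightarrow> 'a::topological_space set \<Rightarrow> 'a \<Rightarrow> ('g \<Rightarrow> (real \<Rightarrow> 'a) set) \<Rightarrow> bool" where
  "eilenberg_maclane_1 G X x0 \<alpha> \<longleftrightarrow>
     x0 \<in> X \<and> path_connected X \<and> \<alpha> \<in> iso G (fundamental_group X x0) \<and>
     (\<forall>k\<ge>2. \<forall>f. let e = (\<lambda>i::nat. if i = 0 then 1 else 0 :: real) in
        continuous_map (nsphere k) (top_of_set X) f \<and> f e = x0 \<longrightarrow>
        homotopic_with (\<lambda>h. h e = x0) (nsphere k) (top_of_set X) f (\<lambda>x. x0))"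

definition disc :: "nat \<Rightarrow> (nat \<Rightarrow> real) topology" where
  "disc k = subtopology (Euclidean_space k) {x. (\<Sum>i<k. (x i)\<^sup>2) \<le> 1}"

definition open_disc :: "nat \<Rightarrow> (nat \<Rightarrow> real) set" where
  "open_disc k = {x \<in> topspace (disc k). (\<Sum>i<k. (x i)\<^sup>2) < 1}"

text \<open>A CW structure is given by a set of pairs consisting of the dimension of a cell and its
  characteristic map.\<close>

definition open_cell :: "nat \<times> ((nat \<Rightarrow> real) \<Rightarrow> 'a) \<Rightarrow> 'a set" where
  "open_cell = (\<lambda>(k, \<Phi>). \<Phi> ` open_disc k)"

definition cw_structure :: "'a topology \<Rightarrow> (nat \<times> ((nat \<Rightarrow> real) \<Rightarrow> 'a)) set \<Rightarrow> bool" where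
  "cw_structure X \<K> \<longleftrightarrow>
     Hausdorff_space X \<and>
     (\<forall>(k, \<Phi>)\<in>\<K>. continuous_map (disc k) X \<Phi> \<and>
        homeomorphic_map (subtopology (disc k) (open_disc k)) (subtopology X (\<Phi> ` open_disc k)) \<Phi>) \<and>
     (\<forall>c\<in>\<K>. \<forall>d\<in>\<K>. c \<noteq> d \<longrightarrow> open_cell c \<inter> open_cell d = {}) \<and>
     topspace X = \<Union> (open_cell ` \<K>) \<and>
     (\<forall>(k, \<Phi>)\<in>\<K>. \<exists>\<F>. finite \<F> \<and> \<F> \<subseteq> {d \<in> \<K>. fst d < k} \<and>
        \<Phi> ` (topspace (disc k) - open_disc k) \<subseteq> \<Union> (open_cell ` \<F>)) \<and>
     (\<forall>A \<subseteq> topspace X. closedin X A \<longleftrightarrow>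
        (\<forall>(k, \<Phi>)\<in>\<K>. closedin (disc k) {x \<in> topspace (disc k). \<Phi> x \<in> A}))"

definition finite_2_skeleton :: "(nat \<times> ((nat \<Rightarrow> real) \<Rightarrow> 'a)) set \<Rightarrow> bool" where
  "finite_2_skeleton \<K> \<longleftrightarrow> finite {c \<in> \<K>. fst c \<le> 2}"

end

theory Submission
  imports Defs
begin

text \<open>
  Sending a generator \<open>x\<close> of the free group to \<open>1 + x\<close> (Magnus) assigns to a word \<open>w\<close> its exponent
  sums \<open>e\<^sub>i w\<close> and quadratic coefficients \<open>\<mu>\<^sub>i\<^sub>j w\<close>, with
  \<open>\<mu>\<^sub>i\<^sub>j (u v) = \<mu>\<^sub>i\<^sub>j u + \<mu>\<^sub>i\<^sub>j v + e\<^sub>i u e\<^sub>j v\<close>.  On the commutator subgroup the \<open>\<mu>\<^sub>i\<^sub>j\<close> are additive,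
  conjugation invariant and antisymmetric, and the quadratic part of \<open>r\<close> is
  \<open>\<Sum>\<^sub>i\<^sub><\<^sub>j \<mu>\<^sub>i\<^sub>j r [y\<^sub>i, y\<^sub>j]\<close>.

  The same product formula is the cup product of 1-cocycles on a triangle.  Closing up edges with
  chosen paths from the base point turns every edge into a word; the boundary word of a triangle is a
  relation, and up to a coboundary \<open>\<phi> \<union> \<psi>\<close> takes on the triangle the value
  \<open>\<Sum>\<^sub>i\<^sub>j \<mu>\<^sub>i\<^sub>j \<phi>\<^sub>i \<psi>\<^sub>j\<close> of that relation.  Hence every 2-cycle evaluates cup products as some relation does.
  Conversely the null homotopy of the loop of a relation closes up to a 2-cycle that realizes its
  coefficients.  So the image of the dual cup product consists exactly of the quadratic parts of the
  relations.  As these depend additively and conjugation invariantly on the relation, they generate the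
  same ideal as those of the given relators.  Since first homology is free on the classes of the
  generators, the two quotients satisfy the same universal property.
\<close>

section \<open>Graded nonassociative rings\<close>

text \<open>The word of an edge does not determine the value of a 1-cocycle \<phi> on it, since
  \<phi> also sees the paths chosen to the end points. With t\<phi>(x) the value of \<phi> on the
  path to x and l\<phi> the linear value of edge words, \<phi> = l\<phi> + d(t\<phi>), and the
  Leibniz rule puts all terms with t into a coboundary. What remains, l\<phi> cup l\<psi>, differs
  from the value of the relation by the coboundary of the quadratic Magnus form, because that form
  fails to be additive by exactly this cross term. The resulting cochain
  \<open>cup_correction\<close> is explicit, and it also shows that the cup product is well defined
  on classes. Both \<open>quadratic_part\<close> and \<open>cup_dual\<close> are defined by
  inverting something, so existence and uniqueness are owed for each. Both come from one fact: a
  biadditive alternating expression is fixed by its values on pairs i < j of generators. The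
  coordinates are Magnus coefficients on one side and pairings with dual cocycles on the other;
  these cocycles exist because relations have exponent sums zero.\<close>

lemma comm_group_cong:
  assumes "comm_group G" "carrier H = carrier G" "\<one>\<^bsub>H\<^esub> = \<one>\<^bsub>G\<^esub>" "\<And>x y. x \<otimes>\<^bsub>H\<^esub> y = x \<otimes>\<^bsub>G\<^esub> y"
  shows "comm_group H"
proof -
  interpret G: comm_group G by fact
  show ?thesis
    using G.l_inv_ex by (intro comm_groupI) (simp_all add: assms(2-4) G.m_ac)
qed

section \<open>Linear extension of maps on free abelian groups\<close>

context comm_group
begin

lemma frag_lift_superset:
  assumes "finite S" "Poly_Mapping.keys c \<subseteq> S" "f \<in> S \<rightarrow> carrier G"
  shows "frag_lift G f c = finprod G (\<lambda>s. f s [^] Poly_Mapping.lookup c s) S"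
  unfolding frag_lift_def
  using assms by (intro finprod_mono_neutral_cong_left) (auto simp: in_keys_iff)

lemma frag_lift_closed:
  assumes "f \<in> Poly_Mapping.keys c \<rightarrow> carrier G"
  shows "frag_lift G f c \<in> carrier G"
  unfolding frag_lift_def using assms by (intro finprod_closed) auto

lemma frag_lift_add:
  assumes "f \<in> S \<rightarrow> carrier G" "Poly_Mapping.keys c \<subseteq> S" "Poly_Mapping.keys d \<subseteq> S"
  shows "frag_lift G f (c + d) = frag_lift G f c \<otimes> frag_lift G f d"
proof -
  let ?T = "Poly_Mapping.keys c \<union> Poly_Mapping.keys d"
  have f: "f \<in> ?T \<rightarrow> carrier G" and fin: "finite ?T"
    using assms by auto
  have "frag_lift G f (c + d) = finprod G (\<lambda>s. f s [^] Poly_Mapping.lookup (c + d) s) ?T"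
    by (rule frag_lift_superset[OF fin keys_add f])
  also have "\<dots> = finprod G (\<lambda>s. f s [^] Poly_Mapping.lookup c s \<otimes> f s [^] Poly_Mapping.lookup d s) ?T"
    using f by (intro finprod_cong') (auto simp: lookup_add int_pow_mult Pi_iff)
  also have "\<dots> = frag_lift G f c \<otimes> frag_lift G f d"
    using f by (subst finprod_multf) (auto simp: frag_lift_superset[OF fin])
  finally show ?thesis .
qed

lemma frag_lift_of: "f s \<in> carrier G \<Longrightarrow> frag_lift G f (frag_of s) = f s"
  by (simp add: frag_lift_def keys_frag_of)

lemma frag_lift_hom:
  "f \<in> S \<rightarrow> carrier G \<Longrightarrow> frag_lift G f \<in> hom (free_Abelian_group S) G"
  by (intro homI) (auto simp: frag_lift_add intro!: frag_lift_closed)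

end

lemma hom_free_Abelian_group_eq:
  assumes "comm_group G" "f \<in> hom (free_Abelian_group S) G" "g \<in> hom (free_Abelian_group S) G"
    and "\<And>s. s \<in> S \<Longrightarrow> f (frag_of s) = g (frag_of s)" "Poly_Mapping.keys c \<subseteq> S"
  shows "f c = g c"
proof -
  interpret G: comm_group G by fact
  interpret f: group_hom "free_Abelian_group S" G f
    using assms(2) by (simp add: group_hom_def group_hom_axioms_def)
  interpret g: group_hom "free_Abelian_group S" G g
    using assms(3) by (simp add: group_hom_def group_hom_axioms_def)
  have minus: "h (x - y) = h x \<otimes>\<^bsub>G\<^esub> inv\<^bsub>G\<^esub> h y"
    if "h \<in> hom (free_Abelian_group S) G" "Poly_Mapping.keys x \<subseteq> S" "Poly_Mapping.keys y \<subseteq> S" for h x y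
  proof -
    interpret h: group_hom "free_Abelian_group S" G h
      using that(1) by (simp add: group_hom_def group_hom_axioms_def)
    show ?thesis
      using h.hom_mult[of x "-y"] h.hom_inv[of y] that by simp
  qed
  \<comment> \<open>The support is part of the claim because the difference step of
    \<open>frag_induction\<close> gives no bound on the keys of its two arguments.\<close>
  have "Poly_Mapping.keys c \<subseteq> S \<and> f c = g c"
    using assms(5)
  proof (induction c rule: frag_induction)
    case zero
    then show ?case using f.hom_one g.hom_one by simp
  next
    case (one x)
    then show ?case using assms(4) by (simp add: keys_frag_of)
  next
    case (diff a b)
    then show ?case
      using keys_diff[of a b] minus[OF assms(2), of a b] minus[OF assms(3), of a b] by auto
  qed
  then show ?thesis by simp
qed

text \<open>Brackets of cosets, products of word classes and of loop classes, and cup products are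
  all defined as unions over pairs of representatives; this reduces each of them to independence of
  the representatives.\<close>

lemma UN2_const:
  assumes "A \<noteq> {}" "B \<noteq> {}" "\<And>a b. a \<in> A \<Longrightarrow> b \<in> B \<Longrightarrow> F a b = C"
  shows "(\<Union>a\<in>A. \<Union>b\<in>B. F a b) = C"
proof -
  have "(\<Union>a\<in>A. \<Union>b\<in>B. F a b) = (\<Union>a\<in>A. \<Union>b\<in>B. C)"
    using assms(3) by (intro SUP_cong) auto
  then show ?thesis using assms(1,2) by auto
qed

text \<open>The Lie identities are kept apart in \<open>lie_law\<close>, so that the free
  nonassociative ring and all its quotients share the theory of ideals, quotients and
  homomorphisms.\<close>

locale graded_nring = comm_group L for L :: "('a, 'b) graded_lie_scheme" (structure) +
  assumes bracket_closed [simp, intro]: "x \<in> carrier L \<Longrightarrow> y \<in> carrier L \<Longrightarrow> bracket L x y \<in> carrier L"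
    and bracket_mult_left: "x \<in> carrier L \<Longrightarrow> y \<in> carrier L \<Longrightarrow> z \<in> carrier L \<Longrightarrow>
          bracket L (x \<otimes> y) z = bracket L x z \<otimes> bracket L y z"
    and bracket_mult_right: "x \<in> carrier L \<Longrightarrow> y \<in> carrier L \<Longrightarrow> z \<in> carrier L \<Longrightarrow>
          bracket L z (x \<otimes> y) = bracket L z x \<otimes> bracket L z y"
    and degree_subgroup: "subgroup (degree_part L k) L"
    and bracket_degree: "x \<in> degree_part L i \<Longrightarrow> y \<in> degree_part L j \<Longrightarrow> bracket L x y \<in> degree_part L (i + j)"
begin

lemma degree_closed: "x \<in> degree_part L k \<Longrightarrow> x \<in> carrier L"
  using degree_subgroup subgroup.mem_carrier by fastforce

lemma bracket_left_hom: "z \<in> carrier L \<Longrightarrow> group_hom L L (\<lambda>x. bracket L x z)"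
  by unfold_locales (auto simp: hom_def bracket_mult_left)

lemma bracket_right_hom: "z \<in> carrier L \<Longrightarrow> group_hom L L (bracket L z)"
  by unfold_locales (auto simp: hom_def bracket_mult_right)

lemmas bracket_one_left = group_hom.hom_one[OF bracket_left_hom]
  and bracket_one_right = group_hom.hom_one[OF bracket_right_hom]

end

definition nring_hom :: "('a, 'c) graded_lie_scheme \<Rightarrow> ('b, 'd) graded_lie_scheme \<Rightarrow> ('a \<Rightarrow> 'b) set" where
  "nring_hom L M =
     {f \<in> hom L M. (\<forall>x\<in>carrier L. \<forall>y\<in>carrier L. f (bracket L x y) = bracket M (f x) (f y)) \<and>
                   (\<forall>k. f ` degree_part L k \<subseteq> degree_part M k)}"

lemma nring_hom_closed: "f \<in> nring_hom L M \<Longrightarrow> x \<in> carrier L \<Longrightarrow> f x \<in> carrier M"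
  and nring_hom_mult: "f \<in> nring_hom L M \<Longrightarrow> x \<in> carrier L \<Longrightarrow> y \<in> carrier L \<Longrightarrow>
        f (x \<otimes>\<^bsub>L\<^esub> y) = f x \<otimes>\<^bsub>M\<^esub> f y"
  and nring_hom_bracket: "f \<in> nring_hom L M \<Longrightarrow> x \<in> carrier L \<Longrightarrow> y \<in> carrier L \<Longrightarrow>
        f (bracket L x y) = bracket M (f x) (f y)"
  and nring_hom_degree: "f \<in> nring_hom L M \<Longrightarrow> x \<in> degree_part L k \<Longrightarrow> f x \<in> degree_part M k"
  by (auto simp: nring_hom_def hom_def image_subset_iff)

lemma nring_hom_compose:
  assumes "f \<in> nring_hom L M" "g \<in> nring_hom M N"
  shows "(\<lambda>x. g (f x)) \<in> nring_hom L N"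
proof -
  have "f \<in> hom L M" "g \<in> hom M N"
    using assms by (auto simp: nring_hom_def)
  then have "(\<lambda>x. g (f x)) \<in> hom L N" and "\<And>x. x \<in> carrier L \<Longrightarrow> f x \<in> carrier M"
    by (auto simp: hom_def Pi_iff)
  then show ?thesis
    using assms by (auto simp: nring_hom_def image_subset_iff)
qed

text \<open>Homomorphisms only map degree parts into degree parts. Equality follows from y = f (g
  y), because g preserves degrees too.\<close>

lemma inverse_nring_homs_iso:
  assumes "graded_nring L" "graded_nring M" "f \<in> nring_hom L M" "g \<in> nring_hom M L"
    and "\<And>x. x \<in> carrier L \<Longrightarrow> g (f x) = x" "\<And>y. y \<in> carrier M \<Longrightarrow> f (g y) = y"
  shows "f \<in> graded_lie_iso L M"
proof -
  have f: "f \<in> hom L M" and g: "g \<in> hom M L"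
    using assms by (auto simp: nring_hom_def)
  have "bij_betw f (carrier L) (carrier M)"
    using assms f g by (intro bij_betwI[where g = g]) (auto simp: hom_def Pi_iff)
  moreover have "f ` degree_part L k = degree_part M k" for k
  proof
    show "f ` degree_part L k \<subseteq> degree_part M k"
      using assms by (simp add: nring_hom_def)
    show "degree_part M k \<subseteq> f ` degree_part L k"
    proof
      fix y assume "y \<in> degree_part M k"
      then have "g y \<in> degree_part L k" "f (g y) = y"
        using assms(4,6) graded_nring.degree_closed[OF assms(2)] by (auto intro: nring_hom_degree)
      then show "y \<in> f ` degree_part L k" by force
    qed
  qed
  ultimately show ?thesis
    using assms f by (auto simp: graded_lie_iso_def iso_def nring_hom_def)
qed

subsection \<open>Quotients\<close>

context graded_nring
begin

lemma lie_ideal_carrier: "lie_ideal (carrier L) L"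
  by (auto simp: lie_ideal_def subgroup_self)

lemma ideal_generated_ideal:
  assumes "S \<subseteq> carrier L"
  shows "lie_ideal (ideal_generated L S) L"
proof -
  let ?F = "{J. lie_ideal J L \<and> S \<subseteq> J}"
  have "carrier L \<in> ?F"
    using assms lie_ideal_carrier by simp
  then have "subgroup (\<Inter>?F) L"
    by (intro subgroups_Inter) (auto simp: lie_ideal_def)
  then show ?thesis
    unfolding ideal_generated_def by (auto simp: lie_ideal_def)
qed

lemma ideal_generated_incl: "S \<subseteq> ideal_generated L S"
  by (auto simp: ideal_generated_def)

lemma ideal_generated_minimal: "lie_ideal J L \<Longrightarrow> S \<subseteq> J \<Longrightarrow> ideal_generated L S \<subseteq> J"
  by (auto simp: ideal_generated_def)

lemma ideal_coset_eq_iff: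
  assumes "lie_ideal J L" "x \<in> carrier L" "y \<in> carrier L"
  shows "J #> x = J #> y \<longleftrightarrow> x \<otimes> inv y \<in> J"
proof -
  have J: "subgroup J L" using assms by (simp add: lie_ideal_def)
  show ?thesis
  proof
    assume "J #> x = J #> y"
    then have "x \<in> J #> y" using rcos_self[OF assms(2) J] by simp
    then obtain h where "h \<in> J" "x = h \<otimes> y" by (auto simp: r_coset_def)
    then show "x \<otimes> inv y \<in> J"
      using assms J subgroup.mem_carrier[OF J] by (simp add: m_assoc)
  next
    assume h: "x \<otimes> inv y \<in> J"
    have "x = (x \<otimes> inv y) \<otimes> y" using assms by (simp add: m_assoc)
    then have "x \<in> J #> y" using h by (auto simp: r_coset_def)
    then show "J #> x = J #> y" using repr_independence[OF _ assms(3) J] by metis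
  qed
qed

lemma coset_mem_ideal:
  assumes "lie_ideal J L" "x \<in> J #> y" "y \<in> carrier L"
  shows "x \<in> carrier L" "J #> x = J #> y"
proof -
  have J: "subgroup J L" using assms by (simp add: lie_ideal_def)
  show "x \<in> carrier L" using assms J by (meson r_coset_subset_G subgroup.subset subsetD)
  show "J #> x = J #> y" using repr_independence[OF assms(2,3) J] by simp
qed

lemma carrier_lie_quotient: "carrier (lie_quotient L J) = (\<lambda>x. J #> x) ` carrier L"
  by (auto simp: lie_quotient_def FactGroup_def RCOSETS_def)

text \<open>In the biadditive expansion for other representatives, three of the four terms have an
  argument in J, and J absorbs brackets on either side.\<close>

lemma bracket_lie_quotient:
  assumes J: "lie_ideal J L" and x: "x \<in> carrier L" and y: "y \<in> carrier L"
  shows "bracket (lie_quotient L J) (J #> x) (J #> y) = J #> bracket L x y"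
proof -
  have sg: "subgroup J L" using J by (simp add: lie_ideal_def)
  have "J #> bracket L a b = J #> bracket L x y" if "a \<in> J #> x" "b \<in> J #> y" for a b
  proof -
    from that obtain h k where h: "h \<in> J" "a = h \<otimes> x" and k: "k \<in> J" "b = k \<otimes> y"
      unfolding r_coset_def by blast
    have c: "h \<in> carrier L" "k \<in> carrier L" using h k subgroup.mem_carrier[OF sg] by auto
    have "bracket L a b = (bracket L h k \<otimes> bracket L h y \<otimes> bracket L x k) \<otimes> bracket L x y"
      using h k c x y by (simp add: bracket_mult_left bracket_mult_right m_ac)
    moreover have "bracket L h k \<otimes> bracket L h y \<otimes> bracket L x k \<in> J"
      using J h k c x y sg by (auto simp: lie_ideal_def intro!: subgroup.m_closed)
    ultimately have "bracket L a b \<in> J #> bracket L x y"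
      by (auto simp: r_coset_def)
    then show ?thesis by (rule coset_mem_ideal(2)[OF J _ bracket_closed[OF x y]])
  qed
  moreover have "x \<in> J #> x" "y \<in> J #> y" using rcos_self[OF _ sg] x y by auto
  ultimately have "(\<Union>a\<in>J #> x. \<Union>b\<in>J #> y. J #> bracket L a b) = J #> bracket L x y"
    by (intro UN2_const) blast+
  then show ?thesis
    by (simp add: lie_quotient_def)
qed

lemma mult_lie_quotient:
  assumes "lie_ideal J L" "x \<in> carrier L" "y \<in> carrier L"
  shows "(J #> x) \<otimes>\<^bsub>lie_quotient L J\<^esub> (J #> y) = J #> (x \<otimes> y)"
proof -
  have "J \<lhd> L" using assms by (simp add: lie_ideal_def normal_iff_subgroup)
  then show ?thesis
    using assms normal.rcos_sum by (fastforce simp: lie_quotient_def FactGroup_def)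
qed

lemma one_lie_quotient: "\<one>\<^bsub>lie_quotient L J\<^esub> = J"
  by (simp add: lie_quotient_def FactGroup_def)

lemma graded_nring_lie_quotient:
  assumes J: "lie_ideal J L"
  shows "graded_nring (lie_quotient L J)"
proof -
  let ?Q = "lie_quotient L J"
  have sg: "subgroup J L" using J by (simp add: lie_ideal_def)
  have Q: "comm_group ?Q"
  proof -
    have "comm_group (L Mod J)" by (rule abelian_FactGroup[OF sg])
    moreover have "carrier ?Q = carrier (L Mod J)" "\<one>\<^bsub>?Q\<^esub> = \<one>\<^bsub>L Mod J\<^esub>"
      "\<And>x y. x \<otimes>\<^bsub>?Q\<^esub> y = x \<otimes>\<^bsub>L Mod J\<^esub> y"
      by (simp_all add: lie_quotient_def)
    ultimately show ?thesis by (rule comm_group_cong)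
  qed
  then interpret Q: comm_group ?Q .
  have hom: "group_hom L ?Q (\<lambda>x. J #> x)"
    by unfold_locales (auto simp: hom_def carrier_lie_quotient mult_lie_quotient[OF J])
  show ?thesis
  proof (intro graded_nring.intro graded_nring_axioms.intro, goal_cases)
    case (5 k)
    have "degree_part ?Q k = (\<lambda>x. J #> x) ` degree_part L k" by (simp add: lie_quotient_def)
    then show ?case
      using group_hom.subgroup_img_is_subgroup[OF hom degree_subgroup[of k]]
      by (simp only:)
  next
    case (6 x i y j)
    then obtain a b where "x = J #> a" "y = J #> b" "a \<in> degree_part L i" "b \<in> degree_part L j"
      by (auto simp: lie_quotient_def)
    moreover from this have "bracket ?Q x y = J #> bracket L a b"
      using bracket_lie_quotient[OF J] degree_closed by blast
    ultimately show ?case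
      using bracket_degree by (auto simp: lie_quotient_def)
  qed (use Q in \<open>auto simp: carrier_lie_quotient bracket_lie_quotient[OF J] mult_lie_quotient[OF J]
       bracket_mult_left bracket_mult_right\<close>)
qed

lemma quotient_map_hom:
  assumes J: "lie_ideal J L"
  shows "(\<lambda>x. J #> x) \<in> nring_hom L (lie_quotient L J)"
  by (auto simp: nring_hom_def hom_def carrier_lie_quotient mult_lie_quotient[OF J] bracket_lie_quotient[OF J])
     (simp add: lie_quotient_def)

lemma kernel_lie_ideal:
  assumes "graded_nring M" "f \<in> nring_hom L M"
  shows "lie_ideal {x \<in> carrier L. f x = \<one>\<^bsub>M\<^esub>} L"
proof -
  interpret M: graded_nring M by fact
  interpret f: group_hom L M f
    using assms by unfold_locales (simp add: nring_hom_def)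
  have "subgroup {x \<in> carrier L. f x = \<one>\<^bsub>M\<^esub>} L"
    using f.subgroup_kernel by (simp add: kernel_def)
  moreover have "f (bracket L x y) = bracket M (f x) (f y)" if "x \<in> carrier L" "y \<in> carrier L" for x y
    using assms that by (simp add: nring_hom_def)
  ultimately show ?thesis
    by (auto simp: lie_ideal_def M.bracket_one_left M.bracket_one_right)
qed

lemma lie_quotient_factor:
  assumes M: "graded_nring M" and f: "f \<in> nring_hom L M"
    and S: "S \<subseteq> carrier L" "\<And>s. s \<in> S \<Longrightarrow> f s = \<one>\<^bsub>M\<^esub>"
  obtains g where "g \<in> nring_hom (lie_quotient L (ideal_generated L S)) M"
    "\<And>x. x \<in> carrier L \<Longrightarrow> g (ideal_generated L S #> x) = f x"
proof -
  let ?J = "ideal_generated L S"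
  interpret M: graded_nring M by fact
  interpret f: group_hom L M f
    using f by unfold_locales (simp add: nring_hom_def)
  have J: "lie_ideal ?J L" by (rule ideal_generated_ideal[OF S(1)])
  have ker: "?J \<subseteq> {x \<in> carrier L. f x = \<one>\<^bsub>M\<^esub>}"
    using kernel_lie_ideal[OF M f] S by (intro ideal_generated_minimal) auto
  \<comment> \<open>An arbitrary representative will do: the kernel of f is an ideal containing S,
    so it contains the ideal generated by S.\<close>
  define g where "g = (\<lambda>C. f (SOME x. x \<in> C))"
  have g: "g (?J #> x) = f x" if x: "x \<in> carrier L" for x
  proof -
    have "x \<in> ?J #> x" using rcos_self[OF x] J by (simp add: lie_ideal_def)
    then have "(SOME z. z \<in> ?J #> x) \<in> ?J #> x" by (rule someI)
    then obtain h where "h \<in> ?J" "(SOME z. z \<in> ?J #> x) = h \<otimes> x" by (auto simp: r_coset_def)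
    moreover have "h \<in> carrier L" "f h = \<one>\<^bsub>M\<^esub>" using ker \<open>h \<in> ?J\<close> by auto
    ultimately show ?thesis using x by (simp add: g_def)
  qed
  moreover have "g \<in> nring_hom (lie_quotient L ?J) M"
  proof -
    have "\<And>k y. y \<in> degree_part (lie_quotient L ?J) k \<Longrightarrow> g y \<in> degree_part M k"
      using nring_hom_degree[OF f] g degree_closed by (auto simp: lie_quotient_def)
    then show ?thesis
      using f by (auto simp: nring_hom_def hom_def carrier_lie_quotient mult_lie_quotient[OF J]
          bracket_lie_quotient[OF J] g)
  qed
  ultimately show thesis using that by blast
qed

end

subsection \<open>The free nonassociative ring\<close>

lemma keys_frag_extend2:
  assumes "Poly_Mapping.keys c \<subseteq> S" "Poly_Mapping.keys d \<subseteq> T" "\<And>s t. s \<in> S \<Longrightarrow> t \<in> T \<Longrightarrow> Br s t \<in> U"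
  shows "Poly_Mapping.keys (frag_extend (\<lambda>s. frag_extend (\<lambda>t. frag_of (Br s t)) d) c) \<subseteq> U"
proof -
  have "Poly_Mapping.keys (frag_extend (\<lambda>t. frag_of (Br s t)) d) \<subseteq> U" if "s \<in> S" for s
    using keys_frag_extend[of "\<lambda>t. frag_of (Br s t)" d] assms that by (fastforce simp: keys_frag_of)
  then show ?thesis
    using keys_frag_extend[of "\<lambda>s. frag_extend (\<lambda>t. frag_of (Br s t)) d" c] assms(1) by blast
qed

lemma frag_extend_add_left:
  "frag_extend (\<lambda>s. f s + g s) c = frag_extend f c + frag_extend g c"
  by (simp add: frag_extend_def frag_cmul_distrib2 sum.distrib)

lemma graded_nring_free_nonassoc: "graded_nring (free_nonassoc I)"
proof -
  let ?N = "free_nonassoc I"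
  have "comm_group (free_Abelian_group {t. set_bracketing t \<subseteq> I})"
    by (rule abelian_free_Abelian_group)
  moreover have eqs: "carrier ?N = carrier (free_Abelian_group {t. set_bracketing t \<subseteq> I})" "\<one>\<^bsub>?N\<^esub> = 0"
    "\<And>x y. x \<otimes>\<^bsub>?N\<^esub> y = x + y"
    unfolding free_nonassoc_def free_Abelian_group_def by simp_all
  ultimately have grp: "comm_group ?N"
    using comm_group_cong[of "free_Abelian_group {t. set_bracketing t \<subseteq> I}" ?N] by simp
  then interpret N: comm_group ?N .
  have inv: "inv\<^bsub>?N\<^esub> x = - x" if "x \<in> carrier ?N" for x
    using that by (intro N.inv_equality) (auto simp: free_nonassoc_def)
  show ?thesis
  proof (intro graded_nring.intro graded_nring_axioms.intro, goal_cases)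
    case 1
    show ?case by (rule grp)
  next
    case (2 x y)
    then have "Poly_Mapping.keys (frag_extend (\<lambda>s. frag_extend (\<lambda>t. frag_of (Br s t)) y) x) \<subseteq>
        {t. set_bracketing t \<subseteq> I}"
      by (intro keys_frag_extend2[of _ "{t. set_bracketing t \<subseteq> I}" _ "{t. set_bracketing t \<subseteq> I}"])
        (auto simp: free_nonassoc_def)
    then show ?case by (simp add: free_nonassoc_def)
  next
    case (3 x y z)
    then show ?case by (simp add: free_nonassoc_def frag_extend_add)
  next
    case (4 x y z)
    then show ?case by (simp add: free_nonassoc_def frag_extend_add frag_extend_add_left)
  next
    case (5 k)
    show ?case
    proof (rule N.subgroupI)
      show "degree_part ?N k \<subseteq> carrier ?N" by (auto simp: free_nonassoc_def)
      have "0 \<in> degree_part ?N k" by (auto simp: free_nonassoc_def)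
      then show "degree_part ?N k \<noteq> {}" by blast
      fix a assume a: "a \<in> degree_part ?N k"
      then have "a \<in> carrier ?N" by (auto simp: free_nonassoc_def)
      then show "inv\<^bsub>?N\<^esub> a \<in> degree_part ?N k" using a by (simp add: inv) (simp add: free_nonassoc_def)
      fix b assume "b \<in> degree_part ?N k"
      then show "a \<otimes>\<^bsub>?N\<^esub> b \<in> degree_part ?N k" using a keys_add[of a b] by (simp add: free_nonassoc_def) blast
    qed
  next
    case (6 x i y j)
    then have "Poly_Mapping.keys (frag_extend (\<lambda>s. frag_extend (\<lambda>t. frag_of (Br s t)) y) x) \<subseteq>
        {t. set_bracketing t \<subseteq> I \<and> bracket_length t = i + j}"
      by (intro keys_frag_extend2[of _ "{t. set_bracketing t \<subseteq> I \<and> bracket_length t = i}" _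
            "{t. set_bracketing t \<subseteq> I \<and> bracket_length t = j}"])
        (auto simp: free_nonassoc_def)
    then show ?case by (simp add: free_nonassoc_def)
  qed
qed

lemma free_nonassoc_simps:
  "\<one>\<^bsub>free_nonassoc I\<^esub> = 0" "x \<otimes>\<^bsub>free_nonassoc I\<^esub> y = x + y"
  "x \<in> carrier (free_nonassoc I) \<longleftrightarrow> Poly_Mapping.keys x \<subseteq> {t. set_bracketing t \<subseteq> I}"
  by (auto simp: free_nonassoc_def)

lemma inv_free_nonassoc:
  assumes "x \<in> carrier (free_nonassoc I)"
  shows "inv\<^bsub>free_nonassoc I\<^esub> x = - x"
proof -
  interpret graded_nring "free_nonassoc I" by (rule graded_nring_free_nonassoc)
  show ?thesis using assms by (intro inv_equality) (auto simp: free_nonassoc_simps)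
qed

lemma bracket_free_nonassoc_of:
  "bracket (free_nonassoc I) (frag_of s) (frag_of t) = frag_of (Br s t)"
  by (simp add: free_nonassoc_def)

lemma hom_free_nonassoc_iff:
  "hom (free_nonassoc I) M = hom (free_Abelian_group {t. set_bracketing t \<subseteq> I}) M"
  by (simp add: free_nonassoc_def free_Abelian_group_def hom_def)

lemma free_nonassoc_hom_eq:
  assumes M: "graded_nring M" and f: "f \<in> nring_hom (free_nonassoc I) M" and g: "g \<in> nring_hom (free_nonassoc I) M"
    and leaf: "\<And>i. i \<in> I \<Longrightarrow> f (frag_of (Leaf i)) = g (frag_of (Leaf i))" and c: "c \<in> carrier (free_nonassoc I)"
  shows "f c = g c"
proof -
  interpret M: graded_nring M by fact
  have "f (frag_of t) = g (frag_of t)" if "set_bracketing t \<subseteq> I" for t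
    using that
  proof (induction t)
    case (Br s t)
    have "frag_of s \<in> carrier (free_nonassoc I)" "frag_of t \<in> carrier (free_nonassoc I)"
      using Br.prems by (simp_all add: free_nonassoc_simps keys_frag_of)
    note br = nring_hom_bracket[OF _ this, of _ M, unfolded bracket_free_nonassoc_of]
    show ?case using Br by (simp add: br[OF f] br[OF g])
  qed (simp add: leaf)
  then show ?thesis
    using c f g M.comm_group_axioms hom_free_Abelian_group_eq[of M f "{t. set_bracketing t \<subseteq> I}" g c]
    by (auto simp: free_nonassoc_simps nring_hom_def hom_free_nonassoc_iff)
qed

primrec eval_bracketing :: "('a, 'b) graded_lie_scheme \<Rightarrow> ('i \<Rightarrow> 'a) \<Rightarrow> 'i bracketing \<Rightarrow> 'a" where
  "eval_bracketing M f (Leaf i) = f i"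
| "eval_bracketing M f (Br s t) = bracket M (eval_bracketing M f s) (eval_bracketing M f t)"

text \<open>Bracketings form a free magma, so \<open>eval_bracketing\<close> is the forced value on
  them and \<open>frag_lift\<close> extends it linearly. Compatibility with the bracket is
  biadditive and is checked on basis elements, first in the right and then in the left
  argument.\<close>

lemma free_nonassoc_universal:
  assumes M: "graded_nring M" and f: "\<And>i. i \<in> I \<Longrightarrow> f i \<in> degree_part M 1"
  obtains g where "g \<in> nring_hom (free_nonassoc I) M" "\<And>i. i \<in> I \<Longrightarrow> g (frag_of (Leaf i)) = f i"
proof -
  interpret M: graded_nring M by fact
  let ?T = "{t. set_bracketing t \<subseteq> I}" and ?e = "eval_bracketing M f"
  let ?g = "frag_lift M ?e"
  have deg: "?e t \<in> degree_part M (bracket_length t)" if "set_bracketing t \<subseteq> I" for t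
    using that by (induction t) (simp_all add: f[unfolded One_nat_def] M.bracket_degree)
  then have e: "?e \<in> ?T \<rightarrow> carrier M" using M.degree_closed by blast
  have gof: "?g (frag_of t) = ?e t" if "set_bracketing t \<subseteq> I" for t
    using that e by (intro M.frag_lift_of) auto
  have ghom: "?g \<in> hom (free_Abelian_group ?T) M" by (rule M.frag_lift_hom[OF e])
  have gcl: "?g c \<in> carrier M" if "Poly_Mapping.keys c \<subseteq> ?T" for c
    using ghom that by (auto simp: hom_def)
  have homs: "(\<lambda>d. ?g (frag_extend (\<lambda>t. frag_of (Br s t)) d)) \<in> hom (free_Abelian_group ?T) M"
    if "s \<in> ?T" for s
  proof (intro homI)
    fix x assume "x \<in> carrier (free_Abelian_group ?T)"
    then have "Poly_Mapping.keys (frag_extend (\<lambda>t. frag_of (Br s t)) x) \<subseteq> ?T"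
      using keys_frag_extend[of "\<lambda>t. frag_of (Br s t)" x] that by (fastforce simp: keys_frag_of)
    then show k: "?g (frag_extend (\<lambda>t. frag_of (Br s t)) x) \<in> carrier M" by (rule gcl)
    fix y assume "y \<in> carrier (free_Abelian_group ?T)"
    then have "Poly_Mapping.keys (frag_extend (\<lambda>t. frag_of (Br s t)) y) \<subseteq> ?T"
      using keys_frag_extend[of "\<lambda>t. frag_of (Br s t)" y] that by (fastforce simp: keys_frag_of)
    then show "?g (frag_extend (\<lambda>t. frag_of (Br s t)) (x \<otimes>\<^bsub>free_Abelian_group ?T\<^esub> y)) =
       ?g (frag_extend (\<lambda>t. frag_of (Br s t)) x) \<otimes>\<^bsub>M\<^esub> ?g (frag_extend (\<lambda>t. frag_of (Br s t)) y)"
      using \<open>Poly_Mapping.keys (frag_extend (\<lambda>t. frag_of (Br s t)) x) \<subseteq> ?T\<close>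
      by (simp add: frag_extend_add M.frag_lift_add[OF e])
  qed
  have br1: "?g (frag_extend (\<lambda>t. frag_of (Br s t)) d) = bracket M (?e s) (?g d)"
    if s: "s \<in> ?T" and d: "Poly_Mapping.keys d \<subseteq> ?T" for s d
  proof (rule hom_free_Abelian_group_eq[OF M.comm_group_axioms homs[OF s] _ _ d])
    show "(\<lambda>d. bracket M (?e s) (?g d)) \<in> hom (free_Abelian_group ?T) M"
      using s e gcl by (intro homI) (auto simp: M.frag_lift_add[OF e] M.bracket_mult_right Pi_iff)
    fix t assume "t \<in> ?T"
    then show "?g (frag_extend (\<lambda>t. frag_of (Br s t)) (frag_of t)) = bracket M (?e s) (?g (frag_of t))"
      using s by (simp add: gof)
  qed
  have br: "?g (bracket (free_nonassoc I) c d) = bracket M (?g c) (?g d)"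
    if c: "Poly_Mapping.keys c \<subseteq> ?T" and d: "Poly_Mapping.keys d \<subseteq> ?T" for c d
  proof (rule hom_free_Abelian_group_eq[OF M.comm_group_axioms _ _ _ c])
    interpret N: graded_nring "free_nonassoc I" by (rule graded_nring_free_nonassoc)
    have N: "bracket (free_nonassoc I) x d \<in> carrier (free_nonassoc I)" if "Poly_Mapping.keys x \<subseteq> ?T" for x
      using that d by (intro N.bracket_closed) (auto simp: free_nonassoc_simps)
    show "(\<lambda>c. ?g (bracket (free_nonassoc I) c d)) \<in> hom (free_Abelian_group ?T) M"
    proof (intro homI)
      fix x y assume xy: "x \<in> carrier (free_Abelian_group ?T)" "y \<in> carrier (free_Abelian_group ?T)"
      show "?g (bracket (free_nonassoc I) x d) \<in> carrier M"
        using N[of x] xy by (intro gcl) (auto simp: free_nonassoc_simps)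
      show "?g (bracket (free_nonassoc I) (x \<otimes>\<^bsub>free_Abelian_group ?T\<^esub> y) d) =
        ?g (bracket (free_nonassoc I) x d) \<otimes>\<^bsub>M\<^esub> ?g (bracket (free_nonassoc I) y d)"
        using N.bracket_mult_left[of x y d] N[of x] N[of y] xy d
        by (simp add: free_nonassoc_simps M.frag_lift_add[OF e])
    qed
    show "(\<lambda>c. bracket M (?g c) (?g d)) \<in> hom (free_Abelian_group ?T) M"
      using gcl d by (intro homI) (auto simp: M.frag_lift_add[OF e] M.bracket_mult_left)
    fix s assume "s \<in> ?T"
    then show "?g (bracket (free_nonassoc I) (frag_of s) d) = bracket M (?g (frag_of s)) (?g d)"
      using br1[of s d] d by (simp add: gof free_nonassoc_def)
  qed
  have degk: "?g c \<in> degree_part M k" if "c \<in> degree_part (free_nonassoc I) k" for c k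
  proof -
    interpret S: subgroup "degree_part M k" M by (rule M.degree_subgroup)
    let ?Tk = "{t. set_bracketing t \<subseteq> I \<and> bracket_length t = k}"
    have c: "Poly_Mapping.keys c \<subseteq> ?Tk" using that by (auto simp: free_nonassoc_def)
    have "?g c = finprod M (\<lambda>s. ?e s [^]\<^bsub>M\<^esub> Poly_Mapping.lookup c s) (Poly_Mapping.keys c)"
      by (simp add: frag_lift_def)
    also have "\<dots> \<in> degree_part M k"
    proof -
      have "finprod M (\<lambda>s. ?e s [^]\<^bsub>M\<^esub> Poly_Mapping.lookup c s) A \<in> degree_part M k"
        if "finite A" "A \<subseteq> ?Tk" for A
        using that
      proof (induction A rule: finite_induct)
        case (insert x A)
        have x: "?e x \<in> degree_part M k" using deg[of x] insert by auto
        then have "?e x [^]\<^bsub>M\<^esub> Poly_Mapping.lookup c x \<in> degree_part M k"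
          using M.subgroup_int_pow_closed[OF M.degree_subgroup] by blast
        moreover have "(\<lambda>s. ?e s [^]\<^bsub>M\<^esub> Poly_Mapping.lookup c s) \<in> A \<rightarrow> carrier M"
          using e insert by (auto simp: Pi_iff)
        ultimately show ?case
          using insert by (subst M.finprod_insert) auto
      qed auto
      then show ?thesis using c by simp
    qed
    finally show ?thesis .
  qed
  have "?g \<in> nring_hom (free_nonassoc I) M"
    using ghom br degk by (auto simp: nring_hom_def hom_free_nonassoc_iff free_nonassoc_simps)
  then show thesis
    using that[of ?g] gof by simp
qed

subsection \<open>The Lie identities\<close>

definition lie_law :: "('a, 'b) graded_lie_scheme \<Rightarrow> bool" where
  "lie_law L \<longleftrightarrow> (\<forall>u\<in>carrier L. bracket L u u = \<one>\<^bsub>L\<^esub>) \<and>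
     (\<forall>u\<in>carrier L. \<forall>v\<in>carrier L. \<forall>w\<in>carrier L.
        bracket L u (bracket L v w) \<otimes>\<^bsub>L\<^esub> bracket L v (bracket L w u) \<otimes>\<^bsub>L\<^esub> bracket L w (bracket L u v) = \<one>\<^bsub>L\<^esub>)"

lemma lie_law_quotient:
  assumes "graded_nring L" "lie_ideal J L" "lie_law L"
  shows "lie_law (lie_quotient L J)"
proof -
  interpret graded_nring L by fact
  have J: "J #>\<^bsub>L\<^esub> \<one>\<^bsub>L\<^esub> = J"
    using assms(2) coset_join2[of "\<one>\<^bsub>L\<^esub>" J] subgroup.one_closed[of J L] by (auto simp: lie_ideal_def)
  show ?thesis
    unfolding lie_law_def
  proof (intro conjI ballI)
    fix u v w
    assume "u \<in> carrier (lie_quotient L J)" "v \<in> carrier (lie_quotient L J)" "w \<in> carrier (lie_quotient L J)"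
    then obtain x y z where "x \<in> carrier L" "y \<in> carrier L" "z \<in> carrier L"
      "u = J #>\<^bsub>L\<^esub> x" "v = J #>\<^bsub>L\<^esub> y" "w = J #>\<^bsub>L\<^esub> z"
      unfolding carrier_lie_quotient by blast
    note xyz = this
    have "J #>\<^bsub>L\<^esub> (bracket L x (bracket L y z) \<otimes>\<^bsub>L\<^esub> bracket L y (bracket L z x) \<otimes>\<^bsub>L\<^esub>
        bracket L z (bracket L x y)) = J"
      using assms(3) xyz J unfolding lie_law_def by metis
    then show "bracket (lie_quotient L J) u (bracket (lie_quotient L J) v w) \<otimes>\<^bsub>lie_quotient L J\<^esub>
       bracket (lie_quotient L J) v (bracket (lie_quotient L J) w u) \<otimes>\<^bsub>lie_quotient L J\<^esub>
       bracket (lie_quotient L J) w (bracket (lie_quotient L J) u v) = \<one>\<^bsub>lie_quotient L J\<^esub>"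
      using xyz(1-3) unfolding xyz(4-6)
      by (simp add: bracket_lie_quotient[OF assms(2)] mult_lie_quotient[OF assms(2)] one_lie_quotient)
  next
    fix u assume "u \<in> carrier (lie_quotient L J)"
    then obtain x where "x \<in> carrier L" "u = J #>\<^bsub>L\<^esub> x" unfolding carrier_lie_quotient by blast
    then show "bracket (lie_quotient L J) u u = \<one>\<^bsub>lie_quotient L J\<^esub>"
      using assms(3) J by (simp add: bracket_lie_quotient[OF assms(2)] one_lie_quotient lie_law_def)
  qed
qed

lemma (in graded_nring) bracket_antisym:
  assumes "lie_law L" "x \<in> carrier L" "y \<in> carrier L"
  shows "bracket L y x = inv (bracket L x y)"
proof -
  have "\<one> = bracket L (x \<otimes> y) (x \<otimes> y)" using assms by (simp add: lie_law_def)
  also have "\<dots> = (bracket L x x \<otimes> bracket L y x) \<otimes> (bracket L x y \<otimes> bracket L y y)"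
    using assms by (simp only: bracket_mult_left bracket_mult_right m_closed)
  also have "\<dots> = bracket L y x \<otimes> bracket L x y"
    using assms by (simp add: lie_law_def)
  finally show ?thesis using assms by (metis bracket_closed inv_equality)
qed

lemma lie_identities_carrier: "lie_identities I \<subseteq> carrier (free_nonassoc I)"
proof -
  interpret N: graded_nring "free_nonassoc I" by (rule graded_nring_free_nonassoc)
  have "x + y + z \<in> carrier (free_nonassoc I)"
    if "x \<in> carrier (free_nonassoc I)" "y \<in> carrier (free_nonassoc I)" "z \<in> carrier (free_nonassoc I)" for x y z
    using N.m_closed[OF N.m_closed[OF that(1,2)] that(3)] by (simp add: free_nonassoc_simps)
  then show ?thesis by (auto simp: lie_identities_def Let_def)
qed

lemma lie_law_hom_identities:
  assumes M: "lie_law M" "graded_nring M" and f: "f \<in> nring_hom (free_nonassoc I) M" and s: "s \<in> lie_identities I"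
  shows "f s = \<one>\<^bsub>M\<^esub>"
proof -
  interpret N: graded_nring "free_nonassoc I" by (rule graded_nring_free_nonassoc)
  interpret M: graded_nring M by fact
  have fc: "f x \<in> carrier M" if "x \<in> carrier (free_nonassoc I)" for x
    using f that by (auto simp: nring_hom_def hom_def)
  have fb: "f (bracket (free_nonassoc I) x y) = bracket M (f x) (f y)"
    if "x \<in> carrier (free_nonassoc I)" "y \<in> carrier (free_nonassoc I)" for x y
    using f that by (auto simp: nring_hom_def)
  have fa: "f (x + y) = f x \<otimes>\<^bsub>M\<^esub> f y"
    if "x \<in> carrier (free_nonassoc I)" "y \<in> carrier (free_nonassoc I)" for x y
    using f that by (auto simp: nring_hom_def hom_def free_nonassoc_simps)
  have fp: "x + y \<in> carrier (free_nonassoc I)"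
    if "x \<in> carrier (free_nonassoc I)" "y \<in> carrier (free_nonassoc I)" for x y
    using N.m_closed[OF that] by (simp add: free_nonassoc_simps(2))
  consider u where "u \<in> carrier (free_nonassoc I)" "s = bracket (free_nonassoc I) u u"
    | u v w where "u \<in> carrier (free_nonassoc I)" "v \<in> carrier (free_nonassoc I)" "w \<in> carrier (free_nonassoc I)"
      "s = bracket (free_nonassoc I) u (bracket (free_nonassoc I) v w) +
           bracket (free_nonassoc I) v (bracket (free_nonassoc I) w u) +
           bracket (free_nonassoc I) w (bracket (free_nonassoc I) u v)"
    using s unfolding lie_identities_def Let_def by blast
  then show ?thesis
  proof cases
    case 1
    then have "f s = bracket M (f u) (f u)" by (simp add: fb)
    then show ?thesis using M(1) fc 1 by (simp add: lie_law_def)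
  next
    case 2
    then have "f s = bracket M (f u) (bracket M (f v) (f w)) \<otimes>\<^bsub>M\<^esub>
        bracket M (f v) (bracket M (f w) (f u)) \<otimes>\<^bsub>M\<^esub> bracket M (f w) (bracket M (f u) (f v))"
      by (simp add: fa fp fb)
    then show ?thesis using M(1) fc 2 by (metis lie_law_def)
  qed
qed

text \<open>Every element of the quotient is the class of an element of the free ring, so each
  instance of an identity in the quotient is the class of a member of \<open>lie_identities\<close>,
  which lies in the ideal.\<close>

lemma
  shows graded_nring_free_lie: "graded_nring (free_lie I)"
    and lie_law_free_lie: "lie_law (free_lie I)"
proof -
  let ?N = "free_nonassoc I" and ?K = "ideal_generated (free_nonassoc I) (lie_identities I)"
  interpret N: graded_nring ?N by (rule graded_nring_free_nonassoc)
  have K: "lie_ideal ?K ?N"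
    by (rule N.ideal_generated_ideal[OF lie_identities_carrier])
  show "graded_nring (free_lie I)"
    unfolding free_lie_def by (rule N.graded_nring_lie_quotient[OF K])
  have one: "?K #>\<^bsub>?N\<^esub> x = ?K" if "x \<in> lie_identities I" for x
  proof -
    have "x \<in> ?K" using that N.ideal_generated_incl by blast
    then show ?thesis
      using K N.coset_join2[of x ?K] lie_identities_carrier[of I] that by (auto simp: lie_ideal_def)
  qed
  have m: "(?K #>\<^bsub>?N\<^esub> x) \<otimes>\<^bsub>lie_quotient ?N ?K\<^esub> (?K #>\<^bsub>?N\<^esub> y) = ?K #>\<^bsub>?N\<^esub> (x + y)"
    if "x \<in> carrier ?N" "y \<in> carrier ?N" for x y
    using N.mult_lie_quotient[OF K that] by (simp add: free_nonassoc_simps)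
  have p: "x + y \<in> carrier ?N" if "x \<in> carrier ?N" "y \<in> carrier ?N" for x y
    using N.m_closed[OF that] by (simp add: free_nonassoc_simps(2))
  have sq: "bracket ?N u u \<in> lie_identities I" if "u \<in> carrier ?N" for u
    using that by (auto simp: lie_identities_def Let_def)
  have jac: "bracket ?N u (bracket ?N v w) + bracket ?N v (bracket ?N w u) + bracket ?N w (bracket ?N u v)
      \<in> lie_identities I" if "u \<in> carrier ?N" "v \<in> carrier ?N" "w \<in> carrier ?N" for u v w
    using that unfolding lie_identities_def Let_def by blast
  show "lie_law (free_lie I)"
    unfolding free_lie_def lie_law_def
  proof (intro conjI ballI)
    fix u v w
    assume "u \<in> carrier (lie_quotient ?N ?K)" "v \<in> carrier (lie_quotient ?N ?K)" "w \<in> carrier (lie_quotient ?N ?K)"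
    then obtain x y z where xyz: "x \<in> carrier ?N" "y \<in> carrier ?N" "z \<in> carrier ?N"
      "u = ?K #>\<^bsub>?N\<^esub> x" "v = ?K #>\<^bsub>?N\<^esub> y" "w = ?K #>\<^bsub>?N\<^esub> z"
      unfolding N.carrier_lie_quotient by blast
    show "bracket (lie_quotient ?N ?K) u (bracket (lie_quotient ?N ?K) v w) \<otimes>\<^bsub>lie_quotient ?N ?K\<^esub>
       bracket (lie_quotient ?N ?K) v (bracket (lie_quotient ?N ?K) w u) \<otimes>\<^bsub>lie_quotient ?N ?K\<^esub>
       bracket (lie_quotient ?N ?K) w (bracket (lie_quotient ?N ?K) u v) = \<one>\<^bsub>lie_quotient ?N ?K\<^esub>"
      using xyz(1-3) one[OF jac[OF xyz(1-3)]] unfolding xyz(4-6)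
      by (simp add: N.bracket_lie_quotient[OF K] m p N.one_lie_quotient)
  next
    fix u assume "u \<in> carrier (lie_quotient ?N ?K)"
    then obtain x where "x \<in> carrier ?N" "u = ?K #>\<^bsub>?N\<^esub> x" unfolding N.carrier_lie_quotient by blast
    then show "bracket (lie_quotient ?N ?K) u u = \<one>\<^bsub>lie_quotient ?N ?K\<^esub>"
      using one[OF sq[of x]] by (simp add: N.bracket_lie_quotient[OF K] N.one_lie_quotient)
  qed
qed

section \<open>The free group\<close>

lemma word_eq_context: "word_eq u v \<Longrightarrow> word_eq (a @ u @ b) (a @ v @ b)"
proof (induction rule: word_eq.induct)
  case (cancel u i c v)
  show ?case using word_eq.cancel[of "a @ u" i c "v @ b"] by simp
qed (auto intro: word_eq.intros)

lemma word_eq_append: "word_eq u u' \<Longrightarrow> word_eq v v' \<Longrightarrow> word_eq (u @ v) (u' @ v')"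
  using word_eq_context[of u u' "[]" v] word_eq_context[of v v' u' "[]"] word_eq.trans by fastforce

lemma word_class_eq_iff: "word_class u = word_class v \<longleftrightarrow> word_eq u v"
  unfolding word_class_def by (auto intro: word_eq.intros)

lemma mem_word_class: "v \<in> word_class u \<longleftrightarrow> word_class v = word_class u"
  by (simp add: word_class_def) (metis word_class_def word_class_eq_iff word_eq.sym)

lemma mult_free_group: "word_class u \<otimes>\<^bsub>free_group I\<^esub> word_class v = word_class (u @ v)"
proof -
  have "(\<Union>a\<in>word_class u. \<Union>b\<in>word_class v. word_class (a @ b)) = word_class (u @ v)"
  proof (rule UN2_const)
    show "word_class u \<noteq> {}" "word_class v \<noteq> {}" using mem_word_class by blast+
  qed (auto simp: mem_word_class word_class_eq_iff word_eq_append)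
  then show ?thesis by (simp add: free_group_def)
qed

lemma one_free_group: "\<one>\<^bsub>free_group I\<^esub> = word_class []"
  by (simp add: free_group_def)

lemma carrier_free_group: "carrier (free_group I) = word_class ` lists (I \<times> UNIV)"
  by (simp add: free_group_def)

definition word_inv :: "'i word \<Rightarrow> 'i word" where
  "word_inv u = rev (map (\<lambda>(i, b). (i, \<not> b)) u)"

lemma word_inv_lists: "u \<in> lists (I \<times> UNIV) \<Longrightarrow> word_inv u \<in> lists (I \<times> UNIV)"
  by (auto simp: word_inv_def)

lemma word_eq_inv: "word_eq (word_inv u @ u) []"
proof (induction u)
  case Nil
  then show ?case by (simp add: word_inv_def word_eq.refl)
next
  case (Cons x u)
  obtain i b where x: "x = (i, b)" by (cases x)
  have "word_eq (word_inv u @ [(i, \<not> b), (i, \<not> \<not> b)] @ u) (word_inv u @ u)" by (rule word_eq.cancel)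
  then show ?case using Cons word_eq.trans by (fastforce simp: word_inv_def x)
qed

lemma group_free_group: "group (free_group I)"
proof (rule groupI)
  fix x assume "x \<in> carrier (free_group I)"
  then obtain u where "u \<in> lists (I \<times> UNIV)" "x = word_class u" by (auto simp: carrier_free_group)
  then have "word_class (word_inv u) \<in> carrier (free_group I)"
    "word_class (word_inv u) \<otimes>\<^bsub>free_group I\<^esub> x = \<one>\<^bsub>free_group I\<^esub>"
    using word_inv_lists[of u I] by (auto simp: carrier_free_group mult_free_group one_free_group word_class_eq_iff word_eq_inv)
  then show "\<exists>y\<in>carrier (free_group I). y \<otimes>\<^bsub>free_group I\<^esub> x = \<one>\<^bsub>free_group I\<^esub>" by blast
next
  fix x y assume "x \<in> carrier (free_group I)" "y \<in> carrier (free_group I)"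
  then show "x \<otimes>\<^bsub>free_group I\<^esub> y \<in> carrier (free_group I)"
    unfolding carrier_free_group by (force simp: mult_free_group)
qed (auto simp: carrier_free_group mult_free_group one_free_group)

lemma free_group_gen_closed: "i \<in> I \<Longrightarrow> free_group_gen i \<in> carrier (free_group I)"
  by (auto simp: free_group_gen_def carrier_free_group)

lemma inv_free_group_gen: "i \<in> I \<Longrightarrow> inv\<^bsub>free_group I\<^esub> free_group_gen i = word_class [(i, False)]"
  using word_eq_inv[of "[(i, True)]"]
  by (intro group.inv_equality[OF group_free_group])
    (auto simp: free_group_gen_def carrier_free_group mult_free_group one_free_group word_class_eq_iff word_inv_def)

text \<open>Words grow by one letter on the right, the form in which \<open>bounds_word\<close>
  attaches one triangle per letter.\<close>

lemma free_group_induct [consumes 1, case_names one gen inv_gen]: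
  assumes "x \<in> carrier (free_group I)" and one: "P \<one>\<^bsub>free_group I\<^esub>"
    and gen: "\<And>x i. x \<in> carrier (free_group I) \<Longrightarrow> P x \<Longrightarrow> i \<in> I \<Longrightarrow> P (x \<otimes>\<^bsub>free_group I\<^esub> free_group_gen i)"
    and inv: "\<And>x i. x \<in> carrier (free_group I) \<Longrightarrow> P x \<Longrightarrow> i \<in> I \<Longrightarrow>
                P (x \<otimes>\<^bsub>free_group I\<^esub> inv\<^bsub>free_group I\<^esub> free_group_gen i)"
  shows "P x"
proof -
  obtain u where u: "u \<in> lists (I \<times> UNIV)" "x = word_class u" using assms(1) by (auto simp: carrier_free_group)
  have "P (word_class u)" using u(1)
  proof (induction u rule: rev_induct)
    case Nil
    then show ?case using one by (simp add: one_free_group)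
  next
    case (snoc l u)
    obtain i b where l: "l = (i, b)" "i \<in> I" using snoc.prems by (cases l) auto
    have u: "word_class u \<in> carrier (free_group I)" "P (word_class u)"
      using snoc by (auto simp: carrier_free_group)
    show ?case
      using gen[OF u l(2)] inv[OF u l(2)] l
      by (cases b) (simp_all add: inv_free_group_gen, simp_all add: free_group_gen_def mult_free_group)
  qed
  then show ?thesis using u by simp
qed

subsection \<open>Exponent sums and quadratic Magnus coefficients\<close>

primrec letter_exponent :: "'i \<Rightarrow> 'i \<times> bool \<Rightarrow> int" where
  "letter_exponent i (k, b) = (if k = i then if b then 1 else - 1 else 0)"

primrec word_exponent :: "'i \<Rightarrow> 'i word \<Rightarrow> int" where
  "word_exponent i [] = 0"
| "word_exponent i (l # w) = letter_exponent i l + word_exponent i w"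

text \<open>The Magnus embedding sends a generator \<open>x\<close> to \<open>1 + x\<close> and hence its inverse to
  \<open>1 - x + x\<^sup>2 - \<dots>\<close>; the coefficient of \<open>x\<^sub>i x\<^sub>j\<close> is recorded.\<close>

primrec word_magnus :: "'i \<Rightarrow> 'i \<Rightarrow> 'i word \<Rightarrow> int" where
  "word_magnus i j [] = 0"
| "word_magnus i j (l # w) =
     (if l = (i, False) \<and> i = j then 1 else 0) + word_magnus i j w + letter_exponent i l * word_exponent j w"

lemma word_exponent_append: "word_exponent i (u @ v) = word_exponent i u + word_exponent i v"
  by (induction u) auto

lemma word_magnus_append:
  "word_magnus i j (u @ v) = word_magnus i j u + word_magnus i j v + word_exponent i u * word_exponent j v"
  by (induction u) (auto simp: word_exponent_append algebra_simps)

text \<open>A cancelling pair of a generator and its inverse contributes to the coefficient of the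
  square 1 from the inverse letter and -1 from the product of the two exponents. The exponents are
  carried along because they enter the coefficient of a concatenation.\<close>

lemma word_eq_invariants:
  "word_eq u v \<Longrightarrow> word_exponent i u = word_exponent i v \<and> word_exponent j u = word_exponent j v
     \<and> word_magnus i j u = word_magnus i j v"
proof (induction rule: word_eq.induct)
  case (cancel u k b v)
  show ?case
    by (cases b) (auto simp: word_exponent_append word_magnus_append algebra_simps)
qed auto

definition exponent :: "'i \<Rightarrow> 'i word set \<Rightarrow> int" where
  "exponent i C = word_exponent i (SOME u. u \<in> C)"

definition magnus :: "'i \<Rightarrow> 'i \<Rightarrow> 'i word set \<Rightarrow> int" where
  "magnus i j C = word_magnus i j (SOME u. u \<in> C)"

lemma some_word_class: "word_eq u (SOME v. v \<in> word_class u)"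
  using someI[of "\<lambda>v. v \<in> word_class u" u] by (simp add: word_class_def word_eq.refl)

lemma exponent_class: "exponent i (word_class u) = word_exponent i u"
  using word_eq_invariants[OF some_word_class[of u]] by (simp add: exponent_def)

lemma magnus_class: "magnus i j (word_class u) = word_magnus i j u"
  using word_eq_invariants[OF some_word_class[of u]] by (simp add: magnus_def)

lemma exponent_mult:
  "x \<in> carrier (free_group I) \<Longrightarrow> y \<in> carrier (free_group I) \<Longrightarrow>
    exponent i (x \<otimes>\<^bsub>free_group I\<^esub> y) = exponent i x + exponent i y"
  by (auto simp: carrier_free_group mult_free_group exponent_class word_exponent_append)

lemma magnus_mult:
  "x \<in> carrier (free_group I) \<Longrightarrow> y \<in> carrier (free_group I) \<Longrightarrow>
    magnus i j (x \<otimes>\<^bsub>free_group I\<^esub> y) = magnus i j x + magnus i j y + exponent i x * exponent j y"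
  by (auto simp: carrier_free_group mult_free_group exponent_class magnus_class word_magnus_append)

lemma exponent_one: "exponent i \<one>\<^bsub>free_group I\<^esub> = 0"
  by (simp add: one_free_group exponent_class)

lemma magnus_one: "magnus i j \<one>\<^bsub>free_group I\<^esub> = 0"
  by (simp add: one_free_group magnus_class)

lemma exponent_inv:
  assumes "x \<in> carrier (free_group I)"
  shows "exponent i (inv\<^bsub>free_group I\<^esub> x) = - exponent i x"
proof -
  interpret F: group "free_group I" by (rule group_free_group)
  show ?thesis
    using exponent_mult[of x I "inv\<^bsub>free_group I\<^esub> x" i] assms by (simp add: exponent_one)
qed

lemma magnus_inv:
  assumes "x \<in> carrier (free_group I)"
  shows "magnus i j (inv\<^bsub>free_group I\<^esub> x) = exponent i x * exponent j x - magnus i j x"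
proof -
  interpret F: group "free_group I" by (rule group_free_group)
  show ?thesis
    using magnus_mult[of x I "inv\<^bsub>free_group I\<^esub> x" i j] assms by (simp add: magnus_one exponent_inv)
qed

lemma exponent_gen: "exponent i (free_group_gen k) = (if i = k then 1 else 0)"
  by (auto simp: free_group_gen_def exponent_class)

lemma magnus_gen: "magnus i j (free_group_gen k) = 0"
  by (simp add: free_group_gen_def magnus_class)

text \<open>Compare coefficients in [x,y] y x = x y. Since the commutator has exponent sums zero it
  adds no cross term on the left, so its coefficient is the difference of the cross terms of x y and
  y x.\<close>

lemma magnus_commutator:
  assumes x: "x \<in> carrier (free_group I)" and y: "y \<in> carrier (free_group I)"
  shows "magnus i j (commutator (free_group I) x y) = exponent i x * exponent j y - exponent i y * exponent j x"
    and "exponent i (commutator (free_group I) x y) = 0"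
proof -
  interpret F: group "free_group I" by (rule group_free_group)
  show e: "exponent i (commutator (free_group I) x y) = 0" for i
    using x y by (simp add: commutator_def exponent_mult exponent_inv)
  have "commutator (free_group I) x y \<otimes>\<^bsub>free_group I\<^esub> (y \<otimes>\<^bsub>free_group I\<^esub> x) = x \<otimes>\<^bsub>free_group I\<^esub> y"
    using x y by (simp add: commutator_def F.m_assoc F.inv_solve_left')
  then have "magnus i j (commutator (free_group I) x y \<otimes>\<^bsub>free_group I\<^esub> (y \<otimes>\<^bsub>free_group I\<^esub> x)) =
    magnus i j (x \<otimes>\<^bsub>free_group I\<^esub> y)" by simp
  then show "magnus i j (commutator (free_group I) x y) = exponent i x * exponent j y - exponent i y * exponent j x"
    using x y magnus_mult[of "commutator (free_group I) x y" I "y \<otimes>\<^bsub>free_group I\<^esub> x" i j]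
    by (simp add: magnus_mult e) (simp add: commutator_def)
qed

subsection \<open>The lower central series\<close>

context group
begin

lemma inv_cancel_left: "x \<in> carrier G \<Longrightarrow> y \<in> carrier G \<Longrightarrow> inv x \<otimes> (x \<otimes> y) = y"
  "x \<in> carrier G \<Longrightarrow> y \<in> carrier G \<Longrightarrow> x \<otimes> (inv x \<otimes> y) = y"
  by (simp_all add: m_assoc[symmetric])

text \<open>Right association, inverses moved to single letters and cancellation of neighbours: this
  rewriting brings both sides of the commutator identities below to the same reduced word.\<close>

lemmas group_normalize = commutator_def m_assoc inv_mult_group inv_cancel_left

lemma commutator_closed [simp, intro]: "x \<in> carrier G \<Longrightarrow> y \<in> carrier G \<Longrightarrow> commutator G x y \<in> carrier G"
  by (simp add: commutator_def)

lemma commutator_conj: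
  "x \<in> carrier G \<Longrightarrow> y \<in> carrier G \<Longrightarrow> g \<in> carrier G \<Longrightarrow>
    g \<otimes> commutator G x y \<otimes> inv g = commutator G (g \<otimes> x \<otimes> inv g) (g \<otimes> y \<otimes> inv g)"
  by (simp add: group_normalize)

lemma lower_central_2: "lower_central G 2 = generate G {commutator G x y | x y. x \<in> carrier G \<and> y \<in> carrier G}"
  by (simp add: numeral_2_eq_2)

lemma lower_central_3: "lower_central G 3 = generate G {commutator G x y | x y. x \<in> lower_central G 2 \<and> y \<in> carrier G}"
  by (simp add: numeral_2_eq_2 numeral_3_eq_3)

lemma normal_lower_central_2: "lower_central G 2 \<lhd> G"
  unfolding lower_central_2
proof (rule normal_generateI)
  fix h g assume "h \<in> {commutator G x y | x y. x \<in> carrier G \<and> y \<in> carrier G}" and g: "g \<in> carrier G"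
  then obtain x y where "h = commutator G x y" "x \<in> carrier G" "y \<in> carrier G" by blast
  then show "g \<otimes> h \<otimes> inv g \<in> {commutator G x y | x y. x \<in> carrier G \<and> y \<in> carrier G}"
    using g commutator_conj[of x y g] by blast
qed auto

lemmas subgroup_lower_central_2 = normal_imp_subgroup[OF normal_lower_central_2]

lemmas lower_central_2_closed = subgroup.mem_carrier[OF subgroup_lower_central_2]

lemma normal_lower_central_3: "lower_central G 3 \<lhd> G"
  unfolding lower_central_3
proof (rule normal_generateI)
  show "{commutator G x y | x y. x \<in> lower_central G 2 \<and> y \<in> carrier G} \<subseteq> carrier G"
    using lower_central_2_closed by blast
  fix h g assume "h \<in> {commutator G x y | x y. x \<in> lower_central G 2 \<and> y \<in> carrier G}" and g: "g \<in> carrier G"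
  then obtain x y where xy: "h = commutator G x y" "x \<in> lower_central G 2" "y \<in> carrier G" by blast
  moreover have "g \<otimes> x \<otimes> inv g \<in> lower_central G 2"
    using normal_lower_central_2 xy g by (simp add: normal_inv_iff)
  ultimately show "g \<otimes> h \<otimes> inv g \<in> {commutator G x y | x y. x \<in> lower_central G 2 \<and> y \<in> carrier G}"
    using g commutator_conj[of x y g] lower_central_2_closed by blast
qed

lemmas subgroup_lower_central_3 = normal_imp_subgroup[OF normal_lower_central_3]

lemma lower_central_3_commutator:
  "x \<in> lower_central G 2 \<Longrightarrow> y \<in> carrier G \<Longrightarrow> commutator G x y \<in> lower_central G 3"
  unfolding lower_central_3 by (rule generate.incl) blast

lemma commutator_mem_2: "x \<in> carrier G \<Longrightarrow> y \<in> carrier G \<Longrightarrow> commutator G x y \<in> lower_central G 2"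
  unfolding lower_central_2 by (rule generate.incl) blast

lemma lower_central_3_subset: "lower_central G 3 \<subseteq> lower_central G 2"
proof -
  have "{commutator G x y | x y. x \<in> lower_central G 2 \<and> y \<in> carrier G} \<subseteq> lower_central G 2"
    using lower_central_2_closed commutator_mem_2 by blast
  then show ?thesis
    unfolding lower_central_3 by (rule generate_subgroup_incl[OF _ subgroup_lower_central_2])
qed

lemma lower_central_3_coset_eq:
  assumes "x \<in> carrier G" "y \<in> carrier G" "z \<in> lower_central G 3" "x = z \<otimes> y"
  shows "lower_central G 3 #> x = lower_central G 3 #> y"
proof -
  have "x \<in> lower_central G 3 #> y" using assms by (auto simp: r_coset_def)
  then show ?thesis
    using repr_independence[OF _ assms(2) subgroup_lower_central_3] by simp
qed

abbreviation "gr2 \<equiv> lower_central_quotient G 2"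

lemma gr2_eq: "gr2 = (G\<lparr>carrier := lower_central G 2\<rparr>) Mod lower_central G 3"
  by (simp add: lower_central_quotient_def numeral_2_eq_2 numeral_3_eq_3)

lemma carrier_gr2: "carrier gr2 = (\<lambda>x. lower_central G 3 #> x) ` lower_central G 2"
  unfolding gr2_eq by (auto simp: FactGroup_def RCOSETS_def r_coset_def)

lemma mult_gr2:
  assumes "x \<in> carrier G" "y \<in> carrier G"
  shows "(lower_central G 3 #> x) \<otimes>\<^bsub>gr2\<^esub> (lower_central G 3 #> y) = lower_central G 3 #> (x \<otimes> y)"
  using normal.rcos_sum[OF normal_lower_central_3 assms]
  unfolding gr2_eq by (simp add: FactGroup_def set_mult_def)

lemma one_gr2: "\<one>\<^bsub>gr2\<^esub> = lower_central G 3"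
  unfolding gr2_eq by (simp add: FactGroup_def)

lemma comm_group_gr2: "comm_group gr2"
proof -
  let ?H = "G\<lparr>carrier := lower_central G 2\<rparr>"
  note sg = subgroup_lower_central_2
  have "group ?H" using sg by (rule subgroup_imp_group)
  moreover have "lower_central G 3 \<lhd> ?H"
    using normal_restrict_supergroup[OF sg normal_lower_central_3 lower_central_3_subset] .
  ultimately have "group gr2" unfolding gr2_eq by (simp add: normal.factorgroup_is_group)
  moreover have "x \<otimes>\<^bsub>gr2\<^esub> y = y \<otimes>\<^bsub>gr2\<^esub> x" if xy: "x \<in> carrier gr2" "y \<in> carrier gr2" for x y
  proof -
    obtain a b where ab: "a \<in> lower_central G 2" "b \<in> lower_central G 2"
      "x = lower_central G 3 #> a" "y = lower_central G 3 #> b"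
      using xy by (auto simp: carrier_gr2)
    have c: "a \<in> carrier G" "b \<in> carrier G" using ab lower_central_2_closed by auto
    have "a \<otimes> b = commutator G a b \<otimes> (b \<otimes> a)" using c by (simp add: group_normalize)
    then show ?thesis
      using ab c lower_central_3_coset_eq[of "a \<otimes> b" "b \<otimes> a"] lower_central_3_commutator[of a b]
      by (simp add: mult_gr2)
  qed
  ultimately show ?thesis by (simp add: group.group_comm_groupI)
qed

lemma inv_gr2:
  assumes "x \<in> lower_central G 2"
  shows "inv\<^bsub>gr2\<^esub> (lower_central G 3 #> x) = lower_central G 3 #> inv x"
proof -
  interpret gr: comm_group gr2 by (rule comm_group_gr2)
  note sg = subgroup_lower_central_2 subgroup_lower_central_3
  have x: "x \<in> carrier G" "inv x \<in> lower_central G 2"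
    using assms lower_central_2_closed subgroup.m_inv_closed[OF sg(1)] by auto
  show ?thesis
    using x assms subgroup.one_closed[OF sg(2)] coset_join2[OF one_closed sg(2)]
    by (intro gr.inv_equality) (simp_all add: mult_gr2 one_gr2 carrier_gr2)
qed

text \<open>\<open>lower_central\<close> has the deeper factor on the left; inverting a commutator
  exchanges its factors.\<close>

lemma commutator_mem_3_right:
  assumes "x \<in> carrier G" "y \<in> lower_central G 2"
  shows "commutator G x y \<in> lower_central G 3"
proof -
  have y: "y \<in> carrier G" using assms lower_central_2_closed by auto
  have "commutator G x y = inv (commutator G y x)" using assms y by (simp add: group_normalize)
  then show ?thesis
    using lower_central_3_commutator[OF assms(2,1)] subgroup.m_inv_closed[OF subgroup_lower_central_3] by simp
qed

lemma gr2_commutator_mult_left: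
  assumes "x \<in> carrier G" "y \<in> carrier G" "z \<in> carrier G"
  shows "lower_central G 3 #> commutator G (x \<otimes> y) z =
    (lower_central G 3 #> commutator G x z) \<otimes>\<^bsub>gr2\<^esub> (lower_central G 3 #> commutator G y z)"
proof -
  interpret gr: comm_group gr2 by (rule comm_group_gr2)
  \<comment> \<open>This is [xy,z] = x [y,z] x^-1 [x,z] with the conjugate rewritten as [x,[y,z]]
    [y,z]. The double commutator lies in the third term and disappears in the quotient.\<close>
  have "commutator G (x \<otimes> y) z =
      commutator G x (commutator G y z) \<otimes> (commutator G y z \<otimes> commutator G x z)"
    using assms by (simp add: group_normalize)
  then have "lower_central G 3 #> commutator G (x \<otimes> y) z = lower_central G 3 #> (commutator G y z \<otimes> commutator G x z)"
    using assms commutator_mem_3_right commutator_mem_2 by (intro lower_central_3_coset_eq) auto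
  also have "\<dots> = (lower_central G 3 #> commutator G y z) \<otimes>\<^bsub>gr2\<^esub> (lower_central G 3 #> commutator G x z)"
    using assms by (simp add: mult_gr2)
  also have "\<dots> = (lower_central G 3 #> commutator G x z) \<otimes>\<^bsub>gr2\<^esub> (lower_central G 3 #> commutator G y z)"
    using assms by (intro gr.m_comm) (auto simp: carrier_gr2 commutator_mem_2)
  finally show ?thesis .
qed

lemma gr2_commutator_swap:
  assumes "x \<in> carrier G" "y \<in> carrier G"
  shows "lower_central G 3 #> commutator G y x = inv\<^bsub>gr2\<^esub> (lower_central G 3 #> commutator G x y)"
proof -
  have "commutator G y x = inv (commutator G x y)" using assms by (simp add: group_normalize)
  then show ?thesis using assms by (simp add: inv_gr2 commutator_mem_2)
qed

lemma gr2_commutator_self: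
  assumes "x \<in> carrier G"
  shows "lower_central G 3 #> commutator G x x = \<one>\<^bsub>gr2\<^esub>"
proof -
  have "commutator G x x = \<one>" using assms by (simp add: group_normalize)
  then show ?thesis
    using subgroup.one_closed[OF subgroup_lower_central_3] coset_join2[OF one_closed subgroup_lower_central_3]
    by (simp add: one_gr2)
qed

lemma derived_eq_lower_central_2: "derived G (carrier G) = lower_central G 2"
proof -
  have "derived_set G (carrier G) = {commutator G x y | x y. x \<in> carrier G \<and> y \<in> carrier G}"
    by (auto simp: commutator_def)
  then show ?thesis by (simp add: derived_def lower_central_2)
qed

end

section \<open>Alternating sums\<close>

definition ordered_pairs :: "'i::linorder set \<Rightarrow> ('i \<times> 'i) set" where
  "ordered_pairs I = {(i, j). i \<in> I \<and> j \<in> I \<and> i < j}"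

text \<open>For alternating b and antisymmetric m the full double sum is twice this value. Selecting
  one of each two index pairs by a linear order avoids a division by two, which an abelian group
  does not offer.\<close>

definition alt_sum :: "('a, 'b) monoid_scheme \<Rightarrow> ('i::linorder \<Rightarrow> 'i \<Rightarrow> 'a) \<Rightarrow> 'i set \<Rightarrow> ('i \<Rightarrow> 'i \<Rightarrow> int) \<Rightarrow> 'a" where
  "alt_sum A b I m = finprod A (\<lambda>(i, j). b i j [^]\<^bsub>A\<^esub> m i j) (ordered_pairs I)"

lemma finite_ordered_pairs: "finite I \<Longrightarrow> finite (ordered_pairs I)"
  by (rule finite_subset[of _ "I \<times> I"]) (auto simp: ordered_pairs_def)

context comm_group
begin

lemma alt_sum_closed:
  assumes "\<And>i j. i \<in> I \<Longrightarrow> j \<in> I \<Longrightarrow> b i j \<in> carrier G"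
  shows "alt_sum G b I m \<in> carrier G"
  unfolding alt_sum_def using assms by (intro finprod_closed) (auto simp: ordered_pairs_def)

lemma alt_sum_cong:
  assumes "\<And>i j. i \<in> I \<Longrightarrow> j \<in> I \<Longrightarrow> b i j \<in> carrier G"
    and "\<And>i j. i \<in> I \<Longrightarrow> j \<in> I \<Longrightarrow> m i j = m' i j"
  shows "alt_sum G b I m = alt_sum G b I m'"
  unfolding alt_sum_def using assms by (intro finprod_cong') (auto simp: ordered_pairs_def)

lemma alt_sum_add:
  assumes "\<And>i j. i \<in> I \<Longrightarrow> j \<in> I \<Longrightarrow> b i j \<in> carrier G"
  shows "alt_sum G b I (\<lambda>i j. m i j + m' i j) = alt_sum G b I m \<otimes> alt_sum G b I m'"
proof -
  have "finprod G (\<lambda>(i, j). b i j [^] (m i j + m' i j)) (ordered_pairs I) =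
    finprod G (\<lambda>p. (case p of (i, j) \<Rightarrow> b i j [^] m i j) \<otimes> (case p of (i, j) \<Rightarrow> b i j [^] m' i j)) (ordered_pairs I)"
    using assms by (intro finprod_cong') (auto simp: ordered_pairs_def int_pow_mult)
  also have "\<dots> = alt_sum G b I m \<otimes> alt_sum G b I m'"
    unfolding alt_sum_def using assms by (intro finprod_multf) (auto simp: ordered_pairs_def)
  finally show ?thesis by (simp add: alt_sum_def)
qed

lemma alt_sum_zero:
  assumes "\<And>i j. i \<in> I \<Longrightarrow> j \<in> I \<Longrightarrow> b i j \<in> carrier G"
  shows "alt_sum G b I (\<lambda>i j. 0) = \<one>"
  unfolding alt_sum_def by (intro finprod_one_eqI) auto

lemma alt_sum_neg:
  assumes "\<And>i j. i \<in> I \<Longrightarrow> j \<in> I \<Longrightarrow> b i j \<in> carrier G"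
  shows "alt_sum G b I (\<lambda>i j. - m i j) = inv (alt_sum G b I m)"
  using alt_sum_add[of I b "\<lambda>i j. - m i j" m] alt_sum_zero[of I b] alt_sum_closed[of I b] assms
  by (intro inv_equality[symmetric]) auto

text \<open>The antisymmetrized unit matrix picks out b k l in whichever order k and l stand: for l
  < k the only entry that counts is -1 at (l, k), and the inverse of b l k is b k l; for k = l the
  matrix is zero and b k k is trivial.\<close>

lemma alt_sum_single:
  assumes "finite I" "k \<in> I" "l \<in> I" "\<And>i j. i \<in> I \<Longrightarrow> j \<in> I \<Longrightarrow> b i j \<in> carrier G"
    and "\<And>i. i \<in> I \<Longrightarrow> b i i = \<one>" "\<And>i j. i \<in> I \<Longrightarrow> j \<in> I \<Longrightarrow> b j i = inv (b i j)"
  shows "alt_sum G b I (\<lambda>i j. (if i = k \<and> j = l then 1 else 0) - (if i = l \<and> j = k then 1 else 0)) = b k l"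
proof -
  have single: "alt_sum G b I (\<lambda>i j. (if i = k \<and> j = l then 1 else 0)) = b k l"
    if "k < l" "k \<in> I" "l \<in> I" for k l
  proof -
    have "alt_sum G b I (\<lambda>i j. (if i = k \<and> j = l then 1 else 0)) =
        finprod G (\<lambda>p. if (k, l) = p then (case p of (i, j) \<Rightarrow> b i j) else \<one>) (ordered_pairs I)"
      unfolding alt_sum_def using assms(4) by (intro finprod_cong') (auto simp: ordered_pairs_def split: if_splits)
    also have "\<dots> = b k l"
      using assms(4) that finite_ordered_pairs[OF assms(1)] by (subst finprod_singleton) (auto simp: ordered_pairs_def)
    finally show ?thesis .
  qed
  have zero: "alt_sum G b I (\<lambda>i j. (if i = k \<and> j = l then 1 else 0)) = \<one>" if "\<not> k < l" for k l
    unfolding alt_sum_def using that by (intro finprod_one_eqI) (auto simp: ordered_pairs_def)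
  have "alt_sum G b I (\<lambda>i j. (if i = k \<and> j = l then 1 else 0) - (if i = l \<and> j = k then 1 else 0)) =
    alt_sum G b I (\<lambda>i j. (if i = k \<and> j = l then 1 else 0)) \<otimes> inv (alt_sum G b I (\<lambda>i j. (if i = l \<and> j = k then 1 else 0)))"
    using alt_sum_add[of I b "\<lambda>i j. (if i = k \<and> j = l then 1 else 0)" "\<lambda>i j. - (if i = l \<and> j = k then 1 else 0)"]
      alt_sum_neg[of I b] assms(4) by simp
  also have "\<dots> = b k l"
  proof (cases k l rule: linorder_cases)
    case less
    then show ?thesis using single[of k l] zero[of l k] assms(2-4) by simp
  next
    case equal
    then show ?thesis using zero[of k k] assms(2,5) by simp
  next
    case greater
    then show ?thesis using single[of l k] zero[of k l] assms(2,3,4) assms(6)[of l k] by simp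
  qed
  finally show ?thesis .
qed

end

lemma hom_finprod:
  assumes "comm_group G" "comm_group H" "h \<in> hom G H" "f \<in> A \<rightarrow> carrier G"
  shows "h (finprod G f A) = finprod H (\<lambda>x. h (f x)) A"
proof -
  interpret G: comm_group G by fact
  interpret H: comm_group H by fact
  interpret h: group_hom G H h using assms(3) by unfold_locales
  show ?thesis
    using assms(4)
  proof (induction A rule: infinite_finite_induct)
    case (insert x A)
    then have "(\<lambda>x. h (f x)) \<in> A \<rightarrow> carrier H" "h (f x) \<in> carrier H" by (auto simp: Pi_iff)
    then show ?case using insert by (subst G.finprod_insert) (auto simp: h.hom_mult)
  qed auto
qed

lemma hom_alt_sum:
  assumes "comm_group G" "comm_group H" "h \<in> hom G H" "\<And>i j. i \<in> I \<Longrightarrow> j \<in> I \<Longrightarrow> b i j \<in> carrier G"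
  shows "h (alt_sum G b I m) = alt_sum H (\<lambda>i j. h (b i j)) I m"
proof -
  interpret G: comm_group G by fact
  interpret H: comm_group H by fact
  interpret h: group_hom G H h using assms(3) by unfold_locales
  have "h (alt_sum G b I m) = finprod H (\<lambda>p. h (case p of (i, j) \<Rightarrow> b i j [^]\<^bsub>G\<^esub> m i j)) (ordered_pairs I)"
    unfolding alt_sum_def using assms by (intro hom_finprod) (auto simp: ordered_pairs_def)
  also have "\<dots> = alt_sum H (\<lambda>i j. h (b i j)) I m"
    unfolding alt_sum_def using assms(4)
    by (intro H.finprod_cong') (auto simp: ordered_pairs_def h.hom_int_pow)
  finally show ?thesis .
qed

section \<open>The quadratic part of the free Lie algebra\<close>

definition quadratic_bracketings :: "'i set \<Rightarrow> 'i bracketing set" where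
  "quadratic_bracketings I = {t. set_bracketing t \<subseteq> I \<and> bracket_length t = 2}"

lemma bracket_length_pos: "bracket_length t \<ge> 1"
  by (induction t) auto

lemma quadratic_bracketings_eq:
  fixes I :: "'i set"
  shows "quadratic_bracketings I = {Br (Leaf i) (Leaf j) | i j. i \<in> I \<and> j \<in> I}"
proof -
  have one: "\<exists>i\<in>I. t = Leaf i" if "bracket_length t = 1" "set_bracketing t \<subseteq> I" for t :: "'i bracketing"
    using that
  proof (cases t)
    case (Br s u)
    then show ?thesis using that bracket_length_pos[of s] bracket_length_pos[of u] by simp
  qed auto
  show ?thesis
  proof
    show "quadratic_bracketings I \<subseteq> {Br (Leaf i) (Leaf j) | i j. i \<in> I \<and> j \<in> I}"
    proof
      fix t assume "t \<in> quadratic_bracketings I"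
      then have t: "set_bracketing t \<subseteq> I" "bracket_length t = 2" by (auto simp: quadratic_bracketings_def)
      then obtain s u where su: "t = Br s u" by (cases t) auto
      have "bracket_length s = 1" "bracket_length u = 1"
        using t su bracket_length_pos[of s] bracket_length_pos[of u] by auto
      then show "t \<in> {Br (Leaf i) (Leaf j) | i j. i \<in> I \<and> j \<in> I}"
        using one[of s] one[of u] t su by auto
    qed
  qed (auto simp: quadratic_bracketings_def)
qed

text \<open>The coefficient of [y_i, y_j], i < j, once [y_j, y_i] is replaced by -[y_i, y_j]. It is
  the invariant of a degree-two element modulo the Lie identities.\<close>

definition leaf_antisym :: "('i bracketing \<Rightarrow>\<^sub>0 int) \<Rightarrow> 'i \<Rightarrow> 'i \<Rightarrow> int" where
  "leaf_antisym c i j =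
     Poly_Mapping.lookup c (Br (Leaf i) (Leaf j)) - Poly_Mapping.lookup c (Br (Leaf j) (Leaf i))"

lemma leaf_antisym_add: "leaf_antisym (c + d) i j = leaf_antisym c i j + leaf_antisym d i j"
  and leaf_antisym_minus: "leaf_antisym (c - d) i j = leaf_antisym c i j - leaf_antisym d i j"
  and leaf_antisym_zero: "leaf_antisym 0 i j = 0"
  by (simp_all add: leaf_antisym_def lookup_add lookup_minus)

lemma leaf_antisym_of:
  "leaf_antisym (frag_of (Br (Leaf k) (Leaf l))) i j =
     (if i = k \<and> j = l then 1 else 0) - (if i = l \<and> j = k then 1 else 0)"
  by (auto simp: leaf_antisym_def)

text \<open>Applied below both to the evaluation in the lower central quotient and to the class in
  the free Lie algebra. Since both then depend on \<open>leaf_antisym\<close> alone, the two can be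
  compared through it.\<close>

lemma hom_quadratic_alt_sum:
  fixes I :: "'i::linorder set"
  assumes A: "comm_group A" and h: "h \<in> hom (free_Abelian_group (quadratic_bracketings I)) A" and I: "finite I"
    and b: "\<And>i j. i \<in> I \<Longrightarrow> j \<in> I \<Longrightarrow> h (frag_of (Br (Leaf i) (Leaf j))) = b i j"
    and self: "\<And>i. i \<in> I \<Longrightarrow> b i i = \<one>\<^bsub>A\<^esub>"
    and swap: "\<And>i j. i \<in> I \<Longrightarrow> j \<in> I \<Longrightarrow> b j i = inv\<^bsub>A\<^esub> (b i j)"
    and c: "Poly_Mapping.keys c \<subseteq> quadratic_bracketings I"
  shows "h c = alt_sum A b I (leaf_antisym c)"
proof -
  interpret A: comm_group A by fact
  have mem: "Br (Leaf i) (Leaf j) \<in> quadratic_bracketings I" if "i \<in> I" "j \<in> I" for i j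
    using that by (simp add: quadratic_bracketings_eq)
  have closed: "b i j \<in> carrier A" if "i \<in> I" "j \<in> I" for i j
    using hom_in_carrier[OF h, of "frag_of (Br (Leaf i) (Leaf j))"] mem[OF that] b[OF that]
    by (simp add: keys_frag_of)
  show ?thesis
  proof (rule hom_free_Abelian_group_eq[OF A h _ _ c])
    show "(\<lambda>c. alt_sum A b I (leaf_antisym c)) \<in> hom (free_Abelian_group (quadratic_bracketings I)) A"
      using closed A.alt_sum_add[of I b "leaf_antisym c" for c]
      by (intro homI) (simp_all add: A.alt_sum_closed leaf_antisym_add[abs_def])
    fix s assume "s \<in> quadratic_bracketings I"
    then obtain k l where kl: "k \<in> I" "l \<in> I" "s = Br (Leaf k) (Leaf l)" by (auto simp: quadratic_bracketings_eq)
    have "alt_sum A b I (leaf_antisym (frag_of s)) = b k l"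
      unfolding kl(3) leaf_antisym_of
      using A.alt_sum_single[OF I kl(1,2), of b] closed self swap by blast
    then show "h (frag_of s) = alt_sum A b I (leaf_antisym (frag_of s))" using kl b by simp
  qed
qed

lemma lookup_bracket:
  "Poly_Mapping.lookup (bracket (free_nonassoc I) c d) (Leaf i) = 0"
  "Poly_Mapping.lookup (bracket (free_nonassoc I) c d) (Br s t) = Poly_Mapping.lookup c s * Poly_Mapping.lookup d t"
proof -
  have inner: "Poly_Mapping.lookup (frag_extend (\<lambda>t. frag_of (Br s t)) d) u =
      (case u of Leaf i \<Rightarrow> 0 | Br s' t \<Rightarrow> if s' = s then Poly_Mapping.lookup d t else 0)" for s u
  proof (cases u)
    case (Br s' t)
    have "Poly_Mapping.lookup (frag_extend (\<lambda>t. frag_of (Br s t)) d) u =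
        (\<Sum>x\<in>Poly_Mapping.keys d. if x = t then (if s' = s then Poly_Mapping.lookup d t else 0) else 0)"
      unfolding frag_extend_def lookup_sum Br by (intro sum.cong) auto
    then show ?thesis by (auto simp: Br in_keys_iff)
  qed (auto simp: frag_extend_def lookup_sum intro!: sum.neutral)
  have outer: "Poly_Mapping.lookup (bracket (free_nonassoc I) c d) u =
     (\<Sum>s\<in>Poly_Mapping.keys c. Poly_Mapping.lookup c s *
       (case u of Leaf i \<Rightarrow> 0 | Br s' t \<Rightarrow> if s' = s then Poly_Mapping.lookup d t else 0))" for u
    unfolding free_nonassoc_def by (simp add: frag_extend_def[of "\<lambda>s. frag_extend (\<lambda>t. frag_of (Br s t)) d"] lookup_sum inner)
  show "Poly_Mapping.lookup (bracket (free_nonassoc I) c d) (Leaf i) = 0"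
    by (simp add: outer)
  have "Poly_Mapping.lookup (bracket (free_nonassoc I) c d) (Br s t) =
    (\<Sum>x\<in>Poly_Mapping.keys c. if x = s then Poly_Mapping.lookup c s * Poly_Mapping.lookup d t else 0)"
    unfolding outer by (intro sum.cong) auto
  then show "Poly_Mapping.lookup (bracket (free_nonassoc I) c d) (Br s t) = Poly_Mapping.lookup c s * Poly_Mapping.lookup d t"
    by (auto simp: in_keys_iff)
qed

lemma lie_identities_leaf_antisym:
  assumes "c \<in> ideal_generated (free_nonassoc I) (lie_identities I)"
  shows "leaf_antisym c i j = 0"
proof -
  let ?N = "free_nonassoc I"
  interpret N: graded_nring ?N by (rule graded_nring_free_nonassoc)
  \<comment> \<open>The leaf coefficients are required to vanish as well: by \<open>br\<close> the
    antisymmetrized coefficients of a bracket are determinants of leaf coefficients of its factors,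
    so this condition is what makes the set absorb brackets.\<close>
  let ?Z = "{c \<in> carrier ?N. (\<forall>i. Poly_Mapping.lookup c (Leaf i) = 0) \<and> (\<forall>i j. leaf_antisym c i j = 0)}"
  have br: "Poly_Mapping.lookup (bracket ?N x y) (Leaf i) = 0"
    "leaf_antisym (bracket ?N x y) i j = Poly_Mapping.lookup x (Leaf i) * Poly_Mapping.lookup y (Leaf j) -
        Poly_Mapping.lookup x (Leaf j) * Poly_Mapping.lookup y (Leaf i)" for x y i j
    by (simp_all add: lookup_bracket leaf_antisym_def)
  have "lie_ideal ?Z ?N"
    unfolding lie_ideal_def
  proof
    show "subgroup ?Z ?N"
    proof (rule N.subgroupI)
      have "0 \<in> ?Z" using N.one_closed by (simp add: free_nonassoc_simps(1) leaf_antisym_zero)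
      then show "?Z \<noteq> {}" by blast
      fix a assume "a \<in> ?Z"
      then have a: "a \<in> carrier ?N" "\<And>i. Poly_Mapping.lookup a (Leaf i) = 0" "\<And>i j. leaf_antisym a i j = 0" by auto
      have "leaf_antisym (- a) i j = 0" for i j
        using leaf_antisym_minus[of 0 a i j] a(3) by (simp add: leaf_antisym_zero)
      then show "inv\<^bsub>?N\<^esub> a \<in> ?Z"
        using N.inv_closed[OF a(1)] a by (simp add: inv_free_nonassoc)
      fix b assume "b \<in> ?Z"
      then show "a \<otimes>\<^bsub>?N\<^esub> b \<in> ?Z"
        using N.m_closed[OF a(1), of b] a by (simp add: free_nonassoc_simps(2) lookup_add leaf_antisym_add)
    qed auto
    show "\<forall>x\<in>carrier ?N. \<forall>y\<in>?Z. bracket ?N x y \<in> ?Z \<and> bracket ?N y x \<in> ?Z"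
      by (auto simp: br)
  qed
  moreover have "lie_identities I \<subseteq> ?Z"
  proof
    fix s assume s: "s \<in> lie_identities I"
    then have sN: "s \<in> carrier ?N" using lie_identities_carrier by blast
    consider u where "s = bracket ?N u u"
      | u v w where "s = bracket ?N u (bracket ?N v w) + bracket ?N v (bracket ?N w u) + bracket ?N w (bracket ?N u v)"
      using s unfolding lie_identities_def Let_def by blast
    then show "s \<in> ?Z"
      using sN by cases (simp_all add: br leaf_antisym_add lookup_add)
  qed
  ultimately have "ideal_generated ?N (lie_identities I) \<subseteq> ?Z" by (rule N.ideal_generated_minimal)
  then show ?thesis using assms by blast
qed

subsection \<open>Magnus coefficients on the commutator subgroup\<close>

lemma free_group_subgroup_all:
  assumes S: "subgroup S (free_group I)" and gen: "\<And>i. i \<in> I \<Longrightarrow> free_group_gen i \<in> S"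
    and x: "x \<in> carrier (free_group I)"
  shows "x \<in> S"
  using x
proof (induction x rule: free_group_induct)
  case one
  then show ?case by (rule subgroup.one_closed[OF S])
next
  case (gen x i)
  then show ?case using subgroup.m_closed[OF S] assms(2) by simp
next
  case (inv_gen x i)
  then show ?case using subgroup.m_closed[OF S] subgroup.m_inv_closed[OF S] assms(2) by simp
qed

text \<open>Zero exponent sums remove the cross terms in \<open>magnus_mult\<close>, so
  antisymmetry, which commutators have by \<open>magnus_commutator\<close>, passes to products and
  inverses. Hence the joint induction.\<close>

lemma lower_central_2_invariants:
  assumes "r \<in> lower_central (free_group I) 2"
  shows "exponent i r = 0" "magnus j i r = - magnus i j r"
proof -
  let ?F = "free_group I"
  interpret F: group ?F by (rule group_free_group)
  have "r \<in> carrier ?F \<and> exponent i r = 0 \<and> exponent j r = 0 \<and> magnus j i r = - magnus i j r"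
    using assms unfolding F.lower_central_2
  proof (induction rule: generate.induct)
    case one
    then show ?case by (simp add: exponent_one magnus_one)
  next
    case (incl h)
    then show ?case by (auto simp: magnus_commutator)
  next
    case (inv h)
    then obtain x y where xy: "h = commutator ?F x y" "x \<in> carrier ?F" "y \<in> carrier ?F" by blast
    then have "h \<in> carrier ?F" by simp
    then show ?case using xy by (simp add: exponent_inv magnus_inv magnus_commutator)
  next
    case (eng h1 h2)
    then show ?case by (simp add: exponent_mult magnus_mult)
  qed
  then show "exponent i r = 0" "magnus j i r = - magnus i j r" by auto
qed

lemma magnus_mult_2:
  assumes "r \<in> lower_central (free_group I) 2" "x \<in> carrier (free_group I)"
  shows "magnus i j (r \<otimes>\<^bsub>free_group I\<^esub> x) = magnus i j r + magnus i j x"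
  using assms group.lower_central_2_closed[OF group_free_group assms(1)]
  by (simp add: magnus_mult lower_central_2_invariants(1))

lemma magnus_inv_2:
  assumes "r \<in> lower_central (free_group I) 2"
  shows "magnus i j (inv\<^bsub>free_group I\<^esub> r) = - magnus i j r"
  using assms group.lower_central_2_closed[OF group_free_group assms(1)]
  by (simp add: magnus_inv lower_central_2_invariants(1))

lemma magnus_conj_2:
  assumes r: "r \<in> lower_central (free_group I) 2" and g: "g \<in> carrier (free_group I)"
  shows "magnus i j (g \<otimes>\<^bsub>free_group I\<^esub> r \<otimes>\<^bsub>free_group I\<^esub> inv\<^bsub>free_group I\<^esub> g) = magnus i j r"
proof -
  interpret F: group "free_group I" by (rule group_free_group)
  have "r \<in> carrier (free_group I)" using F.lower_central_2_closed[OF r] .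
  then show ?thesis
    using g lower_central_2_invariants(1)[OF r] by (simp add: magnus_mult magnus_inv exponent_mult exponent_inv)
qed

text \<open>The coefficient of a commutator is a determinant of exponent sums, and those of a factor
  from the commutator subgroup are zero.\<close>

lemma lower_central_3_magnus:
  assumes "r \<in> lower_central (free_group I) 3"
  shows "magnus i j r = 0"
proof -
  let ?F = "free_group I"
  interpret F: group ?F by (rule group_free_group)
  have com: "magnus i j (commutator ?F x y) = 0" "commutator ?F x y \<in> lower_central ?F 2"
    if "x \<in> lower_central ?F 2" "y \<in> carrier ?F" for x y
    using that F.lower_central_2_closed by (auto simp: magnus_commutator lower_central_2_invariants(1) F.commutator_mem_2)
  have "r \<in> lower_central ?F 2 \<and> magnus i j r = 0"
    using assms unfolding F.lower_central_3
  proof (induction rule: generate.induct)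
    case one
    then show ?case by (simp add: magnus_one subgroup.one_closed[OF F.subgroup_lower_central_2])
  next
    case (incl h)
    then show ?case using com by auto
  next
    case (inv h)
    then show ?case using com subgroup.m_inv_closed[OF F.subgroup_lower_central_2] by (auto simp: magnus_inv_2)
  next
    case (eng h1 h2)
    then show ?case
      using subgroup.m_closed[OF F.subgroup_lower_central_2] F.lower_central_2_closed by (simp add: magnus_mult_2)
  qed
  then show ?thesis by simp
qed

lemma magnus_coset_eq:
  assumes r: "r \<in> lower_central (free_group I) 2" and s: "s \<in> lower_central (free_group I) 2"
    and eq: "lower_central (free_group I) 3 #>\<^bsub>free_group I\<^esub> r = lower_central (free_group I) 3 #>\<^bsub>free_group I\<^esub> s"
  shows "magnus i j r = magnus i j s"
proof -
  interpret F: group "free_group I" by (rule group_free_group)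
  have "r \<in> lower_central (free_group I) 3 #>\<^bsub>free_group I\<^esub> s"
    using F.rcos_self[OF F.lower_central_2_closed[OF r] F.subgroup_lower_central_3] eq by simp
  then obtain z where z: "z \<in> lower_central (free_group I) 3" "r = z \<otimes>\<^bsub>free_group I\<^esub> s"
    unfolding r_coset_def by blast
  then have "z \<in> lower_central (free_group I) 2" using F.lower_central_3_subset by blast
  then show ?thesis
    using z F.lower_central_2_closed[OF s] by (simp add: magnus_mult_2 lower_central_3_magnus)
qed

subsection \<open>The identification in degree two\<close>

definition gr2_eval :: "'i set \<Rightarrow> ('i bracketing \<Rightarrow>\<^sub>0 int) \<Rightarrow> 'i word set set" where
  "gr2_eval I = frag_lift (lower_central_quotient (free_group I) 2)
     (\<lambda>t. lower_central (free_group I) 3 #>\<^bsub>free_group I\<^esub> bracketing_commutator (free_group I) free_group_gen t)"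

lemma free_lie_to_gr_2:
  "free_lie_to_gr I 2 C = the_elem (gr2_eval I ` (C \<inter> degree_part (free_nonassoc I) 2))"
  by (simp add: free_lie_to_gr_def gr2_eval_def)

lemma degree_part_2: "degree_part (free_nonassoc I) 2 = {c. Poly_Mapping.keys c \<subseteq> quadratic_bracketings I}"
  by (simp add: free_nonassoc_def quadratic_bracketings_def)

lemma gr2_eval_hom:
  "gr2_eval I \<in> hom (free_Abelian_group (quadratic_bracketings I)) (lower_central_quotient (free_group I) 2)"
  and gr2_eval_of: "i \<in> I \<Longrightarrow> j \<in> I \<Longrightarrow> gr2_eval I (frag_of (Br (Leaf i) (Leaf j))) =
     lower_central (free_group I) 3 #>\<^bsub>free_group I\<^esub> commutator (free_group I) (free_group_gen i) (free_group_gen j)"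
proof -
  interpret F: group "free_group I" by (rule group_free_group)
  interpret gr: comm_group "lower_central_quotient (free_group I) 2" by (rule F.comm_group_gr2)
  have cl: "lower_central (free_group I) 3 #>\<^bsub>free_group I\<^esub> commutator (free_group I) (free_group_gen i) (free_group_gen j)
      \<in> carrier (lower_central_quotient (free_group I) 2)" if "i \<in> I" "j \<in> I" for i j
    unfolding F.carrier_gr2 by (intro imageI F.commutator_mem_2 free_group_gen_closed that)
  show "gr2_eval I \<in> hom (free_Abelian_group (quadratic_bracketings I)) (lower_central_quotient (free_group I) 2)"
    unfolding gr2_eval_def by (rule gr.frag_lift_hom) (auto simp: quadratic_bracketings_eq cl)
  show "gr2_eval I (frag_of (Br (Leaf i) (Leaf j))) =
     lower_central (free_group I) 3 #>\<^bsub>free_group I\<^esub> commutator (free_group I) (free_group_gen i) (free_group_gen j)"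
    if "i \<in> I" "j \<in> I"
    unfolding gr2_eval_def using cl[OF that] by (subst gr.frag_lift_of) auto
qed

text \<open>This will give injectivity in degree two: by \<open>magnus_coset_eq\<close> the coset
  determines the Magnus coefficients of r, and these are the antisymmetrized coefficients of
  c.\<close>

lemma gr2_eval_magnus:
  assumes "Poly_Mapping.keys c \<subseteq> quadratic_bracketings I"
  obtains r where "r \<in> lower_central (free_group I) 2"
    "gr2_eval I c = lower_central (free_group I) 3 #>\<^bsub>free_group I\<^esub> r"
    "\<And>i j. magnus i j r = leaf_antisym c i j"
proof -
  let ?F = "free_group I" and ?Q = "lower_central_quotient (free_group I) 2"
  interpret F: group ?F by (rule group_free_group)
  interpret gr: comm_group ?Q by (rule F.comm_group_gr2)
  interpret h: group_hom "free_Abelian_group (quadratic_bracketings I)" ?Q "gr2_eval I"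
    by (simp add: group_hom_def group_hom_axioms_def gr2_eval_hom gr.group_axioms)
  have "Poly_Mapping.keys c \<subseteq> quadratic_bracketings I \<and> (\<exists>r\<in>lower_central ?F 2. gr2_eval I c = lower_central ?F 3 #>\<^bsub>?F\<^esub> r \<and>
      (\<forall>i j. magnus i j r = leaf_antisym c i j))"
    using assms
  proof (induction c rule: frag_induction)
    case zero
    have "gr2_eval I 0 = lower_central ?F 3 #>\<^bsub>?F\<^esub> \<one>\<^bsub>?F\<^esub>"
      using h.hom_one F.coset_join2[OF F.one_closed F.subgroup_lower_central_3]
        subgroup.one_closed[OF F.subgroup_lower_central_3] by (simp add: F.one_gr2)
    then show ?case
      using subgroup.one_closed[OF F.subgroup_lower_central_2]
      by (intro conjI bexI[of _ "\<one>\<^bsub>?F\<^esub>"]) (simp_all add: magnus_one leaf_antisym_zero)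
  next
    case (one t)
    then obtain k l where kl: "k \<in> I" "l \<in> I" "t = Br (Leaf k) (Leaf l)" by (auto simp: quadratic_bracketings_eq)
    then show ?case
      using one free_group_gen_closed[of _ I]
      by (intro conjI bexI[of _ "commutator ?F (free_group_gen k) (free_group_gen l)"])
        (auto simp: keys_frag_of gr2_eval_of leaf_antisym_of magnus_commutator exponent_gen F.commutator_mem_2)
  next
    case (diff a b)
    then obtain r s where r: "r \<in> lower_central ?F 2" "gr2_eval I a = lower_central ?F 3 #>\<^bsub>?F\<^esub> r"
        "\<And>i j. magnus i j r = leaf_antisym a i j"
      and s: "s \<in> lower_central ?F 2" "gr2_eval I b = lower_central ?F 3 #>\<^bsub>?F\<^esub> s"
        "\<And>i j. magnus i j s = leaf_antisym b i j" by blast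
    have k: "Poly_Mapping.keys a \<subseteq> quadratic_bracketings I" "Poly_Mapping.keys b \<subseteq> quadratic_bracketings I"
      using diff by auto
    have s': "inv\<^bsub>?F\<^esub> s \<in> lower_central ?F 2"
      using subgroup.m_inv_closed[OF F.subgroup_lower_central_2 s(1)] .
    have cl: "r \<in> carrier ?F" "s \<in> carrier ?F" using r s F.lower_central_2_closed by auto
    have "gr2_eval I (a - b) = gr2_eval I a \<otimes>\<^bsub>?Q\<^esub> inv\<^bsub>?Q\<^esub> gr2_eval I b"
      using h.hom_mult[of a "- b"] h.hom_inv[of b] k by simp
    also have "\<dots> = lower_central ?F 3 #>\<^bsub>?F\<^esub> (r \<otimes>\<^bsub>?F\<^esub> inv\<^bsub>?F\<^esub> s)"
      using cl s by (simp add: r s F.inv_gr2 F.mult_gr2)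
    finally have "gr2_eval I (a - b) = lower_central ?F 3 #>\<^bsub>?F\<^esub> (r \<otimes>\<^bsub>?F\<^esub> inv\<^bsub>?F\<^esub> s)" .
    moreover have "r \<otimes>\<^bsub>?F\<^esub> inv\<^bsub>?F\<^esub> s \<in> lower_central ?F 2"
      using subgroup.m_closed[OF F.subgroup_lower_central_2 r(1) s'] .
    moreover have "magnus i j (r \<otimes>\<^bsub>?F\<^esub> inv\<^bsub>?F\<^esub> s) = leaf_antisym (a - b) i j" for i j
      using r s cl by (simp add: magnus_mult_2 magnus_inv_2 leaf_antisym_minus)
    moreover have "Poly_Mapping.keys (a - b) \<subseteq> quadratic_bracketings I"
      using keys_diff[of a b] k by blast
    ultimately show ?case by blast
  qed
  then show thesis using that by blast
qed

text \<open>Modulo the third term the commutator is additive in its left argument. So the left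
  argument is extended from generators to all words while the right one is a generator, the two are
  exchanged at the cost of an inverse, and the left argument is extended once more.\<close>

lemma gr2_eval_surj:
  assumes "r \<in> lower_central (free_group I) 2"
  obtains c where "Poly_Mapping.keys c \<subseteq> quadratic_bracketings I"
    "gr2_eval I c = lower_central (free_group I) 3 #>\<^bsub>free_group I\<^esub> r"
proof -
  let ?F = "free_group I" and ?Q = "lower_central_quotient (free_group I) 2"
  let ?k = "\<lambda>x y. lower_central ?F 3 #>\<^bsub>?F\<^esub> commutator ?F x y"
  interpret F: group ?F by (rule group_free_group)
  interpret gr: comm_group ?Q by (rule F.comm_group_gr2)
  interpret h: group_hom "free_Abelian_group (quadratic_bracketings I)" ?Q "gr2_eval I"
    by (simp add: group_hom_def group_hom_axioms_def gr2_eval_hom gr.group_axioms)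
  define S where "S = gr2_eval I ` carrier (free_Abelian_group (quadratic_bracketings I))"
  have S: "subgroup S ?Q" unfolding S_def by (rule h.img_is_subgroup)
  have k: "?k x y \<in> carrier ?Q" if "x \<in> carrier ?F" "y \<in> carrier ?F" for x y
    using that F.commutator_mem_2 by (auto simp: F.carrier_gr2)
  have sub: "subgroup {x \<in> carrier ?F. ?k x y \<in> S} ?F" if y: "y \<in> carrier ?F" for y
  proof -
    interpret ky: group_hom ?F ?Q "\<lambda>x. ?k x y"
      using y k F.gr2_commutator_mult_left by unfold_locales (auto simp: hom_def)
    show ?thesis
    proof (rule F.subgroupI)
      show "{x \<in> carrier ?F. ?k x y \<in> S} \<noteq> {}"
        using subgroup.one_closed[OF S] ky.hom_one F.one_closed by force
      fix a b assume a: "a \<in> {x \<in> carrier ?F. ?k x y \<in> S}" and b: "b \<in> {x \<in> carrier ?F. ?k x y \<in> S}"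
      show "a \<otimes>\<^bsub>?F\<^esub> b \<in> {x \<in> carrier ?F. ?k x y \<in> S}"
        using subgroup.m_closed[OF S] a b ky.hom_mult[of a b] by simp
      show "inv\<^bsub>?F\<^esub> a \<in> {x \<in> carrier ?F. ?k x y \<in> S}"
        using subgroup.m_inv_closed[OF S] a ky.hom_inv[of a] by simp
    qed blast
  qed
  have gg: "?k (free_group_gen i) (free_group_gen j) \<in> S" if "i \<in> I" "j \<in> I" for i j
  proof -
    have "frag_of (Br (Leaf i) (Leaf j)) \<in> carrier (free_Abelian_group (quadratic_bracketings I))"
      using that by (simp add: keys_frag_of quadratic_bracketings_eq)
    then show ?thesis using gr2_eval_of[OF that] unfolding S_def by (metis imageI)
  qed
  have xg: "?k x (free_group_gen j) \<in> S" if "x \<in> carrier ?F" "j \<in> I" for x j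
    using free_group_subgroup_all[OF sub[OF free_group_gen_closed[OF that(2)]] _ that(1)] gg that by (simp add: free_group_gen_closed)
  have gx: "?k (free_group_gen j) x \<in> S" if "x \<in> carrier ?F" "j \<in> I" for x j
    using F.gr2_commutator_swap[OF that(1) free_group_gen_closed[OF that(2)]] xg[OF that]
      subgroup.m_inv_closed[OF S] by simp
  have xy: "?k x y \<in> S" if "x \<in> carrier ?F" "y \<in> carrier ?F" for x y
    using free_group_subgroup_all[OF sub[OF that(2)] _ that(1)] gx that by (simp add: free_group_gen_closed)
  have "r \<in> lower_central ?F 2 \<and> lower_central ?F 3 #>\<^bsub>?F\<^esub> r \<in> S"
    using assms unfolding F.lower_central_2
  proof (induction rule: generate.induct)
    case one
    have "lower_central ?F 3 #>\<^bsub>?F\<^esub> \<one>\<^bsub>?F\<^esub> = \<one>\<^bsub>?Q\<^esub>"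
      using F.coset_join2[OF F.one_closed F.subgroup_lower_central_3]
        subgroup.one_closed[OF F.subgroup_lower_central_3] by (simp add: F.one_gr2)
    then show ?case using subgroup.one_closed[OF S] by (simp add: generate.one)
  next
    case (incl h)
    note mem = generate.incl[OF this]
    obtain x y where "h = commutator ?F x y" "x \<in> carrier ?F" "y \<in> carrier ?F" using incl by blast
    then show ?case using xy[of x y] mem by simp
  next
    case (inv h)
    note mem = generate.inv[OF this]
    obtain x y where h: "h = commutator ?F x y" "x \<in> carrier ?F" "y \<in> carrier ?F" using inv by blast
    have "inv\<^bsub>?Q\<^esub> (lower_central ?F 3 #>\<^bsub>?F\<^esub> h) \<in> S"
      unfolding h(1) by (rule subgroup.m_inv_closed[OF S xy[OF h(2,3)]])
    moreover have "h \<in> lower_central ?F 2" unfolding h(1) by (rule F.commutator_mem_2[OF h(2,3)])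
    ultimately have "lower_central ?F 3 #>\<^bsub>?F\<^esub> inv\<^bsub>?F\<^esub> h \<in> S" by (simp only: F.inv_gr2)
    then show ?case using mem by (intro conjI)
  next
    case (eng h1 h2)
    have "h1 \<in> carrier ?F" "h2 \<in> carrier ?F"
      by (rule F.lower_central_2_closed[unfolded F.lower_central_2, OF eng.hyps(1)])
        (rule F.lower_central_2_closed[unfolded F.lower_central_2, OF eng.hyps(2)])
    then have "lower_central ?F 3 #>\<^bsub>?F\<^esub> (h1 \<otimes>\<^bsub>?F\<^esub> h2) =
        (lower_central ?F 3 #>\<^bsub>?F\<^esub> h1) \<otimes>\<^bsub>?Q\<^esub> (lower_central ?F 3 #>\<^bsub>?F\<^esub> h2)"
      by (rule F.mult_gr2[symmetric])
    also have "\<dots> \<in> S" by (rule subgroup.m_closed[OF S conjunct2[OF eng.IH(1)] conjunct2[OF eng.IH(2)]])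
    finally show ?case using generate.eng[OF eng.hyps] by (intro conjI)
  qed
  then show thesis using that unfolding S_def by auto
qed

lemma gr2_eval_alt_sum:
  fixes I :: "'i::linorder set"
  assumes I: "finite I" and c: "Poly_Mapping.keys c \<subseteq> quadratic_bracketings I"
  shows "gr2_eval I c = alt_sum (lower_central_quotient (free_group I) 2)
     (\<lambda>i j. lower_central (free_group I) 3 #>\<^bsub>free_group I\<^esub> commutator (free_group I) (free_group_gen i) (free_group_gen j))
     I (leaf_antisym c)"
proof -
  interpret F: group "free_group I" by (rule group_free_group)
  show ?thesis
    by (rule hom_quadratic_alt_sum[OF F.comm_group_gr2 gr2_eval_hom I gr2_eval_of
          F.gr2_commutator_self[OF free_group_gen_closed]
          F.gr2_commutator_swap[OF free_group_gen_closed free_group_gen_closed] c])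
qed

lemma free_lie_class_alt_sum:
  fixes I :: "'i::linorder set"
  assumes I: "finite I" and c: "Poly_Mapping.keys c \<subseteq> quadratic_bracketings I"
  shows "ideal_generated (free_nonassoc I) (lie_identities I) #>\<^bsub>free_nonassoc I\<^esub> c =
    alt_sum (free_lie I) (\<lambda>i j. bracket (free_lie I) (free_lie_gen I i) (free_lie_gen I j)) I (leaf_antisym c)"
proof -
  let ?N = "free_nonassoc I" and ?K = "ideal_generated (free_nonassoc I) (lie_identities I)"
  interpret N: graded_nring ?N by (rule graded_nring_free_nonassoc)
  interpret L: graded_nring "free_lie I" by (rule graded_nring_free_lie)
  have K: "lie_ideal ?K ?N" by (rule N.ideal_generated_ideal[OF lie_identities_carrier])
  have pi: "(\<lambda>x. ?K #>\<^bsub>?N\<^esub> x) \<in> nring_hom ?N (free_lie I)"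
    unfolding free_lie_def by (rule N.quotient_map_hom[OF K])
  have leaf: "frag_of (Leaf i) \<in> carrier ?N" if "i \<in> I" for i
    using that by (simp add: free_nonassoc_simps keys_frag_of)
  have gen: "free_lie_gen I i \<in> carrier (free_lie I)" if "i \<in> I" for i
    unfolding free_lie_gen_def using nring_hom_closed[OF pi leaf[OF that]] .
  have sub: "quadratic_bracketings I \<subseteq> {t. set_bracketing t \<subseteq> I}" by (auto simp: quadratic_bracketings_def)
  have hom: "(\<lambda>x. ?K #>\<^bsub>?N\<^esub> x) \<in> hom (free_Abelian_group (quadratic_bracketings I)) (free_lie I)"
  proof (rule homI)
    fix x y assume "x \<in> carrier (free_Abelian_group (quadratic_bracketings I))"
      "y \<in> carrier (free_Abelian_group (quadratic_bracketings I))"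
    then have xy: "x \<in> carrier ?N" "y \<in> carrier ?N" using sub by (auto simp: free_nonassoc_simps)
    show "?K #>\<^bsub>?N\<^esub> x \<in> carrier (free_lie I)" using nring_hom_closed[OF pi xy(1)] .
    show "?K #>\<^bsub>?N\<^esub> (x \<otimes>\<^bsub>free_Abelian_group (quadratic_bracketings I)\<^esub> y) =
        (?K #>\<^bsub>?N\<^esub> x) \<otimes>\<^bsub>free_lie I\<^esub> (?K #>\<^bsub>?N\<^esub> y)"
      using nring_hom_mult[OF pi xy] by (simp add: free_nonassoc_simps(2))
  qed
  show ?thesis
  proof (rule hom_quadratic_alt_sum[OF L.comm_group_axioms hom I _ _ _ c])
    fix i j assume ij: "i \<in> I" "j \<in> I"
    show "?K #>\<^bsub>?N\<^esub> frag_of (Br (Leaf i) (Leaf j)) = bracket (free_lie I) (free_lie_gen I i) (free_lie_gen I j)"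
      unfolding free_lie_gen_def
      using nring_hom_bracket[OF pi leaf[OF ij(1)] leaf[OF ij(2)]] by (simp add: bracket_free_nonassoc_of)
    show "bracket (free_lie I) (free_lie_gen I j) (free_lie_gen I i) =
        inv\<^bsub>free_lie I\<^esub> bracket (free_lie I) (free_lie_gen I i) (free_lie_gen I j)"
      by (rule L.bracket_antisym[OF lie_law_free_lie gen[OF ij(1)] gen[OF ij(2)]])
    show "bracket (free_lie I) (free_lie_gen I i) (free_lie_gen I i) = \<one>\<^bsub>free_lie I\<^esub>"
      using lie_law_free_lie[of I] gen ij by (simp add: lie_law_def)
  qed
qed

text \<open>The quadratic part is a preimage under \<open>free_lie_to_gr\<close>, hence needs
  injectivity in degree two and one explicit preimage. Both reduce to the equality of Magnus
  coefficients and antisymmetrized coefficients.\<close>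

theorem quadratic_part_alt_sum:
  fixes I :: "'i::linorder set"
  assumes I: "finite I" and r: "r \<in> lower_central (free_group I) 2"
  shows "quadratic_part I r =
    alt_sum (free_lie I) (\<lambda>i j. bracket (free_lie I) (free_lie_gen I i) (free_lie_gen I j)) I (\<lambda>i j. magnus i j r)"
proof -
  let ?N = "free_nonassoc I" and ?K = "ideal_generated (free_nonassoc I) (lie_identities I)" and ?F = "free_group I"
  let ?g = "\<lambda>m. alt_sum (free_lie I) (\<lambda>i j. bracket (free_lie I) (free_lie_gen I i) (free_lie_gen I j)) I m"
  interpret F: group ?F by (rule group_free_group)
  interpret N: graded_nring ?N by (rule graded_nring_free_nonassoc)
  have K: "lie_ideal ?K ?N" by (rule N.ideal_generated_ideal[OF lie_identities_carrier])
  have deg: "degree_part (free_lie I) 2 = (\<lambda>c. ?K #>\<^bsub>?N\<^esub> c) ` {c. Poly_Mapping.keys c \<subseteq> quadratic_bracketings I}"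
    by (simp add: free_lie_def lie_quotient_def degree_part_2)
  have carr: "c \<in> carrier ?N" if "Poly_Mapping.keys c \<subseteq> quadratic_bracketings I" for c
    using that by (auto simp: free_nonassoc_simps quadratic_bracketings_def)
  have antisym: "leaf_antisym c = leaf_antisym d"
    if "Poly_Mapping.keys c \<subseteq> quadratic_bracketings I" "Poly_Mapping.keys d \<subseteq> quadratic_bracketings I"
      "?K #>\<^bsub>?N\<^esub> c = ?K #>\<^bsub>?N\<^esub> d" for c d
  proof -
    have "c \<otimes>\<^bsub>?N\<^esub> inv\<^bsub>?N\<^esub> d \<in> ?K" using N.ideal_coset_eq_iff[OF K] that carr by blast
    then have "c - d \<in> ?K" using carr[OF that(2)] by (simp add: inv_free_nonassoc free_nonassoc_simps(2))
    then have "leaf_antisym c i j = leaf_antisym d i j" for i j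
      using lie_identities_leaf_antisym[of "c - d" I i j] by (simp add: leaf_antisym_minus)
    then show ?thesis by blast
  qed
  \<comment> \<open>Homogeneous representatives of one class have equal antisymmetrized coefficients
    and hence equal evaluations, so the \<open>the_elem\<close> in \<open>free_lie_to_gr\<close> is
    applied to a singleton.\<close>
  have gr_value: "free_lie_to_gr I 2 (?K #>\<^bsub>?N\<^esub> c) = gr2_eval I c"
    if c: "Poly_Mapping.keys c \<subseteq> quadratic_bracketings I" for c
  proof -
    have "gr2_eval I d = gr2_eval I c" if "d \<in> (?K #>\<^bsub>?N\<^esub> c) \<inter> degree_part ?N 2" for d
    proof -
      have d: "Poly_Mapping.keys d \<subseteq> quadratic_bracketings I" using that by (simp add: degree_part_2)
      have "?K #>\<^bsub>?N\<^esub> d = ?K #>\<^bsub>?N\<^esub> c" using N.coset_mem_ideal(2)[OF K _ carr[OF c]] that by blast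
      then show ?thesis using antisym[OF d c] by (simp add: gr2_eval_alt_sum[OF I c] gr2_eval_alt_sum[OF I d])
    qed
    moreover have "c \<in> (?K #>\<^bsub>?N\<^esub> c) \<inter> degree_part ?N 2"
      using N.rcos_self[OF carr[OF c]] K c by (simp add: degree_part_2 lie_ideal_def)
    ultimately have "gr2_eval I ` ((?K #>\<^bsub>?N\<^esub> c) \<inter> degree_part ?N 2) = {gr2_eval I c}" by blast
    then show ?thesis by (simp add: free_lie_to_gr_2)
  qed
  have inj: "inj_on (free_lie_to_gr I 2) (degree_part (free_lie I) 2)"
  proof (rule inj_onI)
    fix x y assume "x \<in> degree_part (free_lie I) 2" "y \<in> degree_part (free_lie I) 2"
      and eq: "free_lie_to_gr I 2 x = free_lie_to_gr I 2 y"
    then obtain c d where c: "Poly_Mapping.keys c \<subseteq> quadratic_bracketings I" "x = ?K #>\<^bsub>?N\<^esub> c"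
      and d: "Poly_Mapping.keys d \<subseteq> quadratic_bracketings I" "y = ?K #>\<^bsub>?N\<^esub> d"
      unfolding deg by blast
    obtain s where s: "s \<in> lower_central ?F 2" "gr2_eval I c = lower_central ?F 3 #>\<^bsub>?F\<^esub> s"
      "\<And>i j. magnus i j s = leaf_antisym c i j" using gr2_eval_magnus[OF c(1)] by blast
    obtain t where t: "t \<in> lower_central ?F 2" "gr2_eval I d = lower_central ?F 3 #>\<^bsub>?F\<^esub> t"
      "\<And>i j. magnus i j t = leaf_antisym d i j" using gr2_eval_magnus[OF d(1)] by blast
    have "magnus i j s = magnus i j t" for i j
      using magnus_coset_eq[OF s(1) t(1)] s(2) t(2) eq gr_value[OF c(1)] gr_value[OF d(1)] c(2) d(2) by simp
    then have "leaf_antisym c = leaf_antisym d" using s(3) t(3) by presburger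
    then show "x = y" unfolding c(2) d(2) by (simp add: free_lie_class_alt_sum[OF I] c(1) d(1))
  qed
  obtain c where c: "Poly_Mapping.keys c \<subseteq> quadratic_bracketings I" "gr2_eval I c = lower_central ?F 3 #>\<^bsub>?F\<^esub> r"
    using gr2_eval_surj[OF r] by blast
  obtain s where s: "s \<in> lower_central ?F 2" "gr2_eval I c = lower_central ?F 3 #>\<^bsub>?F\<^esub> s"
    "\<And>i j. magnus i j s = leaf_antisym c i j" using gr2_eval_magnus[OF c(1)] by blast
  have "leaf_antisym c = (\<lambda>i j. magnus i j r)"
    using magnus_coset_eq[OF s(1) r] s c by fastforce
  moreover have "quadratic_part I r = ?K #>\<^bsub>?N\<^esub> c"
    unfolding quadratic_part_def using c gr_value[OF c(1)] by (intro the_inv_into_f_eq[OF inj]) (auto simp: deg)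
  ultimately show ?thesis by (simp add: free_lie_class_alt_sum[OF I c(1)])
qed

section \<open>Cochains, Kronecker pairing and cup product\<close>

type_synonym 'a cochain = "((nat \<Rightarrow> real) \<Rightarrow> 'a) \<Rightarrow> int"

text \<open>Linear extension for an arbitrary index type: it serves for cochains on simplices and
  for pairings on formal wedges alike.\<close>

definition frag_sum :: "('s \<Rightarrow> int) \<Rightarrow> ('s \<Rightarrow>\<^sub>0 int) \<Rightarrow> int" where
  "frag_sum g c = (\<Sum>s\<in>Poly_Mapping.keys c. Poly_Mapping.lookup c s * g s)"

lemma frag_sum_superset:
  "finite S \<Longrightarrow> Poly_Mapping.keys c \<subseteq> S \<Longrightarrow> frag_sum g c = (\<Sum>s\<in>S. Poly_Mapping.lookup c s * g s)"
  unfolding frag_sum_def by (intro sum.mono_neutral_left) (auto simp: in_keys_iff)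

lemma frag_sum_add: "frag_sum g (c + d) = frag_sum g c + frag_sum g d"
proof -
  let ?S = "Poly_Mapping.keys c \<union> Poly_Mapping.keys d"
  have "frag_sum g (c + d) = (\<Sum>s\<in>?S. Poly_Mapping.lookup (c + d) s * g s)"
    by (rule frag_sum_superset[OF _ keys_add]) simp
  then show ?thesis
    by (simp add: frag_sum_superset[of ?S] lookup_add distrib_right sum.distrib)
qed

lemma frag_sum_zero [simp]: "frag_sum g 0 = 0"
  by (simp add: frag_sum_def)

lemma frag_sum_minus: "frag_sum g (- c) = - frag_sum g c"
  using frag_sum_add[of g c "- c"] by simp

lemma frag_sum_diff: "frag_sum g (c - d) = frag_sum g c - frag_sum g d"
  using frag_sum_add[of g c "- d"] by (simp add: frag_sum_minus)

lemma frag_sum_of [simp]: "frag_sum g (frag_of s) = g s"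
  by (simp add: frag_sum_def keys_frag_of)

lemma frag_sum_cmul: "frag_sum g (frag_cmul k c) = k * frag_sum g c"
proof -
  have "frag_sum g (frag_cmul k c) = (\<Sum>s\<in>Poly_Mapping.keys c. Poly_Mapping.lookup (frag_cmul k c) s * g s)"
    by (rule frag_sum_superset[OF _ keys_cmul]) simp
  then show ?thesis by (simp add: frag_sum_def sum_distrib_left mult.assoc)
qed

lemma frag_sum_sum: "frag_sum g (sum f A) = (\<Sum>x\<in>A. frag_sum g (f x))"
  by (induction A rule: infinite_finite_induct) (auto simp: frag_sum_add)

lemma frag_sum_fun_add: "frag_sum (\<lambda>s. g s + h s) c = frag_sum g c + frag_sum h c"
  by (simp add: frag_sum_def distrib_left sum.distrib)

lemma cochain_eval_frag_sum: "cochain_eval \<phi> c = frag_sum \<phi> c"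
  by (simp add: cochain_eval_def frag_sum_def)

lemma coboundary_eval:
  assumes "singular_chain (Suc p) X c"
  shows "frag_sum (coboundary p X \<phi>) c = frag_sum \<phi> (chain_boundary (Suc p) c)"
  using assms unfolding singular_chain_def
proof (induction c rule: frag_induction)
  case (one f)
  then show ?case by (simp add: coboundary_def cochain_eval_frag_sum)
qed (simp_all add: frag_sum_diff chain_boundary_diff)

lemma cocycle_eval_boundary:
  assumes "\<phi> \<in> cocycle_set p X" "singular_chain (Suc p) X c"
  shows "frag_sum \<phi> (chain_boundary (Suc p) c) = 0"
proof -
  have "coboundary p X \<phi> = (\<lambda>f. 0)" using assms by (simp add: cocycle_set_def)
  then show ?thesis using coboundary_eval[OF assms(2), of \<phi>] by (simp add: frag_sum_def)
qed

lemma cocycle_setI: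
  assumes "\<And>f. \<not> singular_simplex p X f \<Longrightarrow> \<phi> f = 0"
    and "\<And>f. singular_simplex (Suc p) X f \<Longrightarrow> frag_sum \<phi> (chain_boundary (Suc p) (frag_of f)) = 0"
  shows "\<phi> \<in> cocycle_set p X"
  using assms by (auto simp: cocycle_set_def cochain_group_def coboundary_def cochain_eval_frag_sum)

lemma coboundary_cocycle:
  assumes "\<phi> \<in> carrier (cochain_group p X)"
  shows "coboundary p X \<phi> \<in> cocycle_set (Suc p) X"
proof (rule cocycle_setI)
  fix f assume f: "singular_simplex (Suc (Suc p)) X f"
  then have c: "singular_chain (Suc (Suc p)) X (frag_of f)" by (simp add: singular_chain_of)
  have "frag_sum (coboundary p X \<phi>) (chain_boundary (Suc (Suc p)) (frag_of f)) =
      frag_sum \<phi> (chain_boundary (Suc p) (chain_boundary (Suc (Suc p)) (frag_of f)))"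
    by (rule coboundary_eval[OF singular_chain_boundary_alt[OF c]])
  also have "\<dots> = 0"
    using chain_boundary_boundary[OF c] by simp
  finally show "frag_sum (coboundary p X \<phi>) (chain_boundary (Suc (Suc p)) (frag_of f)) = 0" .
qed (simp add: coboundary_def)

lemma cocycle_add:
  assumes "\<phi> \<in> cocycle_set p X" "\<psi> \<in> cocycle_set p X"
  shows "(\<lambda>f. \<phi> f + \<psi> f) \<in> cocycle_set p X"
proof (rule cocycle_setI)
  fix f assume "\<not> singular_simplex p X f"
  then show "\<phi> f + \<psi> f = 0" using assms by (simp add: cocycle_set_def cochain_group_def)
next
  fix f assume "singular_simplex (Suc p) X f"
  then have "singular_chain (Suc p) X (frag_of f)" by (simp add: singular_chain_of)
  then show "frag_sum (\<lambda>f. \<phi> f + \<psi> f) (chain_boundary (Suc p) (frag_of f)) = 0"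
    using assms by (simp add: frag_sum_fun_add cocycle_eval_boundary)
qed

abbreviation cochain_coset :: "nat \<Rightarrow> 'a topology \<Rightarrow> 'a cochain \<Rightarrow> 'a cochain set" where
  "cochain_coset p X \<phi> \<equiv> coboundary_set p X #>\<^bsub>cochain_group p X\<^esub> \<phi>"

lemma mem_cochain_coset: "\<psi> \<in> cochain_coset p X \<phi> \<longleftrightarrow> (\<exists>b\<in>coboundary_set p X. \<psi> = (\<lambda>f. b f + \<phi> f))"
  by (auto simp: r_coset_def cochain_group_def)

lemma coboundary_add:
  "coboundary p X (\<lambda>f. \<phi> f + \<psi> f) = (\<lambda>f. coboundary p X \<phi> f + coboundary p X \<psi> f)"
  by (auto simp: coboundary_def cochain_eval_frag_sum frag_sum_fun_add)

lemma coboundary_set_Suc: "coboundary_set (Suc p) X = coboundary p X ` {\<phi>. \<forall>f. \<not> singular_simplex p X f \<longrightarrow> \<phi> f = 0}"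
  by (simp add: coboundary_set_def cochain_group_def)

lemma coboundary_set_add:
  assumes "b \<in> coboundary_set (Suc p) X" "c \<in> coboundary_set (Suc p) X"
  shows "(\<lambda>f. b f + c f) \<in> coboundary_set (Suc p) X"
proof -
  obtain \<phi> \<psi> where "b = coboundary p X \<phi>" "c = coboundary p X \<psi>"
    "\<forall>f. \<not> singular_simplex p X f \<longrightarrow> \<phi> f = 0" "\<forall>f. \<not> singular_simplex p X f \<longrightarrow> \<psi> f = 0"
    using assms unfolding coboundary_set_Suc by blast
  then show ?thesis
    unfolding coboundary_set_Suc by (intro image_eqI[of _ _ "\<lambda>f. \<phi> f + \<psi> f"]) (simp_all add: coboundary_add)
qed

lemma coboundary_set_uminus:
  assumes "b \<in> coboundary_set (Suc p) X"
  shows "(\<lambda>f. - b f) \<in> coboundary_set (Suc p) X"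
proof -
  obtain \<phi> where phi: "b = coboundary p X \<phi>" "\<forall>f. \<not> singular_simplex p X f \<longrightarrow> \<phi> f = 0"
    using assms unfolding coboundary_set_Suc by blast
  have "(\<lambda>f. - b f) = coboundary p X (\<lambda>f. - \<phi> f)"
    unfolding phi(1) by (auto simp: coboundary_def cochain_eval_frag_sum frag_sum_def sum_negf)
  then show ?thesis
    unfolding coboundary_set_Suc using phi(2) by (intro image_eqI[of _ _ "\<lambda>f. - \<phi> f"]) simp_all
qed

lemma coboundary_set_zero: "(\<lambda>f. 0) \<in> coboundary_set (Suc p) X"
  unfolding coboundary_set_Suc
  by (intro image_eqI[of _ _ "\<lambda>f. 0"]) (auto simp: coboundary_def cochain_eval_frag_sum frag_sum_def)

lemma cochain_coset_self: "\<phi> \<in> cochain_coset (Suc p) X \<phi>"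
  using coboundary_set_zero by (force simp: mem_cochain_coset)

lemma cochain_coset_eqI:
  assumes "b \<in> coboundary_set (Suc p) X" "\<psi> = (\<lambda>f. b f + \<phi> f)"
  shows "cochain_coset (Suc p) X \<psi> = cochain_coset (Suc p) X \<phi>"
proof (intro equalityI subsetI)
  fix \<theta> assume "\<theta> \<in> cochain_coset (Suc p) X \<psi>"
  then obtain c where c: "c \<in> coboundary_set (Suc p) X" "\<theta> = (\<lambda>f. c f + \<psi> f)" unfolding mem_cochain_coset by blast
  show "\<theta> \<in> cochain_coset (Suc p) X \<phi>"
    unfolding mem_cochain_coset using coboundary_set_add[OF c(1) assms(1)]
    by (rule bexI[rotated]) (simp add: c assms algebra_simps)
next
  fix \<theta> assume "\<theta> \<in> cochain_coset (Suc p) X \<phi>"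
  then obtain c where c: "c \<in> coboundary_set (Suc p) X" "\<theta> = (\<lambda>f. c f + \<phi> f)" unfolding mem_cochain_coset by blast
  show "\<theta> \<in> cochain_coset (Suc p) X \<psi>"
    unfolding mem_cochain_coset using coboundary_set_add[OF c(1) coboundary_set_uminus[OF assms(1)]]
    by (rule bexI[rotated]) (simp add: c assms algebra_simps)
qed

lemma carrier_cohomology_group: "carrier (cohomology_group p X) = cochain_coset p X ` cocycle_set p X"
  by (auto simp: cohomology_group_def FactGroup_def RCOSETS_def r_coset_def)

lemma cochain_coset_cocycle:
  assumes "\<phi> \<in> cocycle_set (Suc p) X" "\<psi> \<in> cochain_coset (Suc p) X \<phi>"
  shows "\<psi> \<in> cocycle_set (Suc p) X"
proof -
  obtain b where b: "b \<in> coboundary_set (Suc p) X" "\<psi> = (\<lambda>f. b f + \<phi> f)"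
    using assms(2) unfolding mem_cochain_coset by blast
  have "b \<in> cocycle_set (Suc p) X"
    using b(1) coboundary_cocycle by (auto simp: coboundary_set_def)
  then show ?thesis unfolding b(2) by (rule cocycle_add[OF _ assms(1)])
qed

lemma coboundary_eval_cycle:
  assumes "b \<in> coboundary_set (Suc p) X" "singular_relcycle (Suc p) X {} c"
  shows "frag_sum b c = 0"
  using assms coboundary_eval[of p X c] by (auto simp: coboundary_set_def singular_cycle)

lemma Collect_pair_eq_singleton:
  assumes "\<And>x y. x \<in> A \<Longrightarrow> y \<in> B \<Longrightarrow> F x y = C" "a \<in> A" "b \<in> B"
  shows "{F x y | x y. x \<in> A \<and> y \<in> B} = {C}"
proof
  show "{F x y | x y. x \<in> A \<and> y \<in> B} \<subseteq> {C}" using assms(1) by blast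
  have "C = F a b" using assms by simp
  then show "{C} \<subseteq> {F x y | x y. x \<in> A \<and> y \<in> B}" using assms(2,3) by blast
qed

text \<open>The \<open>the_elem\<close> in \<open>kronecker\<close> asks for independence of both
  representatives: cocycles kill boundaries, and coboundaries kill cycles.\<close>

lemma kronecker_eval:
  assumes phi: "\<phi> \<in> cocycle_set (Suc p) X" and c: "singular_relcycle (Suc p) X {} c"
  shows "kronecker (Suc p) X (homologous_rel_set (Suc p) X {} c) (cochain_coset (Suc p) X \<phi>) = frag_sum \<phi> c"
proof -
  have "cochain_eval \<psi> d = frag_sum \<phi> c"
    if psi: "\<psi> \<in> cochain_coset (Suc p) X \<phi>" and d: "d \<in> homologous_rel_set (Suc p) X {} c" for \<psi> d
  proof -
    obtain b where b: "b \<in> coboundary_set (Suc p) X" "\<psi> = (\<lambda>f. b f + \<phi> f)"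
      using psi unfolding mem_cochain_coset by blast
    obtain e where e: "singular_chain (Suc (Suc p)) X e" "chain_boundary (Suc (Suc p)) e = c - d"
      using d unfolding homologous_rel_def singular_boundary by blast
    have "frag_sum \<psi> (c - d) = 0"
      using cocycle_eval_boundary[OF cochain_coset_cocycle[OF phi psi] e(1)] e(2) by simp
    moreover have "frag_sum \<psi> c = frag_sum \<phi> c"
      unfolding b(2) frag_sum_fun_add using coboundary_eval_cycle[OF b(1) c] by simp
    ultimately show ?thesis by (simp add: cochain_eval_frag_sum frag_sum_diff)
  qed
  moreover have "\<phi> \<in> cochain_coset (Suc p) X \<phi>" "c \<in> homologous_rel_set (Suc p) X {} c"
    using cochain_coset_self by auto
  ultimately have "{cochain_eval \<psi> d | \<psi> d. \<psi> \<in> cochain_coset (Suc p) X \<phi> \<and> d \<in> homologous_rel_set (Suc p) X {} c}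
      = {frag_sum \<phi> c}"
    by (rule Collect_pair_eq_singleton)
  moreover have "cochain_coset (Suc p) X \<phi> \<in> carrier (cohomology_group (Suc p) X)"
    using phi by (simp add: carrier_cohomology_group)
  ultimately show ?thesis by (simp add: kronecker_def)
qed

subsection \<open>Low-dimensional faces\<close>

lemma chain_boundary_1:
  "chain_boundary (Suc 0) (frag_of f) = frag_of (singular_face 1 0 f) - frag_of (singular_face 1 1 f)"
  by (simp add: chain_boundary_of)

lemma chain_boundary_2:
  "chain_boundary (Suc (Suc 0)) (frag_of f) =
     frag_of (singular_face 2 0 f) - frag_of (singular_face 2 1 f) + frag_of (singular_face 2 2 f)"
  by (simp add: chain_boundary_of numeral_2_eq_2)

lemma chain_boundary_3:
  "chain_boundary (Suc (Suc (Suc 0))) (frag_of f) =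
     frag_of (singular_face 3 0 f) - frag_of (singular_face 3 1 f) + frag_of (singular_face 3 2 f) -
     frag_of (singular_face 3 3 f)"
  by (simp add: chain_boundary_of numeral_2_eq_2 numeral_3_eq_3)

text \<open>The front edge of a triangle joins vertices 0 and 1, so it is the face opposite vertex
  2, and the back edge is the face opposite vertex 0. Throughout, face 1 is the edge from the first
  to the last vertex.\<close>

lemma front_face_1: "front_face 1 f = singular_face 2 2 f"
proof -
  have "simplical_face 2 x = x" if "x \<in> standard_simplex 1" for x :: "nat \<Rightarrow> real"
    using that by (auto simp: simplical_face_def standard_simplex_def)
  then show ?thesis by (auto simp: front_face_def singular_face_def)
qed

lemma back_face_1: "back_face 1 1 f = singular_face 2 0 f"
proof -
  have "(\<lambda>i. if i < 1 then 0 else x (i - 1)) = simplical_face 0 x" for x :: "nat \<Rightarrow> real"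
    by (auto simp: simplical_face_def)
  then show ?thesis unfolding back_face_def singular_face_def by (simp add: comp_def)
qed

lemma cochain_cup_1:
  "singular_simplex 2 X f \<Longrightarrow> cochain_cup 1 1 X \<phi> \<psi> f = \<phi> (singular_face 2 2 f) * \<psi> (singular_face 2 0 f)"
  by (simp add: cochain_cup_def front_face_1[unfolded One_nat_def] back_face_1[unfolded One_nat_def] numeral_2_eq_2)

lemma singular_face_face:
  assumes "i \<le> j" "j \<le> 2"
  shows "singular_face 2 i (singular_face 3 (Suc j) f) = singular_face 2 j (singular_face 3 i f)"
proof -
  have "simplical_face k t \<in> standard_simplex 2" if "t \<in> standard_simplex 1" "k \<le> 2" for k and t :: "nat \<Rightarrow> real"
    using simplical_face_in_standard_simplex[of 2 k t] that by simp
  moreover have "simplical_face (Suc j) (simplical_face i t) = simplical_face i (simplical_face j t)"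
    for t :: "nat \<Rightarrow> real"
    using assms(1) by (intro ext) (auto simp: simplical_face_def)
  ultimately show ?thesis
    using assms by (auto simp: singular_face_def restrict_def)
qed

lemma cocycle_triangle:
  assumes "\<phi> \<in> cocycle_set 1 X" "singular_simplex 2 X f"
  shows "\<phi> (singular_face 2 1 f) = \<phi> (singular_face 2 2 f) + \<phi> (singular_face 2 0 f)"
  using cocycle_eval_boundary[of \<phi> 1 X "frag_of f"] assms
  by (simp add: chain_boundary_2 frag_sum_add frag_sum_diff singular_chain_of numeral_2_eq_2)

lemma cup_cocycle:
  assumes phi: "\<phi> \<in> cocycle_set 1 X" and psi: "\<psi> \<in> cocycle_set 1 X"
  shows "cochain_cup 1 1 X \<phi> \<psi> \<in> cocycle_set 2 X"
  unfolding numeral_2_eq_2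
proof (rule cocycle_setI)
  fix f assume "\<not> singular_simplex (Suc (Suc 0)) X f"
  then show "cochain_cup 1 1 X \<phi> \<psi> f = 0" by (simp add: cochain_cup_def)
next
  fix f assume f: "singular_simplex (Suc (Suc (Suc 0))) X f"
  have s: "singular_simplex 2 X (singular_face 3 k f)" if "k \<le> 3" for k
    using singular_simplex_singular_face[OF f, of k] that by (simp add: numeral_2_eq_2 numeral_3_eq_3)
  have faces: "singular_face 2 0 (singular_face 3 1 f) = singular_face 2 0 (singular_face 3 0 f)"
    "singular_face 2 0 (singular_face 3 2 f) = singular_face 2 1 (singular_face 3 0 f)"
    "singular_face 2 0 (singular_face 3 3 f) = singular_face 2 2 (singular_face 3 0 f)"
    "singular_face 2 1 (singular_face 3 2 f) = singular_face 2 1 (singular_face 3 1 f)"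
    "singular_face 2 1 (singular_face 3 3 f) = singular_face 2 2 (singular_face 3 1 f)"
    "singular_face 2 2 (singular_face 3 3 f) = singular_face 2 2 (singular_face 3 2 f)"
    using singular_face_face[of 0 0 f] singular_face_face[of 0 1 f] singular_face_face[of 0 2 f]
      singular_face_face[of 1 1 f] singular_face_face[of 1 2 f] singular_face_face[of 2 2 f]
    by (simp_all add: numeral_2_eq_2 numeral_3_eq_3)
  \<comment> \<open>\<phi> is split on the face with vertices 0, 1, 2 and \<psi> on the face with
    vertices 1, 2, 3; after that the products on the four faces cancel in pairs.\<close>
  show "frag_sum (cochain_cup 1 1 X \<phi> \<psi>) (chain_boundary (Suc (Suc (Suc 0))) (frag_of f)) = 0"
    using cocycle_triangle[OF phi s[of 3]] cocycle_triangle[OF psi s[of 0]]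
    by (simp add: chain_boundary_3 frag_sum_add frag_sum_diff cochain_cup_1[unfolded One_nat_def] s)
      (simp add: faces[unfolded One_nat_def] algebra_simps)
qed

section \<open>Paths and singular chains\<close>

lemma singular_simplex_top_of_set:
  "singular_simplex p (top_of_set X) f \<longleftrightarrow>
     continuous_on (standard_simplex p) f \<and> f ` standard_simplex p \<subseteq> X \<and> f \<in> extensional (standard_simplex p)"
  by (auto simp: singular_simplex_def euclidean_product_topology continuous_map_in_subtopology
      continuous_map_iff_continuous)

lemma standard_simplex_1_mem:
  "0 \<le> s \<Longrightarrow> s \<le> 1 \<Longrightarrow> (\<lambda>i. if i = 0 then 1 - s else if i = 1 then s else 0) \<in> standard_simplex 1"
  by (auto simp: standard_simplex_def)

lemma standard_simplex_1D:
  assumes "t \<in> standard_simplex 1"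
  shows "0 \<le> t 1" "t 1 \<le> 1" "t = (\<lambda>i. if i = 0 then 1 - t 1 else if i = 1 then t 1 else 0)"
proof -
  have "t 0 + t 1 = 1" using assms by (simp add: standard_simplex_def)
  moreover have "t i = 0" if "i > 1" for i using assms that by (simp add: standard_simplex_def)
  ultimately have "t i = (if i = 0 then 1 - t 1 else if i = 1 then t 1 else 0)" for i
    by (cases "i = 0"; cases "i = 1") auto
  then show "t = (\<lambda>i. if i = 0 then 1 - t 1 else if i = 1 then t 1 else 0)" by blast
qed (use assms in \<open>auto simp: standard_simplex_def\<close>)

lemma standard_simplex_2_mem:
  "0 \<le> x \<Longrightarrow> 0 \<le> y \<Longrightarrow> x + y \<le> 1 \<Longrightarrow>
    (\<lambda>i. if i = 0 then 1 - x - y else if i = 1 then x else if i = 2 then y else 0) \<in> standard_simplex 2"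
  by (auto simp: standard_simplex_def numeral_2_eq_2)

lemma standard_simplex_2D:
  assumes "t \<in> standard_simplex 2"
  shows "0 \<le> t 1" "0 \<le> t 2" "t 1 + t 2 \<le> 1"
    "t = (\<lambda>i. if i = 0 then 1 - t 1 - t 2 else if i = 1 then t 1 else if i = 2 then t 2 else 0)"
proof -
  have s: "t 0 + t 1 + t 2 = 1" using assms by (simp add: standard_simplex_def numeral_2_eq_2)
  moreover have "t i = 0" if "i > 2" for i using assms that by (simp add: standard_simplex_def)
  moreover have "i = 0 \<or> i = 1 \<or> i = 2 \<or> i > 2" for i :: nat by linarith
  ultimately have "t i = (if i = 0 then 1 - t 1 - t 2 else if i = 1 then t 1 else if i = 2 then t 2 else 0)" for i
    by (smt (verit))
  then show "t = (\<lambda>i. if i = 0 then 1 - t 1 - t 2 else if i = 1 then t 1 else if i = 2 then t 2 else 0)" by blast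
  have "0 \<le> t 0" using assms by (auto simp: standard_simplex_def)
  then show "t 1 + t 2 \<le> 1" using s by simp
qed (use assms in \<open>auto simp: standard_simplex_def\<close>)

subsection \<open>Edges and triangles\<close>

definition path_simplex :: "(real \<Rightarrow> 'a) \<Rightarrow> (nat \<Rightarrow> real) \<Rightarrow> 'a" where
  "path_simplex p = restrict (\<lambda>t. p (t 1)) (standard_simplex 1)"

definition simplex_path :: "((nat \<Rightarrow> real) \<Rightarrow> 'a) \<Rightarrow> real \<Rightarrow> 'a" where
  "simplex_path e = (\<lambda>s. e (\<lambda>i. if i = 0 then 1 - s else if i = 1 then s else 0))"

abbreviation path_in :: "'a::topological_space set \<Rightarrow> (real \<Rightarrow> 'a) \<Rightarrow> bool" where
  "path_in X p \<equiv> path p \<and> path_image p \<subseteq> X"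

text \<open>Singular simplices are extensional, so paths that agree on the unit interval give the
  same edge even if they differ as functions on the reals.\<close>

lemma path_simplex_cong:
  assumes "\<And>s. 0 \<le> s \<Longrightarrow> s \<le> 1 \<Longrightarrow> p s = q s"
  shows "path_simplex p = path_simplex q"
  unfolding path_simplex_def by (intro restrict_ext assms standard_simplex_1D(1,2))

lemma simplex_path_simplex: "0 \<le> s \<Longrightarrow> s \<le> 1 \<Longrightarrow> simplex_path (path_simplex p) s = p s"
proof -
  assume s: "0 \<le> s" "s \<le> 1"
  have "(\<lambda>i::nat. if i = 0 then 1 - s else if i = 1 then s else 0) \<in> standard_simplex 1"
    using s by (rule standard_simplex_1_mem)
  then show ?thesis by (simp add: simplex_path_def path_simplex_def)
qed

lemma singular_simplex_path:
  assumes "path_in X p"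
  shows "singular_simplex 1 (top_of_set X) (path_simplex p)"
proof -
  have "continuous_on (standard_simplex 1) (\<lambda>t. p (t 1))"
  proof (rule continuous_on_compose2[of "{0..1}" p])
    show "continuous_on {0..1} p" using assms by (simp add: path_def)
    show "continuous_on (standard_simplex 1) (\<lambda>t. t 1 :: real)"
      by (rule continuous_on_subset[OF continuous_on_product_coordinates]) simp
    show "(\<lambda>t. t 1) ` standard_simplex 1 \<subseteq> {0..1 :: real}"
      using standard_simplex_1D(1,2) by fastforce
  qed
  then have "continuous_on (standard_simplex 1) (path_simplex p)"
    by (rule continuous_on_eq) (simp add: path_simplex_def)
  moreover have "p (t 1) \<in> X" if "t \<in> standard_simplex 1" for t
    using assms standard_simplex_1D(1,2)[OF that] by (auto simp: path_image_def)
  ultimately show ?thesis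
    by (auto simp: singular_simplex_top_of_set path_simplex_def)
qed

lemma
  assumes "singular_simplex 1 (top_of_set X) e"
  shows path_simplex_path: "path_in X (simplex_path e)" and path_simplex_of_path: "path_simplex (simplex_path e) = e"
proof -
  have mem: "(\<lambda>i::nat. if i = 0 then 1 - s else if i = 1 then s else 0) \<in> standard_simplex 1" if "0 \<le> s" "s \<le> 1" for s :: real
    using that by (rule standard_simplex_1_mem)
  have e: "continuous_on (standard_simplex 1) e" "e ` standard_simplex 1 \<subseteq> X" "e \<in> extensional (standard_simplex 1)"
    using assms by (auto simp: singular_simplex_top_of_set)
  have "continuous_on {0..1} (\<lambda>s i::nat. if i = 0 then 1 - s else if i = 1 then s else (0::real))"
  proof (rule continuous_on_coordinatewise_then_product)
    fix i :: nat
    show "continuous_on {0..1} (\<lambda>s. if i = 0 then 1 - s else if i = 1 then s else (0::real))"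
      by (cases "i = 0"; cases "i = 1") (auto intro: continuous_intros)
  qed
  then have "path (simplex_path e)"
    unfolding path_def simplex_path_def using mem by (intro continuous_on_compose2[OF e(1)]) auto
  moreover have "path_image (simplex_path e) \<subseteq> X"
    using e(2) mem by (auto simp: path_image_def simplex_path_def)
  ultimately show "path_in X (simplex_path e)" by simp
  show "path_simplex (simplex_path e) = e"
  proof
    fix t
    show "path_simplex (simplex_path e) t = e t"
    proof (cases "t \<in> standard_simplex 1")
      case True
      then have "t = (\<lambda>i. if i = 0 then 1 - t 1 else if i = 1 then t 1 else 0)" by (rule standard_simplex_1D(3))
      then show ?thesis using True by (simp add: path_simplex_def simplex_path_def)
    next
      case False
      then show ?thesis using e(3) by (simp add: path_simplex_def extensional_def)
    qed
  qed
qed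

text \<open>The standard 2-simplex in the coordinates \<open>t 1\<close>, \<open>t 2\<close>, so
  that triangles can be given by formulas: vertices 0, 1, 2 become (0,0), (1,0), (0,1).\<close>

definition std_triangle :: "(real \<times> real) set" where
  "std_triangle = {(x, y). 0 \<le> x \<and> 0 \<le> y \<and> x + y \<le> 1}"

definition triangle_simplex :: "(real \<times> real \<Rightarrow> 'a) \<Rightarrow> (nat \<Rightarrow> real) \<Rightarrow> 'a" where
  "triangle_simplex \<tau> = restrict (\<lambda>t. \<tau> (t 1, t 2)) (standard_simplex 2)"

lemma convex_triangle: "convex std_triangle"
proof (rule convexI)
  fix a b :: "real \<times> real" and u v :: real
  assume *: "a \<in> std_triangle" "b \<in> std_triangle" "0 \<le> u" "0 \<le> v" "u + v = 1"
  obtain x y x' y' where ab: "a = (x, y)" "b = (x', y')" by (cases a, cases b)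
  have "u * (x + y) + v * (x' + y') \<le> u * 1 + v * 1"
    using * ab by (intro add_mono mult_left_mono) (auto simp: std_triangle_def)
  then show "u *\<^sub>R a + v *\<^sub>R b \<in> std_triangle"
    using * ab by (auto simp: std_triangle_def algebra_simps)
qed

lemma singular_simplex_triangle:
  assumes "continuous_on std_triangle \<tau>" "\<tau> ` std_triangle \<subseteq> X"
  shows "singular_simplex 2 (top_of_set X) (triangle_simplex \<tau>)"
proof -
  have sub: "(\<lambda>t. (t 1, t 2)) ` standard_simplex 2 \<subseteq> std_triangle"
    using standard_simplex_2D(1-3) by (auto simp: std_triangle_def)
  have "continuous_on (standard_simplex 2) (\<lambda>t. (t 1, t 2 :: real))"
    by (intro continuous_on_Pair continuous_on_subset[OF continuous_on_product_coordinates]) auto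
  then have "continuous_on (standard_simplex 2) (\<lambda>t. \<tau> (t 1, t 2))"
    using continuous_on_compose2[OF assms(1)] sub by blast
  then have "continuous_on (standard_simplex 2) (triangle_simplex \<tau>)"
    by (rule continuous_on_eq) (simp add: triangle_simplex_def)
  moreover have "\<tau> (t 1, t 2) \<in> X" if "t \<in> standard_simplex 2" for t
    using assms(2) sub that by blast
  ultimately show ?thesis
    by (auto simp: singular_simplex_top_of_set triangle_simplex_def)
qed

lemma triangle_faces:
  "singular_face 2 0 (triangle_simplex \<tau>) = path_simplex (\<lambda>s. \<tau> (1 - s, s))"
  "singular_face 2 1 (triangle_simplex \<tau>) = path_simplex (\<lambda>s. \<tau> (0, s))"
  "singular_face 2 2 (triangle_simplex \<tau>) = path_simplex (\<lambda>s. \<tau> (s, 0))"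
proof -
  have mem: "simplical_face k t \<in> standard_simplex 2" if "t \<in> standard_simplex 1" "k \<le> 2" for k and t :: "nat \<Rightarrow> real"
    using simplical_face_in_standard_simplex[of 2 k t] that by simp
  have face: "singular_face 2 k (triangle_simplex \<tau>) =
      restrict (\<lambda>t. \<tau> (simplical_face k t 1, simplical_face k t 2)) (standard_simplex 1)" if "k \<le> 2" for k
    unfolding singular_face_def triangle_simplex_def using mem[OF _ that]
    by (auto simp: restrict_def fun_eq_iff)
  have t0: "t 0 = 1 - t 1" "t 2 = 0" if "t \<in> standard_simplex 1" for t :: "nat \<Rightarrow> real"
    using that by (simp_all add: standard_simplex_def)
  show "singular_face 2 0 (triangle_simplex \<tau>) = path_simplex (\<lambda>s. \<tau> (1 - s, s))"
    unfolding face[OF le0] path_simplex_def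
    by (rule restrict_ext) (use t0 in \<open>simp add: simplical_face_def\<close>)
  show "singular_face 2 1 (triangle_simplex \<tau>) = path_simplex (\<lambda>s. \<tau> (0, s))"
    unfolding face[OF one_le_numeral] path_simplex_def
    by (rule restrict_ext) (simp add: simplical_face_def)
  show "singular_face 2 2 (triangle_simplex \<tau>) = path_simplex (\<lambda>s. \<tau> (s, 0))"
    unfolding face[OF order_refl] path_simplex_def
    by (rule restrict_ext) (simp add: simplical_face_def)
qed

lemma triangle_of_simplex:
  assumes "singular_simplex 2 (top_of_set X) f"
  obtains \<tau> where "continuous_on std_triangle \<tau>" "\<tau> ` std_triangle \<subseteq> X" "triangle_simplex \<tau> = f"
proof -
  define g where "g = (\<lambda>(x, y) i::nat. if i = 0 then 1 - x - y else if i = 1 then x else if i = 2 then y else (0::real))"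
  have mem: "g p \<in> standard_simplex 2" if "p \<in> std_triangle" for p
    using that standard_simplex_2_mem by (auto simp: std_triangle_def g_def)
  have f: "continuous_on (standard_simplex 2) f" "f ` standard_simplex 2 \<subseteq> X" "f \<in> extensional (standard_simplex 2)"
    using assms by (auto simp: singular_simplex_top_of_set)
  have "continuous_on std_triangle g"
  proof (rule continuous_on_coordinatewise_then_product)
    fix i :: nat
    show "continuous_on std_triangle (\<lambda>p. g p i)"
      by (cases "i = 0"; cases "i = 1"; cases "i = 2") (auto simp: g_def split_beta intro!: continuous_intros)
  qed
  then have "continuous_on std_triangle (\<lambda>p. f (g p))" "(\<lambda>p. f (g p)) ` std_triangle \<subseteq> X"
    using mem f(2) by (auto intro: continuous_on_compose2[OF f(1)])
  moreover have "triangle_simplex (\<lambda>p. f (g p)) = f"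
  proof
    fix t
    show "triangle_simplex (\<lambda>p. f (g p)) t = f t"
    proof (cases "t \<in> standard_simplex 2")
      case True
      then have "t = g (t 1, t 2)" unfolding g_def prod.case by (rule standard_simplex_2D(4))
      then show ?thesis using True by (simp add: triangle_simplex_def)
    next
      case False
      then show ?thesis using f(3) by (simp add: triangle_simplex_def extensional_def)
    qed
  qed
  ultimately show thesis by (rule that)
qed

subsection \<open>Homotopy of paths in a topological space\<close>

text \<open>The library proves the groupoid laws only in normed spaces, where constant paths are line
  paths; here they are transported along maps defined on convex sets.\<close>

lemma homotopic_paths_convex_image:
  fixes f :: "'b::real_normed_vector \<Rightarrow> 'a::topological_space"
  assumes "convex C" "continuous_on C f" "f ` C \<subseteq> X" "path_in C p" "path_in C q"
    "pathstart q = pathstart p" "pathfinish q = pathfinish p"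
  shows "homotopic_paths X (f \<circ> p) (f \<circ> q)"
proof -
  have "homotopic_paths C p q"
  proof (rule homotopic_paths_linear)
    fix t :: real assume "t \<in> {0..1}"
    then have "p t \<in> C" "q t \<in> C" using assms(4,5) by (auto simp: path_image_def)
    then show "closed_segment (p t) (q t) \<subseteq> C" using assms(1) by (simp add: closed_segment_subset)
  qed (use assms in auto)
  then show ?thesis using assms(2,3) by (intro homotopic_paths_continuous_image) auto
qed

lemma path_linepath_01: "path_in {0..1} (linepath (a::real) b)" if "a \<in> {0..1}" "b \<in> {0..1}"
  using that by (auto simp: closed_segment_eq_real_ivl)

lemma
  assumes p: "path_in X p"
  shows homotopic_paths_const_left: "homotopic_paths X ((\<lambda>t. pathstart p) +++ p) p"
    and homotopic_paths_const_right: "homotopic_paths X (p +++ (\<lambda>t. pathfinish p)) p"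
    and homotopic_paths_right_inverse: "homotopic_paths X (p +++ reversepath p) (\<lambda>t. pathstart p)"
    and homotopic_paths_left_inverse: "homotopic_paths X (reversepath p +++ p) (\<lambda>t. pathfinish p)"
proof -
  have f: "continuous_on {0..1} p" "p ` {0..1} \<subseteq> X" using p by (auto simp: path_def path_image_def)
  have join: "path_in {0..1} (linepath a b +++ linepath b c)" if "a \<in> {0..1}" "b \<in> {0..1}" "c \<in> {0..1}" for a b c :: real
    using that path_linepath_01[of a b] path_linepath_01[of b c] by (auto simp: path_image_join simp del: path_image_linepath)
  \<comment> \<open>All four laws are instances: the triples a, b, c are 0, 0, 1 and 0, 1, 1 for the
    units, and 0, 1, 0 and 1, 0, 1 for the inverses.\<close>
  have *: "homotopic_paths X ((p \<circ> linepath a b) +++ (p \<circ> linepath b c)) (p \<circ> linepath a c)"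
    if "a \<in> {0..1}" "b \<in> {0..1}" "c \<in> {0..1}" for a b c :: real
    using homotopic_paths_convex_image[OF convex_real_interval(5)[of 0 1] f join[OF that] path_linepath_01[OF that(1,3)]]
    by (simp add: path_compose_join)
  have lin: "p \<circ> linepath a a = (\<lambda>t. p a)" "p \<circ> linepath 0 1 = p" "p \<circ> linepath 1 0 = reversepath p" for a :: real
    by (auto simp: linepath_def reversepath_def fun_eq_iff algebra_simps)
  show "homotopic_paths X ((\<lambda>t. pathstart p) +++ p) p" using *[of 0 0 1] by (simp add: lin pathstart_def)
  show "homotopic_paths X (p +++ (\<lambda>t. pathfinish p)) p" using *[of 0 1 1] by (simp add: lin pathfinish_def)
  show "homotopic_paths X (p +++ reversepath p) (\<lambda>t. pathstart p)" using *[of 0 1 0] by (simp add: lin pathstart_def)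
  show "homotopic_paths X (reversepath p +++ p) (\<lambda>t. pathfinish p)" using *[of 1 0 1] by (simp add: lin pathfinish_def)
qed

text \<open>In the convex planar triangle the two boundary routes from vertex 0 to vertex 2 are
  homotopic, and the simplex carries this homotopy to X. The end point equations say that
  consecutive edges meet in common vertices.\<close>

lemma homotopic_paths_triangle:
  assumes "singular_simplex 2 (top_of_set X) f"
  shows "homotopic_paths X (simplex_path (singular_face 2 2 f) +++ simplex_path (singular_face 2 0 f))
     (simplex_path (singular_face 2 1 f))"
    and "simplex_path (singular_face 2 2 f) 0 = simplex_path (singular_face 2 1 f) 0"
    and "simplex_path (singular_face 2 2 f) 1 = simplex_path (singular_face 2 0 f) 0"
    and "simplex_path (singular_face 2 0 f) 1 = simplex_path (singular_face 2 1 f) 1"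
proof -
  obtain \<tau> where t: "continuous_on std_triangle \<tau>" "\<tau> ` std_triangle \<subseteq> X" "triangle_simplex \<tau> = f"
    using triangle_of_simplex[OF assms] by blast
  note faces = triangle_faces[of \<tau>, unfolded t(3)]
  show "simplex_path (singular_face 2 2 f) 0 = simplex_path (singular_face 2 1 f) 0"
    "simplex_path (singular_face 2 2 f) 1 = simplex_path (singular_face 2 0 f) 0"
    "simplex_path (singular_face 2 0 f) 1 = simplex_path (singular_face 2 1 f) 1"
    unfolding faces by (simp_all add: simplex_path_simplex)
  have seg: "path_in std_triangle (linepath a b)" if "a \<in> std_triangle" "b \<in> std_triangle" for a b
    using that convex_triangle by (auto simp: closed_segment_subset)
  have v: "(0, 0) \<in> std_triangle" "(1, 0) \<in> std_triangle" "(0, 1) \<in> std_triangle" by (auto simp: std_triangle_def)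
  have h: "homotopic_paths X (\<tau> \<circ> (linepath (0, 0) (1, 0) +++ linepath (1, 0) (0, 1))) (\<tau> \<circ> linepath (0, 0) (0, 1))"
  proof (rule homotopic_paths_convex_image[OF convex_triangle t(1,2) _ seg[OF v(1,3)]])
    show "path_in std_triangle (linepath (0, 0) (1, 0) +++ linepath (1, 0) (0, 1))"
      using seg[OF v(1,2)] seg[OF v(2,3)] by (auto simp: path_image_join simp del: path_image_linepath)
  qed auto
  have lin: "\<tau> (linepath (0, 0) (1, 0) s) = \<tau> (s, 0)" "\<tau> (linepath (1, 0) (0, 1) s) = \<tau> (1 - s, s)"
    "\<tau> (linepath (0, 0) (0, 1) s) = \<tau> (0, s)" for s
    by (auto simp: linepath_def)
  \<comment> \<open>\<open>simplex_path\<close> of a face recovers the side of the triangle only on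
    the unit interval, so the paths are matched by \<open>homotopic_paths_eq\<close> instead of by
    equality.\<close>
  have eq1: "(\<tau> \<circ> (linepath (0, 0) (1, 0) +++ linepath (1, 0) (0, 1))) s =
      (simplex_path (singular_face 2 2 f) +++ simplex_path (singular_face 2 0 f)) s" if "s \<in> {0..1}" for s
    using that unfolding faces by (auto simp: joinpaths_def simplex_path_simplex lin)
  have eq2: "(\<tau> \<circ> linepath (0, 0) (0, 1)) s = simplex_path (singular_face 2 1 f) s" if "s \<in> {0..1}" for s
    using that unfolding faces by (auto simp: simplex_path_simplex lin)
  have pp: "path_in X (\<tau> \<circ> (linepath (0, 0) (1, 0) +++ linepath (1, 0) (0, 1)))" "path_in X (\<tau> \<circ> linepath (0, 0) (0, 1))"
    using homotopic_paths_imp_path[OF h] homotopic_paths_imp_subset[OF h] by auto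
  show "homotopic_paths X (simplex_path (singular_face 2 2 f) +++ simplex_path (singular_face 2 0 f))
     (simplex_path (singular_face 2 1 f))"
    using homotopic_paths_trans[OF homotopic_paths_sym[OF homotopic_paths_eq[OF conjunct1[OF pp(1)] conjunct2[OF pp(1)] eq1]]
        homotopic_paths_trans[OF h homotopic_paths_eq[OF conjunct1[OF pp(2)] conjunct2[OF pp(2)] eq2]]]
    by blast
qed

subsection \<open>Chains bounding combinations of paths\<close>

text \<open>Keeps the boundary and the cup product values of a 2-chain and forgets the chain itself.
  Chains can then be assembled by adding relations, and values be simplified by cocycle
  identities.\<close>

definition bounds ::
    "'a::topological_space set \<Rightarrow> 'a chain \<Rightarrow> ('a cochain \<Rightarrow> 'a cochain \<Rightarrow> int) \<Rightarrow> bool" where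
  "bounds X z v \<longleftrightarrow> (\<exists>c. singular_chain 2 (top_of_set X) c \<and> chain_boundary 2 c = z \<and>
     (\<forall>\<phi>\<in>cocycle_set 1 (top_of_set X). \<forall>\<psi>\<in>cocycle_set 1 (top_of_set X).
        frag_sum (cochain_cup 1 1 (top_of_set X) \<phi> \<psi>) c = v \<phi> \<psi>))"

abbreviation path_chain :: "(real \<Rightarrow> 'a) \<Rightarrow> 'a chain" where
  "path_chain p \<equiv> frag_of (path_simplex p)"

lemma bounds_diff:
  assumes "bounds X z v" "bounds X z' v'"
  shows "bounds X (z - z') (\<lambda>\<phi> \<psi>. v \<phi> \<psi> - v' \<phi> \<psi>)"
proof -
  obtain c where c: "singular_chain 2 (top_of_set X) c" "chain_boundary 2 c = z"
    "\<forall>\<phi>\<in>cocycle_set 1 (top_of_set X). \<forall>\<psi>\<in>cocycle_set 1 (top_of_set X).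
        frag_sum (cochain_cup 1 1 (top_of_set X) \<phi> \<psi>) c = v \<phi> \<psi>"
    using assms(1) unfolding bounds_def by blast
  obtain d where d: "singular_chain 2 (top_of_set X) d" "chain_boundary 2 d = z'"
    "\<forall>\<phi>\<in>cocycle_set 1 (top_of_set X). \<forall>\<psi>\<in>cocycle_set 1 (top_of_set X).
        frag_sum (cochain_cup 1 1 (top_of_set X) \<phi> \<psi>) d = v' \<phi> \<psi>"
    using assms(2) unfolding bounds_def by blast
  show ?thesis
    unfolding bounds_def using c d
    by (intro exI[of _ "c - d"]) (simp add: singular_chain_diff chain_boundary_diff frag_sum_diff)
qed

lemma bounds_zero: "bounds X 0 (\<lambda>\<phi> \<psi>. 0)"
  unfolding bounds_def by (intro exI[of _ 0]) simp

lemma bounds_add: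
  assumes "bounds X z v" "bounds X z' v'"
  shows "bounds X (z + z') (\<lambda>\<phi> \<psi>. v \<phi> \<psi> + v' \<phi> \<psi>)"
  using bounds_diff[OF assms(1) bounds_diff[OF bounds_zero assms(2)]] by simp

lemma bounds_cong:
  assumes "bounds X z v"
    and "\<And>\<phi> \<psi>. \<phi> \<in> cocycle_set 1 (top_of_set X) \<Longrightarrow> \<psi> \<in> cocycle_set 1 (top_of_set X) \<Longrightarrow> v \<phi> \<psi> = v' \<phi> \<psi>"
  shows "bounds X z v'"
  using assms unfolding bounds_def by force

lemma bounds_cocycle:
  assumes "bounds X z v" "\<phi> \<in> cocycle_set 1 (top_of_set X)"
  shows "frag_sum \<phi> z = 0"
  using assms cocycle_eval_boundary[of \<phi> 1] unfolding bounds_def by (auto simp: numeral_2_eq_2)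

lemma bounds_relboundary: "bounds X z v \<Longrightarrow> singular_relboundary 1 (top_of_set X) {} z"
  unfolding bounds_def singular_boundary by (auto simp: numeral_2_eq_2)

lemma bounds_triangle:
  assumes "continuous_on std_triangle \<tau>" "\<tau> ` std_triangle \<subseteq> X"
  shows "bounds X (path_chain (\<lambda>s. \<tau> (1 - s, s)) - path_chain (\<lambda>s. \<tau> (0, s)) + path_chain (\<lambda>s. \<tau> (s, 0)))
    (\<lambda>\<phi> \<psi>. \<phi> (path_simplex (\<lambda>s. \<tau> (s, 0))) * \<psi> (path_simplex (\<lambda>s. \<tau> (1 - s, s))))"
  unfolding bounds_def
proof (intro exI conjI ballI)
  show "singular_chain 2 (top_of_set X) (frag_of (triangle_simplex \<tau>))"
    by (simp add: singular_chain_of singular_simplex_triangle[OF assms])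
  show "chain_boundary 2 (frag_of (triangle_simplex \<tau>)) =
     path_chain (\<lambda>s. \<tau> (1 - s, s)) - path_chain (\<lambda>s. \<tau> (0, s)) + path_chain (\<lambda>s. \<tau> (s, 0))"
    using chain_boundary_2[of "triangle_simplex \<tau>"] unfolding triangle_faces by (simp add: numeral_2_eq_2)
  show "frag_sum (cochain_cup 1 1 (top_of_set X) \<phi> \<psi>) (frag_of (triangle_simplex \<tau>)) =
     \<phi> (path_simplex (\<lambda>s. \<tau> (s, 0))) * \<psi> (path_simplex (\<lambda>s. \<tau> (1 - s, s)))" for \<phi> \<psi>
    by (simp only: frag_sum_of cochain_cup_1[OF singular_simplex_triangle[OF assms]] triangle_faces)
qed

text \<open>The constant triangle has three equal faces with signs +, -, +, so it bounds one
  constant edge. Cocycles therefore vanish on that edge, and with them the cup value.\<close>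

lemma bounds_const:
  assumes "x \<in> X"
  shows "bounds X (path_chain (\<lambda>s. x)) (\<lambda>\<phi> \<psi>. 0)"
proof -
  have b: "bounds X (path_chain (\<lambda>s. x)) (\<lambda>\<phi> \<psi>. \<phi> (path_simplex (\<lambda>s. x)) * \<psi> (path_simplex (\<lambda>s. x)))"
    using bounds_triangle[of "\<lambda>p. x" X] assms by (simp add: image_subset_iff)
  show ?thesis
    by (rule bounds_cong[OF b]) (use bounds_cocycle[OF b] in simp)
qed

lemma cocycle_const: "x \<in> X \<Longrightarrow> \<phi> \<in> cocycle_set 1 (top_of_set X) \<Longrightarrow> \<phi> (path_simplex (\<lambda>s. x)) = 0"
  using bounds_cocycle[OF bounds_const[of x X], of \<phi>] by simp

lemma bounds_join:
  assumes p: "path_in X p" and q: "path_in X q" and eq: "pathfinish p = pathstart q"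
  shows "bounds X (path_chain p + path_chain q - path_chain (p +++ q))
    (\<lambda>\<phi> \<psi>. \<phi> (path_simplex p) * \<psi> (path_simplex q))"
proof -
  \<comment> \<open>The parameter of the joined path is y + x/2: it runs over [0, 1/2] on the bottom
    side, giving p, over [1/2, 1] on the slanted side, giving q, and over [0, 1] on the vertical
    side, giving the join.\<close>
  let ?t = "\<lambda>z. (p +++ q) (snd z + fst z / 2)"
  have pq: "path_in X (p +++ q)" using assms by (auto simp: path_image_join)
  have sub: "(\<lambda>z. snd z + fst z / 2) ` std_triangle \<subseteq> {0..1}" by (auto simp: std_triangle_def)
  have "continuous_on std_triangle (\<lambda>z. snd z + fst z / 2 :: real)"
    by (intro continuous_intros) auto
  then have t1: "continuous_on std_triangle ?t"
    by (rule continuous_on_compose2[OF conjunct1[OF pq, unfolded path_def]]) (rule sub)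
  have t2: "?t ` std_triangle \<subseteq> X"
  proof
    fix x assume "x \<in> ?t ` std_triangle"
    then obtain z where "z \<in> std_triangle" "x = ?t z" by (rule imageE)
    moreover from this have "snd z + fst z / 2 \<in> {0..1}" using sub by blast
    ultimately show "x \<in> X" using pq unfolding path_image_def by blast
  qed
  have "path_simplex (\<lambda>s. ?t (1 - s, s)) = path_simplex q"
    using eq by (intro path_simplex_cong) (auto simp: joinpaths_def pathfinish_def pathstart_def field_simps)
  moreover have "path_simplex (\<lambda>s. ?t (s, 0)) = path_simplex p"
    by (intro path_simplex_cong) (auto simp: joinpaths_def)
  moreover have "path_simplex (\<lambda>s. ?t (0, s)) = path_simplex (p +++ q)" by simp
  ultimately have "bounds X (path_chain q - path_chain (p +++ q) + path_chain p)
    (\<lambda>\<phi> \<psi>. \<phi> (path_simplex p) * \<psi> (path_simplex q))"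
    using bounds_triangle[OF t1 t2] by simp
  then show ?thesis by (simp add: algebra_simps)
qed

text \<open>The square of a homotopy is cut along its diagonal; its two other sides are constant.\<close>

lemma bounds_homotopic:
  fixes X :: "'a::topological_space set"
  assumes "homotopic_paths X p q"
  shows "bounds X (path_chain p - path_chain q) (\<lambda>\<phi> \<psi>. 0)"
proof -
  obtain h :: "real \<times> real \<Rightarrow> 'a" where h: "continuous_on ({0..1} \<times> {0..1}) h" "h \<in> ({0..1} \<times> {0..1}) \<rightarrow> X"
    "\<forall>x\<in>{0..1}. h (0, x) = p x" "\<forall>x\<in>{0..1}. h (1, x) = q x"
    "\<forall>t\<in>{0..1}. pathstart (h \<circ> Pair t) = pathstart p \<and> pathfinish (h \<circ> Pair t) = pathfinish p"
    using assms unfolding homotopic_paths by blast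
  have ends: "h (t, 0) = pathstart p" "h (t, 1) = pathfinish p" if "0 \<le> t" "t \<le> 1" for t
    using h(5) that by (auto simp: pathstart_def pathfinish_def)
  have "h (0, 0) \<in> X" "h (0, 1) \<in> X" using h(2) by auto
  then have inX: "pathstart p \<in> X" "pathfinish p \<in> X" using ends[of 0] by auto
  \<comment> \<open>The coordinates are chosen so that the side x = 0 of either triangle is the
    diagonal. The bottom sides are then p and the constant path at the start, the slanted sides the
    constant path at the end and q; each cup value has a factor on a constant edge.\<close>
  let ?A = "\<lambda>z. h (snd z, fst z + snd z)" and ?B = "\<lambda>z. h (fst z + snd z, snd z)"
  have A: "continuous_on std_triangle ?A" "?A ` std_triangle \<subseteq> X"
  proof -
    show "continuous_on std_triangle ?A"
      by (intro continuous_on_compose2[OF h(1)] continuous_intros) (auto simp: std_triangle_def)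
    show "?A ` std_triangle \<subseteq> X" using h(2) by (auto simp: std_triangle_def Pi_iff)
  qed
  have B: "continuous_on std_triangle ?B" "?B ` std_triangle \<subseteq> X"
  proof -
    show "continuous_on std_triangle ?B"
      by (intro continuous_on_compose2[OF h(1)] continuous_intros) (auto simp: std_triangle_def)
    show "?B ` std_triangle \<subseteq> X" using h(2) by (auto simp: std_triangle_def Pi_iff)
  qed
  have "path_simplex (\<lambda>s. ?A (1 - s, s)) = path_simplex (\<lambda>s. pathfinish p)"
    "path_simplex (\<lambda>s. ?A (0, s)) = path_simplex (\<lambda>s. h (s, s))"
    "path_simplex (\<lambda>s. ?A (s, 0)) = path_simplex p"
    using h(3) ends by (auto intro!: path_simplex_cong)
  then have bA: "bounds X (path_chain (\<lambda>s. pathfinish p) - path_chain (\<lambda>s. h (s, s)) + path_chain p)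
      (\<lambda>\<phi> \<psi>. \<phi> (path_simplex p) * \<psi> (path_simplex (\<lambda>s. pathfinish p)))"
    using bounds_triangle[OF A] by simp
  have "path_simplex (\<lambda>s. ?B (1 - s, s)) = path_simplex q"
    "path_simplex (\<lambda>s. ?B (0, s)) = path_simplex (\<lambda>s. h (s, s))"
    "path_simplex (\<lambda>s. ?B (s, 0)) = path_simplex (\<lambda>s. pathstart p)"
    using h(4) ends by (auto intro!: path_simplex_cong)
  then have bB: "bounds X (path_chain q - path_chain (\<lambda>s. h (s, s)) + path_chain (\<lambda>s. pathstart p))
      (\<lambda>\<phi> \<psi>. \<phi> (path_simplex (\<lambda>s. pathstart p)) * \<psi> (path_simplex q))"
    using bounds_triangle[OF B] by simp
  have "bounds X (path_chain p - path_chain q)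
     (\<lambda>\<phi> \<psi>. (\<phi> (path_simplex p) * \<psi> (path_simplex (\<lambda>s. pathfinish p)) -
        \<phi> (path_simplex (\<lambda>s. pathstart p)) * \<psi> (path_simplex q)) - 0 + 0)"
    using bounds_add[OF bounds_diff[OF bounds_diff[OF bA bB] bounds_const[OF inX(2)]] bounds_const[OF inX(1)]]
    by (simp add: algebra_simps)
  then show ?thesis
  proof (rule bounds_cong)
    fix \<phi> \<psi> assume "\<phi> \<in> cocycle_set 1 (top_of_set X)" "\<psi> \<in> cocycle_set 1 (top_of_set X)"
    then show "\<phi> (path_simplex p) * \<psi> (path_simplex (\<lambda>s. pathfinish p)) -
        \<phi> (path_simplex (\<lambda>s. pathstart p)) * \<psi> (path_simplex q) - 0 + 0 = 0"
      using cocycle_const[OF inX(1), of \<phi>] cocycle_const[OF inX(2), of \<psi>] by simp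
  qed
qed

text \<open>The cup value stays existential, because \<open>bounds_edge\<close> uses this relation
  for its boundary.\<close>

lemma bounds_reverse:
  assumes "path_in X p"
  obtains v where "bounds X (path_chain p + path_chain (reversepath p)) v"
proof -
  have "path_in X (reversepath p)" using assms by simp
  note b = bounds_join[OF assms this]
  have "pathstart p \<in> X" using assms by (auto simp: pathstart_in_path_image)
  note c = bounds_add[OF bounds_add[OF b bounds_homotopic[OF homotopic_paths_right_inverse[OF assms]]] bounds_const[OF this]]
  show thesis by (rule that) (use c in simp)
qed

section \<open>Spaces with a presented fundamental group\<close>

lemma (in group) normal_Inter:
  assumes "\<N> \<noteq> {}" "\<And>N. N \<in> \<N> \<Longrightarrow> N \<lhd> G"
  shows "\<Inter>\<N> \<lhd> G"
  unfolding normal_inv_iff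
proof
  show "subgroup (\<Inter>\<N>) G"
    using assms by (intro subgroups_Inter) (auto intro: normal_imp_subgroup)
  show "\<forall>x\<in>carrier G. \<forall>h\<in>\<Inter>\<N>. x \<otimes> h \<otimes> inv x \<in> \<Inter>\<N>"
    using assms(2) unfolding normal_inv_iff by blast
qed

text \<open>The two loops meet in the inverse of b followed by b, which cancels. In the application
  a, b, c are the chosen paths to the vertices of a triangle, p and q its front and back edge, and r
  the third edge.\<close>

lemma homotopic_conjugates_join:
  assumes paths: "path_in X a" "path_in X p" "path_in X b" "path_in X q" "path_in X c"
    and ends: "pathfinish a = pathstart p" "pathfinish b = pathfinish p" "pathstart q = pathfinish p"
      "pathfinish c = pathfinish q" "pathstart b = pathstart a" "pathstart c = pathstart a"
    and r: "homotopic_paths X (p +++ q) r"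
  shows "homotopic_paths X ((a +++ (p +++ reversepath b)) +++ (b +++ (q +++ reversepath c)))
    (a +++ (r +++ reversepath c))"
proof -
  have rb: "path_in X (reversepath b)" "path_in X (reversepath c)" using paths by auto
  have qc: "path_in X (q +++ reversepath c)" using paths rb ends by (auto simp: path_image_join)
  have bqc: "path_in X (b +++ (q +++ reversepath c))" using paths qc ends by (auto simp: path_image_join)
  have pb: "path_in X (p +++ reversepath b)" using paths rb ends by (auto simp: path_image_join)
  have "homotopic_paths X (reversepath b +++ (b +++ (q +++ reversepath c))) ((reversepath b +++ b) +++ (q +++ reversepath c))"
    using paths rb qc ends by (intro homotopic_paths_assoc) auto
  also have "homotopic_paths X ((reversepath b +++ b) +++ (q +++ reversepath c)) ((\<lambda>t. pathstart (q +++ reversepath c)) +++ (q +++ reversepath c))"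
    by (rule homotopic_paths_join) (use homotopic_paths_left_inverse[OF paths(3)] qc ends in auto)
  also have "homotopic_paths X ((\<lambda>t. pathstart (q +++ reversepath c)) +++ (q +++ reversepath c)) (q +++ reversepath c)"
    by (rule homotopic_paths_const_left[OF qc])
  finally have 1: "homotopic_paths X (reversepath b +++ (b +++ (q +++ reversepath c))) (q +++ reversepath c)" .
  have "homotopic_paths X ((p +++ reversepath b) +++ (b +++ (q +++ reversepath c))) (p +++ (reversepath b +++ (b +++ (q +++ reversepath c))))"
    using paths rb bqc ends by (intro homotopic_paths_sym[OF homotopic_paths_assoc]) auto
  also have "homotopic_paths X (p +++ (reversepath b +++ (b +++ (q +++ reversepath c)))) (p +++ (q +++ reversepath c))"
    by (rule homotopic_paths_join) (use 1 paths ends in auto)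
  also have "homotopic_paths X (p +++ (q +++ reversepath c)) ((p +++ q) +++ reversepath c)"
    using paths rb ends by (intro homotopic_paths_assoc) auto
  also have "homotopic_paths X ((p +++ q) +++ reversepath c) (r +++ reversepath c)"
    by (rule homotopic_paths_join) (use r rb ends in auto)
  finally have 2: "homotopic_paths X ((p +++ reversepath b) +++ (b +++ (q +++ reversepath c))) (r +++ reversepath c)" .
  have "homotopic_paths X ((a +++ (p +++ reversepath b)) +++ (b +++ (q +++ reversepath c)))
      (a +++ ((p +++ reversepath b) +++ (b +++ (q +++ reversepath c))))"
    using paths pb bqc ends by (intro homotopic_paths_sym[OF homotopic_paths_assoc]) auto
  also have "homotopic_paths X (a +++ ((p +++ reversepath b) +++ (b +++ (q +++ reversepath c)))) (a +++ (r +++ reversepath c))"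
    by (rule homotopic_paths_join) (use 2 paths ends in auto)
  finally show ?thesis .
qed

lemma sum_frag_cmul_delta:
  assumes "finite I" "k \<in> I"
  shows "(\<Sum>i\<in>I. frag_cmul (if i = k then a else 0) (f i)) = frag_cmul a (f k)"
proof -
  have "(\<Sum>i\<in>I. frag_cmul (if i = k then a else 0) (f i)) = (\<Sum>i\<in>I. if i = k then frag_cmul a (f k) else 0)"
    by (intro sum.cong) auto
  then show ?thesis using assms by simp
qed

locale presented_space =
  fixes I :: "'i set" and R :: "'i word set set" and X :: "'a::topological_space set" and x0 :: 'a
    and \<alpha> :: "'i word set set \<Rightarrow> (real \<Rightarrow> 'a) set"
  assumes finite_I: "finite I"
    and relators: "R \<subseteq> lower_central (free_group I) 2"
    and base: "x0 \<in> X"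
    and path_connected: "path_connected X"
    and iso: "\<alpha> \<in> iso (presented_group I R) (fundamental_group X x0)"
begin

abbreviation "F \<equiv> free_group I"
abbreviation "N \<equiv> normal_closure F R"
abbreviation "T \<equiv> top_of_set X"
abbreviation "loop p \<equiv> path_in X p \<and> pathstart p = x0 \<and> pathfinish p = x0"
abbreviation "cls p \<equiv> {q. homotopic_paths X p q}"

sublocale F: group F by (rule group_free_group)

lemma normal_N: "N \<lhd> F"
  unfolding normal_closure_def using F.normal_lower_central_2 relators by (intro F.normal_Inter) auto

lemma relators_N: "R \<subseteq> N"
  by (auto simp: normal_closure_def)

lemma N_lower_central: "N \<subseteq> lower_central F 2"
  unfolding normal_closure_def using F.normal_lower_central_2 relators by (intro Inter_lower) simp

lemma N_minimal: "M \<lhd> F \<Longrightarrow> R \<subseteq> M \<Longrightarrow> N \<subseteq> M"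
  unfolding normal_closure_def by (intro Inter_lower) simp

lemmas subgroup_N = normal_imp_subgroup[OF normal_N]

lemma N_closed: "r \<in> N \<Longrightarrow> r \<in> carrier F"
  using subgroup.mem_carrier[OF subgroup_N] .

lemma N_coset_eq_iff:
  assumes "x \<in> carrier F" "y \<in> carrier F"
  shows "N #>\<^bsub>F\<^esub> x = N #>\<^bsub>F\<^esub> y \<longleftrightarrow> x \<otimes>\<^bsub>F\<^esub> inv\<^bsub>F\<^esub> y \<in> N"
proof
  assume "N #>\<^bsub>F\<^esub> x = N #>\<^bsub>F\<^esub> y"
  then have "x \<in> N #>\<^bsub>F\<^esub> y" using F.rcos_self[OF assms(1) subgroup_N] by simp
  then obtain h where h: "h \<in> N" "x = h \<otimes>\<^bsub>F\<^esub> y" unfolding r_coset_def by blast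
  then show "x \<otimes>\<^bsub>F\<^esub> inv\<^bsub>F\<^esub> y \<in> N" using N_closed assms by (simp add: F.m_assoc)
next
  assume h: "x \<otimes>\<^bsub>F\<^esub> inv\<^bsub>F\<^esub> y \<in> N"
  have "x = (x \<otimes>\<^bsub>F\<^esub> inv\<^bsub>F\<^esub> y) \<otimes>\<^bsub>F\<^esub> y" using assms by (simp add: F.m_assoc)
  then have "x \<in> N #>\<^bsub>F\<^esub> y" using h unfolding r_coset_def by blast
  then show "N #>\<^bsub>F\<^esub> x = N #>\<^bsub>F\<^esub> y" using F.repr_independence[OF _ assms(2) subgroup_N] by simp
qed

subsection \<open>Words and loops\<close>

lemma cls_eq_iff: "loop p \<Longrightarrow> loop q \<Longrightarrow> cls p = cls q \<longleftrightarrow> homotopic_paths X p q"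
proof
  assume "loop p" "loop q" "cls p = cls q"
  then have "q \<in> cls q" by simp
  then show "homotopic_paths X p q" using \<open>cls p = cls q\<close> by blast
next
  assume "homotopic_paths X p q"
  then show "cls p = cls q" using homotopic_paths_trans homotopic_paths_sym by blast
qed

lemma homotopic_loop: "loop p \<Longrightarrow> homotopic_paths X p q \<Longrightarrow> loop q"
  using homotopic_paths_imp_path homotopic_paths_imp_subset homotopic_paths_imp_pathstart
    homotopic_paths_imp_pathfinish by metis

lemma loop_join: "loop p \<Longrightarrow> loop q \<Longrightarrow> loop (p +++ q)"
  by (auto simp: path_image_join)

lemma cls_mult: "loop p \<Longrightarrow> loop q \<Longrightarrow> cls p \<otimes>\<^bsub>fundamental_group X x0\<^esub> cls q = cls (p +++ q)"
proof -
  assume p: "loop p" and q: "loop q"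
  have "(\<Union>a\<in>cls p. \<Union>b\<in>cls q. cls (a +++ b)) = cls (p +++ q)"
  proof (rule UN2_const)
    have "p \<in> cls p" "q \<in> cls q" using p q by auto
    then show "cls p \<noteq> {}" "cls q \<noteq> {}" by blast+
    fix a b assume "a \<in> cls p" "b \<in> cls q"
    then have ab: "homotopic_paths X p a" "homotopic_paths X q b" by auto
    then have "homotopic_paths X (p +++ q) (a +++ b)" using p q by (intro homotopic_paths_join) auto
    then show "cls (a +++ b) = cls (p +++ q)"
      using cls_eq_iff[OF loop_join[OF p q] loop_join[OF homotopic_loop[OF p ab(1)] homotopic_loop[OF q ab(2)]]] by simp
  qed
  then show ?thesis by (simp add: fundamental_group_def)
qed

lemma carrier_fundamental_group: "carrier (fundamental_group X x0) = {cls p | p. loop p}"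
  unfolding fundamental_group_def by (simp only: partial_object.simps conj_assoc)

text \<open>A relation and not a function: a word represents every loop of one homotopy class, and a
  loop is represented by every word of one coset of N.\<close>

definition represents :: "'i word set \<Rightarrow> (real \<Rightarrow> 'a) \<Rightarrow> bool" where
  "represents w p \<longleftrightarrow> w \<in> carrier F \<and> loop p \<and> \<alpha> (N #>\<^bsub>F\<^esub> w) = cls p"

lemma coset_presented: "w \<in> carrier F \<Longrightarrow> N #>\<^bsub>F\<^esub> w \<in> carrier (presented_group I R)"
  by (auto simp: presented_group_def FactGroup_def RCOSETS_def)

lemma represents_exists:
  assumes "w \<in> carrier F"
  obtains p where "represents w p"
proof -
  have "\<alpha> (N #>\<^bsub>F\<^esub> w) \<in> carrier (fundamental_group X x0)"
    using iso coset_presented[OF assms] by (auto simp: iso_def hom_def)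
  then show thesis using that assms unfolding represents_def carrier_fundamental_group by blast
qed

lemma represents_word:
  assumes "loop p"
  obtains w where "represents w p"
proof -
  have "cls p \<in> carrier (fundamental_group X x0)" using assms by (auto simp: carrier_fundamental_group)
  then have "cls p \<in> \<alpha> ` carrier (presented_group I R)"
    using iso by (simp add: iso_def bij_betw_def)
  then obtain w where "w \<in> carrier F" "\<alpha> (N #>\<^bsub>F\<^esub> w) = cls p"
    by (auto simp: presented_group_def FactGroup_def RCOSETS_def)
  then show thesis using that assms by (auto simp: represents_def)
qed

lemma represents_homotopic: "represents w p \<Longrightarrow> represents w q \<Longrightarrow> homotopic_paths X p q"
  using cls_eq_iff unfolding represents_def by metis

lemma represents_cong:
  assumes "represents w p" "homotopic_paths X p q"
  shows "represents w q"
proof -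
  have p: "loop p" using assms(1) by (simp add: represents_def)
  have "cls p = cls q" using cls_eq_iff[OF p homotopic_loop[OF p assms(2)]] assms(2) by simp
  then show ?thesis using assms(1) homotopic_loop[OF p assms(2)] by (simp add: represents_def)
qed

lemma represents_mult:
  assumes w: "represents w p" and v: "represents v q"
  shows "represents (w \<otimes>\<^bsub>F\<^esub> v) (p +++ q)"
proof -
  have c: "w \<in> carrier F" "v \<in> carrier F" "loop p" "loop q" using assms by (auto simp: represents_def)
  have "N #>\<^bsub>F\<^esub> (w \<otimes>\<^bsub>F\<^esub> v) = (N #>\<^bsub>F\<^esub> w) \<otimes>\<^bsub>presented_group I R\<^esub> (N #>\<^bsub>F\<^esub> v)"
    using normal.rcos_sum[OF normal_N c(1,2)] by (simp add: presented_group_def FactGroup_def)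
  then have "\<alpha> (N #>\<^bsub>F\<^esub> (w \<otimes>\<^bsub>F\<^esub> v)) = \<alpha> (N #>\<^bsub>F\<^esub> w) \<otimes>\<^bsub>fundamental_group X x0\<^esub> \<alpha> (N #>\<^bsub>F\<^esub> v)"
    using iso coset_presented[OF c(1)] coset_presented[OF c(2)] by (simp add: iso_def hom_def)
  then have "\<alpha> (N #>\<^bsub>F\<^esub> (w \<otimes>\<^bsub>F\<^esub> v)) = cls (p +++ q)"
    using assms cls_mult[OF c(3,4)] by (simp add: represents_def)
  then show ?thesis using c loop_join[OF c(3,4)] by (simp add: represents_def)
qed

lemma represents_inj:
  assumes w: "represents w p" and v: "represents v p"
  shows "w \<otimes>\<^bsub>F\<^esub> inv\<^bsub>F\<^esub> v \<in> N"
proof -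
  have c: "w \<in> carrier F" "v \<in> carrier F" using assms by (auto simp: represents_def)
  have "\<alpha> (N #>\<^bsub>F\<^esub> w) = \<alpha> (N #>\<^bsub>F\<^esub> v)" using assms by (simp add: represents_def)
  moreover have "inj_on \<alpha> (carrier (presented_group I R))" using iso by (simp add: iso_def bij_betw_def)
  ultimately have "N #>\<^bsub>F\<^esub> w = N #>\<^bsub>F\<^esub> v"
    using coset_presented[OF c(1)] coset_presented[OF c(2)] by (simp add: inj_on_def)
  then show ?thesis using N_coset_eq_iff[OF c] by simp
qed

text \<open>A relation and the empty word have the same class in the presented group. In this form
  the null homotopy of the loop of a relation is used.\<close>

lemma represents_N:
  assumes r: "r \<in> N" and p: "represents r p"
  shows "represents \<one>\<^bsub>F\<^esub> p"
proof -
  have "N #>\<^bsub>F\<^esub> r = N #>\<^bsub>F\<^esub> \<one>\<^bsub>F\<^esub>" using N_coset_eq_iff[OF N_closed[OF r] F.one_closed] r N_closed by simp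
  then show ?thesis using p by (simp add: represents_def)
qed

definition gen_loop :: "'i \<Rightarrow> real \<Rightarrow> 'a" where
  "gen_loop i = (SOME p. represents (free_group_gen i) p)"

lemma represents_gen: "i \<in> I \<Longrightarrow> represents (free_group_gen i) (gen_loop i)"
  unfolding gen_loop_def using represents_exists[OF free_group_gen_closed] by (metis someI_ex)

subsection \<open>Quadratic forms of words\<close>

definition word_chain :: "'i word set \<Rightarrow> 'a chain" where
  "word_chain w = (\<Sum>i\<in>I. frag_cmul (exponent i w) (path_chain (gen_loop i)))"

definition linear_value :: "'i word set \<Rightarrow> 'a cochain \<Rightarrow> int" where
  "linear_value w \<phi> = (\<Sum>i\<in>I. exponent i w * \<phi> (path_simplex (gen_loop i)))"

text \<open>The quadratic part of the Magnus expansion of w, evaluated by sending x_i x_j to the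
  product of \<phi> on the i-th and \<psi> on the j-th generator loop.\<close>

definition quadratic_value ::
    "'i word set \<Rightarrow> 'a cochain \<Rightarrow> 'a cochain \<Rightarrow> int" where
  "quadratic_value w \<phi> \<psi> =
     (\<Sum>i\<in>I. \<Sum>j\<in>I. magnus i j w * (\<phi> (path_simplex (gen_loop i)) * \<psi> (path_simplex (gen_loop j))))"

lemma word_chain_mult:
  "x \<in> carrier F \<Longrightarrow> y \<in> carrier F \<Longrightarrow> word_chain (x \<otimes>\<^bsub>F\<^esub> y) = word_chain x + word_chain y"
  by (simp add: word_chain_def exponent_mult frag_cmul_distrib sum.distrib)

lemma linear_value_mult:
  "x \<in> carrier F \<Longrightarrow> y \<in> carrier F \<Longrightarrow> linear_value (x \<otimes>\<^bsub>F\<^esub> y) \<phi> = linear_value x \<phi> + linear_value y \<phi>"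
  by (simp add: linear_value_def exponent_mult distrib_right sum.distrib)

text \<open>The cross term has the shape of the cup value in \<open>bounds_join\<close>, which is
  why adding triangles computes quadratic values.\<close>

lemma quadratic_value_mult:
  assumes "x \<in> carrier F" "y \<in> carrier F"
  shows "quadratic_value (x \<otimes>\<^bsub>F\<^esub> y) \<phi> \<psi> =
    quadratic_value x \<phi> \<psi> + quadratic_value y \<phi> \<psi> + linear_value x \<phi> * linear_value y \<psi>"
proof -
  have "linear_value x \<phi> * linear_value y \<psi> =
    (\<Sum>i\<in>I. \<Sum>j\<in>I. exponent i x * exponent j y * (\<phi> (path_simplex (gen_loop i)) * \<psi> (path_simplex (gen_loop j))))"
    unfolding linear_value_def sum_product by (intro sum.cong) (auto simp: algebra_simps)
  then show ?thesis
    using assms by (simp add: quadratic_value_def magnus_mult distrib_right sum.distrib)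
qed

lemma word_chain_one: "word_chain \<one>\<^bsub>F\<^esub> = 0"
  and linear_value_one: "linear_value \<one>\<^bsub>F\<^esub> \<phi> = 0"
  and quadratic_value_one: "quadratic_value \<one>\<^bsub>F\<^esub> \<phi> \<psi> = 0"
  by (simp_all add: word_chain_def linear_value_def quadratic_value_def exponent_one magnus_one)

lemma word_chain_gen: "i \<in> I \<Longrightarrow> word_chain (free_group_gen i) = path_chain (gen_loop i)"
  using sum_frag_cmul_delta[OF finite_I, of i 1 "\<lambda>i. path_chain (gen_loop i)"]
  by (simp add: word_chain_def exponent_gen)

lemma linear_value_gen: "i \<in> I \<Longrightarrow> linear_value (free_group_gen i) \<phi> = \<phi> (path_simplex (gen_loop i))"
  using finite_I by (simp add: linear_value_def exponent_gen if_distrib[of "\<lambda>x. x * _"] cong: if_cong)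

lemma quadratic_value_gen: "quadratic_value (free_group_gen i) \<phi> \<psi> = 0"
  by (simp add: quadratic_value_def magnus_gen)

lemma word_chain_inv: "x \<in> carrier F \<Longrightarrow> word_chain (inv\<^bsub>F\<^esub> x) = - word_chain x"
  using word_chain_mult[of x "inv\<^bsub>F\<^esub> x"] by (simp add: word_chain_one eq_neg_iff_add_eq_0 add.commute)

lemma linear_value_inv: "x \<in> carrier F \<Longrightarrow> linear_value (inv\<^bsub>F\<^esub> x) \<phi> = - linear_value x \<phi>"
  using linear_value_mult[of x "inv\<^bsub>F\<^esub> x" \<phi>] by (simp add: linear_value_one)

lemma quadratic_value_inv:
  "x \<in> carrier F \<Longrightarrow> quadratic_value (inv\<^bsub>F\<^esub> x) \<phi> \<psi> = linear_value x \<phi> * linear_value x \<psi> - quadratic_value x \<phi> \<psi>"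
  using quadratic_value_mult[of x "inv\<^bsub>F\<^esub> x" \<phi> \<psi>] by (simp add: quadratic_value_one linear_value_inv)

lemma frag_sum_word_chain: "frag_sum \<phi> (word_chain w) = linear_value w \<phi>"
  by (simp add: word_chain_def linear_value_def frag_sum_sum frag_sum_cmul)

lemma lower_central_2_values:
  assumes "r \<in> lower_central F 2"
  shows "word_chain r = 0" "linear_value r \<phi> = 0"
  using lower_central_2_invariants(1)[OF assms] by (simp_all add: word_chain_def linear_value_def)

text \<open>The relation between a word and a loop representing it is bounded by one triangle for each letter.\<close>

lemma bounds_word:
  assumes "represents w p"
  shows "bounds X (word_chain w - path_chain p) (quadratic_value w)"
proof -
  have "w \<in> carrier F" using assms by (simp add: represents_def)
  then show ?thesis
    using assms
  proof (induction w arbitrary: p rule: free_group_induct)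
    case one
    then have p: "path_in X p" "pathfinish p = pathstart p" by (auto simp: represents_def)
    \<comment> \<open>A loop representing the empty word is homotopic to its own square. Together
      with \<open>bounds_join\<close> this makes p itself a boundary, so cocycles vanish on p, and
      so does the cup value of the chain.\<close>
    have "represents \<one>\<^bsub>F\<^esub> (p +++ p)" using represents_mult[OF one one] by simp
    from represents_homotopic[OF this one] have h: "homotopic_paths X (p +++ p) p" .
    have b: "bounds X (path_chain p) (\<lambda>\<phi> \<psi>. \<phi> (path_simplex p) * \<psi> (path_simplex p))"
      using bounds_add[OF bounds_join[OF p(1) p(1) p(2)] bounds_homotopic[OF h]] by simp
    have z: "\<phi> (path_simplex p) = 0" if "\<phi> \<in> cocycle_set 1 T" for \<phi>
      using bounds_cocycle[OF b that] by simp
    have "bounds X (path_chain p) (\<lambda>\<phi> \<psi>. 0)"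
      by (rule bounds_cong[OF b]) (simp add: z[unfolded One_nat_def])
    then show ?case
      using bounds_diff[OF bounds_zero, of X "path_chain p" "\<lambda>\<phi> \<psi>. 0"]
      by (simp add: word_chain_one quadratic_value_one[abs_def])
  next
    case (gen w k)
    obtain q where q: "represents w q" using represents_exists[OF gen.hyps(1)] by blast
    have g: "represents (free_group_gen k) (gen_loop k)" by (rule represents_gen[OF gen.hyps(2)])
    have h: "homotopic_paths X (q +++ gen_loop k) p"
      by (rule represents_homotopic[OF represents_mult[OF q g] gen.prems])
    have "loop q" "loop (gen_loop k)" using q g by (auto simp: represents_def)
    then have "bounds X (path_chain q + path_chain (gen_loop k) - path_chain (q +++ gen_loop k))
        (\<lambda>\<phi> \<psi>. \<phi> (path_simplex q) * \<psi> (path_simplex (gen_loop k)))"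
      by (intro bounds_join) auto
    note b = bounds_add[OF bounds_add[OF gen.IH[OF q] this] bounds_homotopic[OF h]]
    \<comment> \<open>The boundary in the induction hypothesis also determines \<phi> on the loop q,
      which turns the cup value of the new triangle into the cross term of
      \<open>quadratic_value_mult\<close>.\<close>
    have val: "\<phi> (path_simplex q) = linear_value w \<phi>" if "\<phi> \<in> cocycle_set 1 T" for \<phi>
      using bounds_cocycle[OF gen.IH[OF q] that] by (simp add: frag_sum_diff frag_sum_word_chain)
    have "word_chain (w \<otimes>\<^bsub>F\<^esub> free_group_gen k) - path_chain p =
        word_chain w - path_chain q + (path_chain q + path_chain (gen_loop k) - path_chain (q +++ gen_loop k)) +
        (path_chain (q +++ gen_loop k) - path_chain p)"
      using gen by (simp add: word_chain_mult word_chain_gen free_group_gen_closed)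
    then have "bounds X (word_chain (w \<otimes>\<^bsub>F\<^esub> free_group_gen k) - path_chain p)
       (\<lambda>\<phi> \<psi>. quadratic_value w \<phi> \<psi> + \<phi> (path_simplex q) * \<psi> (path_simplex (gen_loop k)) + 0)"
      using b by (simp only:)
    then show ?case
      by (rule bounds_cong) (use gen val in \<open>simp add: quadratic_value_mult quadratic_value_gen linear_value_gen free_group_gen_closed\<close>)
  next
    case (inv_gen w k)
    obtain q where q: "represents w q" using represents_exists[OF inv_gen.hyps(1)] by blast
    have g: "represents (free_group_gen k) (gen_loop k)" by (rule represents_gen[OF inv_gen.hyps(2)])
    \<comment> \<open>For an inverse letter the triangle is placed backwards: p followed by the
      generator loop represents w, and the relation of this join is subtracted. So only the loops
      \<open>gen_loop\<close> themselves occur.\<close>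
    have "represents (w \<otimes>\<^bsub>F\<^esub> inv\<^bsub>F\<^esub> free_group_gen k \<otimes>\<^bsub>F\<^esub> free_group_gen k) (p +++ gen_loop k)"
      by (rule represents_mult[OF inv_gen.prems g])
    then have "represents w (p +++ gen_loop k)"
      using inv_gen.hyps by (simp add: F.m_assoc free_group_gen_closed)
    then have h: "homotopic_paths X (p +++ gen_loop k) q" using represents_homotopic q by blast
    have "loop p" "loop (gen_loop k)" using inv_gen.prems g by (auto simp: represents_def)
    then have j: "bounds X (path_chain p + path_chain (gen_loop k) - path_chain (p +++ gen_loop k))
        (\<lambda>\<phi> \<psi>. \<phi> (path_simplex p) * \<psi> (path_simplex (gen_loop k)))"
      by (intro bounds_join) auto
    note pj = bounds_add[OF j bounds_homotopic[OF h]]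
    note b = bounds_diff[OF inv_gen.IH[OF q] pj]
    have val: "\<phi> (path_simplex p) = linear_value w \<phi> - \<phi> (path_simplex (gen_loop k))" if "\<phi> \<in> cocycle_set 1 T" for \<phi>
      using bounds_cocycle[OF inv_gen.IH[OF q] that] bounds_cocycle[OF pj that]
      by (simp add: frag_sum_diff frag_sum_add frag_sum_word_chain)
    have "word_chain (w \<otimes>\<^bsub>F\<^esub> inv\<^bsub>F\<^esub> free_group_gen k) - path_chain p =
        word_chain w - path_chain q - (path_chain p + path_chain (gen_loop k) - path_chain (p +++ gen_loop k) +
        (path_chain (p +++ gen_loop k) - path_chain q))"
      using inv_gen by (simp add: word_chain_mult word_chain_inv word_chain_gen free_group_gen_closed)
    then have "bounds X (word_chain (w \<otimes>\<^bsub>F\<^esub> inv\<^bsub>F\<^esub> free_group_gen k) - path_chain p)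
       (\<lambda>\<phi> \<psi>. quadratic_value w \<phi> \<psi> - (\<phi> (path_simplex p) * \<psi> (path_simplex (gen_loop k)) + 0))"
      using b by (simp only:)
    then show ?case
    proof (rule bounds_cong)
      fix \<phi> \<psi> assume "\<phi> \<in> cocycle_set 1 T"
      moreover have "quadratic_value (w \<otimes>\<^bsub>F\<^esub> inv\<^bsub>F\<^esub> free_group_gen k) \<phi> \<psi> = quadratic_value w \<phi> \<psi> +
          \<phi> (path_simplex (gen_loop k)) * \<psi> (path_simplex (gen_loop k)) -
          linear_value w \<phi> * \<psi> (path_simplex (gen_loop k))"
        using inv_gen.hyps by (simp add: quadratic_value_mult quadratic_value_inv
          quadratic_value_gen linear_value_inv linear_value_gen free_group_gen_closed)
      ultimately show "quadratic_value w \<phi> \<psi> - (\<phi> (path_simplex p) * \<psi> (path_simplex (gen_loop k)) + 0) =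
          quadratic_value (w \<otimes>\<^bsub>F\<^esub> inv\<^bsub>F\<^esub> free_group_gen k) \<phi> \<psi>"
        by (simp only: val) (simp add: algebra_simps)
    qed
  qed
qed

subsection \<open>The word of an edge\<close>

text \<open>The constant path at the base point is imposed, so that closing up an edge that is
  already a loop at x0 does not change its homotopy class; see
  \<open>edge_loop_of_loop\<close>.\<close>

definition tail_path :: "'a \<Rightarrow> real \<Rightarrow> 'a" where
  "tail_path x = (if x = x0 then (\<lambda>t. x0)
     else (SOME g. path_in X g \<and> pathstart g = x0 \<and> pathfinish g = x))"

lemma tail_path:
  assumes "x \<in> X"
  shows "path_in X (tail_path x)" "pathstart (tail_path x) = x0" "pathfinish (tail_path x) = x"
proof -
  have "path_in X (tail_path x) \<and> pathstart (tail_path x) = x0 \<and> pathfinish (tail_path x) = x"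
  proof (cases "x = x0")
    case True
    then show ?thesis
      using base by (auto simp: tail_path_def path_def path_image_def pathstart_def pathfinish_def)
  next
    case False
    have "\<exists>g. path_in X g \<and> pathstart g = x0 \<and> pathfinish g = x"
      using path_connected base assms unfolding path_connected_def by blast
    moreover have "tail_path x = (SOME g. path_in X g \<and> pathstart g = x0 \<and> pathfinish g = x)"
      using False by (simp only: tail_path_def if_False)
    ultimately show ?thesis using someI_ex[of "\<lambda>g. path_in X g \<and> pathstart g = x0 \<and> pathfinish g = x"] by metis
  qed
  then show "path_in X (tail_path x)" "pathstart (tail_path x) = x0" "pathfinish (tail_path x) = x" by auto
qed

definition edge_loop :: "((nat \<Rightarrow> real) \<Rightarrow> 'a) \<Rightarrow> real \<Rightarrow> 'a" where
  "edge_loop e = tail_path (simplex_path e 0) +++ (simplex_path e +++ reversepath (tail_path (simplex_path e 1)))"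

definition edge_word :: "((nat \<Rightarrow> real) \<Rightarrow> 'a) \<Rightarrow> 'i word set" where
  "edge_word e = (SOME w. represents w (edge_loop e))"

lemma edge_ends:
  assumes "singular_simplex 1 T e"
  shows "simplex_path e 0 \<in> X" "simplex_path e 1 \<in> X"
  using path_simplex_path[OF assms] by (auto simp: path_image_def)

lemma edge_path_closed:
  assumes "singular_simplex 1 T e"
  shows "path_in X (simplex_path e +++ reversepath (tail_path (simplex_path e 1)))" "loop (edge_loop e)"
proof -
  note t0 = tail_path[OF edge_ends(1)[OF assms]] and t1 = tail_path[OF edge_ends(2)[OF assms]]
  have s: "pathstart (simplex_path e) = simplex_path e 0" "pathfinish (simplex_path e) = simplex_path e 1"
    by (auto simp: pathstart_def pathfinish_def)
  show p: "path_in X (simplex_path e +++ reversepath (tail_path (simplex_path e 1)))"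
    using path_simplex_path[OF assms] t1 s by (auto simp: path_image_join)
  show "loop (edge_loop e)"
    unfolding edge_loop_def using p t0 t1 s by (auto simp: path_image_join)
qed

lemma represents_edge: "singular_simplex 1 T e \<Longrightarrow> represents (edge_word e) (edge_loop e)"
  unfolding edge_word_def using represents_word[OF edge_path_closed(2)] by (metis someI_ex)

lemma edge_word_closed: "singular_simplex 1 T e \<Longrightarrow> edge_word e \<in> carrier F"
  using represents_edge by (simp add: represents_def)

lemma bounds_edge:
  assumes e: "singular_simplex 1 T e"
  obtains v where "bounds X (word_chain (edge_word e) - frag_of e +
    (path_chain (tail_path (simplex_path e 1)) - path_chain (tail_path (simplex_path e 0)))) v"
proof -
  let ?a = "tail_path (simplex_path e 0)" and ?b = "tail_path (simplex_path e 1)" and ?p = "simplex_path e"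
  note a = tail_path[OF edge_ends(1)[OF e]] and b = tail_path[OF edge_ends(2)[OF e]]
  have s: "pathstart ?p = simplex_path e 0" "pathfinish ?p = simplex_path e 1"
    by (auto simp: pathstart_def pathfinish_def)
  note p = path_simplex_path[OF e]
  have j1: "bounds X (path_chain ?a + path_chain (?p +++ reversepath ?b) - path_chain (edge_loop e))
     (\<lambda>\<phi> \<psi>. \<phi> (path_simplex ?a) * \<psi> (path_simplex (?p +++ reversepath ?b)))"
    unfolding edge_loop_def using a s by (intro bounds_join edge_path_closed(1)[OF e]) auto
  have j2: "bounds X (path_chain ?p + path_chain (reversepath ?b) - path_chain (?p +++ reversepath ?b))
     (\<lambda>\<phi> \<psi>. \<phi> (path_simplex ?p) * \<psi> (path_simplex (reversepath ?b)))"
    using p b s by (intro bounds_join) auto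
  obtain v where j3: "bounds X (path_chain ?b + path_chain (reversepath ?b)) v"
    using bounds_reverse[OF b(1)] by blast
  have "word_chain (edge_word e) - frag_of e + (path_chain ?b - path_chain ?a) =
    word_chain (edge_word e) - path_chain (edge_loop e) -
    (path_chain ?a + path_chain (?p +++ reversepath ?b) - path_chain (edge_loop e)) -
    (path_chain ?p + path_chain (reversepath ?b) - path_chain (?p +++ reversepath ?b)) +
    (path_chain ?b + path_chain (reversepath ?b))"
    by (simp add: path_simplex_of_path[OF e])
  note eq = this
  show thesis
    by (rule that, unfold eq)
      (rule bounds_add[OF bounds_diff[OF bounds_diff[OF bounds_word[OF represents_edge[OF e]] j1] j2] j3])
qed

text \<open>This says that \<phi> is the linear value of edge words plus the coboundary of its
  values on the tails, read off from the boundary in \<open>bounds_edge\<close>.\<close>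

lemma cocycle_edge:
  assumes "\<phi> \<in> cocycle_set 1 T" "singular_simplex 1 T e"
  shows "\<phi> e = linear_value (edge_word e) \<phi> - \<phi> (path_simplex (tail_path (simplex_path e 0))) +
    \<phi> (path_simplex (tail_path (simplex_path e 1)))"
proof -
  obtain v where "bounds X (word_chain (edge_word e) - frag_of e +
    (path_chain (tail_path (simplex_path e 1)) - path_chain (tail_path (simplex_path e 0)))) v"
    using bounds_edge[OF assms(2)] by blast
  then show ?thesis
    using bounds_cocycle[OF _ assms(1)] by (fastforce simp: frag_sum_add frag_sum_diff frag_sum_word_chain)
qed

definition triangle_word :: "((nat \<Rightarrow> real) \<Rightarrow> 'a) \<Rightarrow> 'i word set" where
  "triangle_word f = edge_word (singular_face 2 2 f) \<otimes>\<^bsub>F\<^esub> edge_word (singular_face 2 0 f) \<otimes>\<^bsub>F\<^esub>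
     inv\<^bsub>F\<^esub> edge_word (singular_face 2 1 f)"

lemma triangle_face_simplex: "singular_simplex 2 T f \<Longrightarrow> k \<le> 2 \<Longrightarrow> singular_simplex 1 T (singular_face 2 k f)"
  using singular_simplex_singular_face[of 2 T f k] by (simp add: numeral_2_eq_2)

text \<open>The edge loops of faces 2 and 0 compose to that of face 1, as the tail at the middle
  vertex cancels. So two words represent one loop, and their quotient is a relation.\<close>

lemma triangle_word_N:
  assumes f: "singular_simplex 2 T f"
  shows "triangle_word f \<in> N"
proof -
  let ?e = "\<lambda>k. singular_face 2 k f"
  have s: "singular_simplex 1 T (?e k)" if "k \<le> 2" for k using triangle_face_simplex[OF f that] .
  note tri = homotopic_paths_triangle[OF f]
  note t0 = tail_path[OF edge_ends(1)[OF s[of 2]]] and t1 = tail_path[OF edge_ends(2)[OF s[of 2]]]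
    and t2 = tail_path[OF edge_ends(2)[OF s[of 0]]]
  have "homotopic_paths X (edge_loop (?e 2) +++ edge_loop (?e 0)) (edge_loop (?e 1))"
    unfolding edge_loop_def tri(3)[symmetric] tri(2)[symmetric] tri(4)[symmetric]
  proof (rule homotopic_conjugates_join[OF _ _ _ _ _ _ _ _ _ _ _ tri(1)])
    show "path_in X (tail_path (simplex_path (?e 2) 0))" using t0 by simp
    show "path_in X (tail_path (simplex_path (?e 2) 1))" using t1 by simp
    show "path_in X (tail_path (simplex_path (?e 0) 1))" using t2 by simp
    show "path_in X (simplex_path (?e 2))" "path_in X (simplex_path (?e 0))"
      using path_simplex_path s by auto
  qed (use t0 t1 t2 tri(3) in \<open>simp_all add: pathstart_def pathfinish_def\<close>)
  then have "represents (edge_word (?e 2) \<otimes>\<^bsub>F\<^esub> edge_word (?e 0)) (edge_loop (?e 1))"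
    using represents_cong[OF represents_mult[OF represents_edge[OF s] represents_edge[OF s]]] by simp
  from represents_inj[OF this represents_edge[OF s]] show ?thesis by (simp add: triangle_word_def)
qed

end

context presented_space
begin

subsection \<open>Cup products evaluated on 2-cycles\<close>

definition tail_value :: "'a cochain \<Rightarrow> 'a \<Rightarrow> int" where
  "tail_value \<phi> x = \<phi> (path_simplex (tail_path x))"

text \<open>With t for the tail values and l for the linear values of edge words, this 1-cochain is
  t\<phi> cup \<psi> - l\<phi> cup t\<psi> - q. The first two terms have coboundaries d(t\<phi>) cup
  \<psi> and l\<phi> cup d(t\<psi>), and q is the quadratic value of the edge word.\<close>

definition cup_correction ::
    "'a cochain \<Rightarrow> 'a cochain \<Rightarrow> ((nat \<Rightarrow> real) \<Rightarrow> 'a) \<Rightarrow> int" where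
  "cup_correction \<phi> \<psi> e = tail_value \<phi> (simplex_path e 0) * \<psi> e -
     linear_value (edge_word e) \<phi> * tail_value \<psi> (simplex_path e 1) - quadratic_value (edge_word e) \<phi> \<psi>"

lemma triangle_word_closed: "singular_simplex 2 T f \<Longrightarrow> triangle_word f \<in> lower_central F 2"
  using triangle_word_N N_lower_central by blast

text \<open>All three compare the two sides of \<open>triangle_word f\<close> times word 1 = word 2
  times word 0. The triangle word lies in N, hence in the commutator subgroup, and so adds no
  exponents and no cross term.\<close>

lemma triangle_edges:
  assumes f: "singular_simplex 2 T f"
  shows "exponent k (edge_word (singular_face 2 1 f)) =
      exponent k (edge_word (singular_face 2 2 f)) + exponent k (edge_word (singular_face 2 0 f))"
    and "linear_value (edge_word (singular_face 2 1 f)) \<phi> =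
      linear_value (edge_word (singular_face 2 2 f)) \<phi> + linear_value (edge_word (singular_face 2 0 f)) \<phi>"
    and "quadratic_value (triangle_word f) \<phi> \<psi> + quadratic_value (edge_word (singular_face 2 1 f)) \<phi> \<psi> =
      quadratic_value (edge_word (singular_face 2 2 f)) \<phi> \<psi> + quadratic_value (edge_word (singular_face 2 0 f)) \<phi> \<psi> +
      linear_value (edge_word (singular_face 2 2 f)) \<phi> * linear_value (edge_word (singular_face 2 0 f)) \<psi>"
proof -
  let ?w = "\<lambda>k. edge_word (singular_face 2 k f)"
  have w: "?w 0 \<in> carrier F" "?w 1 \<in> carrier F" "?w 2 \<in> carrier F"
    using edge_word_closed triangle_face_simplex[OF f] by auto
  have t: "triangle_word f \<in> carrier F" using F.lower_central_2_closed[OF triangle_word_closed[OF f]] .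
  note t0 = lower_central_2_invariants(1)[OF triangle_word_closed[OF f]] lower_central_2_values(2)[OF triangle_word_closed[OF f]]
  have eq: "triangle_word f \<otimes>\<^bsub>F\<^esub> ?w 1 = ?w 2 \<otimes>\<^bsub>F\<^esub> ?w 0"
    using w by (simp add: triangle_word_def F.m_assoc)
  have "exponent k (triangle_word f \<otimes>\<^bsub>F\<^esub> ?w 1) = exponent k (?w 2 \<otimes>\<^bsub>F\<^esub> ?w 0)" by (simp only: eq)
  then show "exponent k (?w 1) = exponent k (?w 2) + exponent k (?w 0)"
    using exponent_mult[OF t w(2)] exponent_mult[OF w(3,1)] t0(1) by simp
  have "linear_value (triangle_word f \<otimes>\<^bsub>F\<^esub> ?w 1) \<phi> = linear_value (?w 2 \<otimes>\<^bsub>F\<^esub> ?w 0) \<phi>" by (simp only: eq)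
  then show "linear_value (?w 1) \<phi> = linear_value (?w 2) \<phi> + linear_value (?w 0) \<phi>"
    using linear_value_mult[OF t w(2)] linear_value_mult[OF w(3,1)] t0(2) by simp
  have "quadratic_value (triangle_word f \<otimes>\<^bsub>F\<^esub> ?w 1) \<phi> \<psi> = quadratic_value (?w 2 \<otimes>\<^bsub>F\<^esub> ?w 0) \<phi> \<psi>" by (simp only: eq)
  then show "quadratic_value (triangle_word f) \<phi> \<psi> + quadratic_value (?w 1) \<phi> \<psi> =
      quadratic_value (?w 2) \<phi> \<psi> + quadratic_value (?w 0) \<phi> \<psi> + linear_value (?w 2) \<phi> * linear_value (?w 0) \<psi>"
    using quadratic_value_mult[OF t w(2)] quadratic_value_mult[OF w(3,1)] t0(2) by simp
qed

text \<open>Insert \<phi> = l\<phi> + d(t\<phi>) and the same for \<psi>. The tail terms are the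
  coboundary of the first two parts of the correction, and l\<phi> cup l\<psi> is the cross term by
  which the quadratic value fails to be additive along the triangle.\<close>

lemma cup_triangle:
  assumes phi: "\<phi> \<in> cocycle_set 1 T" and psi: "\<psi> \<in> cocycle_set 1 T" and f: "singular_simplex 2 T f"
  shows "\<phi> (singular_face 2 2 f) * \<psi> (singular_face 2 0 f) = quadratic_value (triangle_word f) \<phi> \<psi> +
    (cup_correction \<phi> \<psi> (singular_face 2 0 f) - cup_correction \<phi> \<psi> (singular_face 2 1 f) +
     cup_correction \<phi> \<psi> (singular_face 2 2 f))"
proof -
  let ?e = "\<lambda>k. singular_face 2 k f"
  have s: "singular_simplex 1 T (?e k)" if "k \<le> 2" for k using triangle_face_simplex[OF f that] .
  note v = homotopic_paths_triangle(2-4)[OF f]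
  have ph: "\<phi> (?e 2) = linear_value (edge_word (?e 2)) \<phi> - tail_value \<phi> (simplex_path (?e 2) 0) + tail_value \<phi> (simplex_path (?e 2) 1)"
    using cocycle_edge[OF phi s[of 2]] by (simp add: tail_value_def)
  have ps: "\<psi> (?e 0) = linear_value (edge_word (?e 0)) \<psi> - tail_value \<psi> (simplex_path (?e 0) 0) + tail_value \<psi> (simplex_path (?e 0) 1)"
    using cocycle_edge[OF psi s[of 0]] by (simp add: tail_value_def)
  have q: "quadratic_value (triangle_word f) \<phi> \<psi> =
      quadratic_value (edge_word (?e 2)) \<phi> \<psi> + quadratic_value (edge_word (?e 0)) \<phi> \<psi> +
      linear_value (edge_word (?e 2)) \<phi> * linear_value (edge_word (?e 0)) \<psi> - quadratic_value (edge_word (?e 1)) \<phi> \<psi>"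
    using triangle_edges(3)[OF f, of \<phi> \<psi>] by simp
  define A B C where "A = tail_value \<phi> (simplex_path (?e 2) 0)" and "B = tail_value \<phi> (simplex_path (?e 2) 1)"
    and "C = \<psi> (?e 0)"
  define A' B' where "A' = tail_value \<psi> (simplex_path (?e 0) 0)" and "B' = tail_value \<psi> (simplex_path (?e 0) 1)"
  define l l' where "l = linear_value (edge_word (?e 2)) \<phi>" and "l' = linear_value (edge_word (?e 0)) \<phi>"
  define D where "D = \<psi> (?e 2)"
  define k where "k = linear_value (edge_word (?e 0)) \<psi>"
  have c1: "cup_correction \<phi> \<psi> (?e 0) = B * C - l' * B' - quadratic_value (edge_word (?e 0)) \<phi> \<psi>"
    by (simp add: cup_correction_def B_def C_def B'_def l'_def v(2))
  have c2: "cup_correction \<phi> \<psi> (?e 1) = A * (D + C) - (l + l') * B' - quadratic_value (edge_word (?e 1)) \<phi> \<psi>"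
    unfolding cup_correction_def triangle_edges(2)[OF f] cocycle_triangle[OF psi f] A_def C_def B'_def l_def l'_def D_def
      v(1)[symmetric] v(3)[symmetric] by simp
  have c3: "cup_correction \<phi> \<psi> (?e 2) = A * D - l * A' - quadratic_value (edge_word (?e 2)) \<phi> \<psi>"
    by (simp add: cup_correction_def A_def A'_def D_def l_def v(2))
  have peq: "\<phi> (?e 2) = l - A + B" and ceq: "C = k - A' + B'"
    using ph ps by (simp_all add: A_def B_def C_def l_def A'_def B'_def k_def)
  have "\<phi> (?e 2) * C = l * C - A * C + B * C" unfolding peq by (simp add: algebra_simps)
  moreover have "l * C = l * k - l * A' + l * B'" unfolding ceq by (simp add: algebra_simps)
  moreover have "quadratic_value (triangle_word f) \<phi> \<psi> =
      quadratic_value (edge_word (?e 2)) \<phi> \<psi> + quadratic_value (edge_word (?e 0)) \<phi> \<psi> +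
      l * k - quadratic_value (edge_word (?e 1)) \<phi> \<psi>"
    using q by (simp add: l_def k_def)
  ultimately show ?thesis
    unfolding c1 c2 c3 C_def[symmetric] by (simp add: algebra_simps)
qed

lemma quadratic_value_N_diff:
  assumes "r \<in> N" "s \<in> N"
  shows "quadratic_value (r \<otimes>\<^bsub>F\<^esub> inv\<^bsub>F\<^esub> s) \<phi> \<psi> = quadratic_value r \<phi> \<psi> - quadratic_value s \<phi> \<psi>"
proof -
  have "r \<in> lower_central F 2" "s \<in> lower_central F 2" using assms N_lower_central by auto
  then show ?thesis
    using N_closed assms by (simp add: quadratic_value_mult quadratic_value_inv lower_central_2_values)
qed

text \<open>The order of quantifiers matters: one relation r, the product of triangle words and
  their inverses, serves all pairs of cocycles. It exists because the quadratic value is additive on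
  N.\<close>

lemma cup_chain:
  assumes "singular_chain 2 T c"
  shows "\<exists>r\<in>N. \<forall>\<phi>\<in>cocycle_set 1 T. \<forall>\<psi>\<in>cocycle_set 1 T. frag_sum (cochain_cup 1 1 T \<phi> \<psi>) c =
    quadratic_value r \<phi> \<psi> + frag_sum (cup_correction \<phi> \<psi>) (chain_boundary 2 c)"
  using assms unfolding singular_chain_def
proof (induction c rule: frag_induction)
  case zero
  then show ?case
    using subgroup.one_closed[OF subgroup_N] by (intro bexI[of _ "\<one>\<^bsub>F\<^esub>"]) (simp_all add: quadratic_value_one)
next
  case (one f)
  then have f: "singular_simplex 2 T f" by simp
  have "frag_sum (cochain_cup 1 1 T \<phi> \<psi>) (frag_of f) =
    quadratic_value (triangle_word f) \<phi> \<psi> + frag_sum (cup_correction \<phi> \<psi>) (chain_boundary 2 (frag_of f))"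
    if "\<phi> \<in> cocycle_set 1 T" "\<psi> \<in> cocycle_set 1 T" for \<phi> \<psi>
    unfolding numeral_2_eq_2 chain_boundary_2 frag_sum_of frag_sum_add frag_sum_diff
    unfolding numeral_2_eq_2[symmetric] cochain_cup_1[OF f] by (rule cup_triangle[OF that f])
  then show ?case using triangle_word_N[OF f] by blast
next
  case (diff a b)
  then obtain r s where r: "r \<in> N" "\<forall>\<phi>\<in>cocycle_set 1 T. \<forall>\<psi>\<in>cocycle_set 1 T. frag_sum (cochain_cup 1 1 T \<phi> \<psi>) a =
      quadratic_value r \<phi> \<psi> + frag_sum (cup_correction \<phi> \<psi>) (chain_boundary 2 a)"
    and s: "s \<in> N" "\<forall>\<phi>\<in>cocycle_set 1 T. \<forall>\<psi>\<in>cocycle_set 1 T. frag_sum (cochain_cup 1 1 T \<phi> \<psi>) b =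
      quadratic_value s \<phi> \<psi> + frag_sum (cup_correction \<phi> \<psi>) (chain_boundary 2 b)" by blast
  have "r \<otimes>\<^bsub>F\<^esub> inv\<^bsub>F\<^esub> s \<in> N"
    using r(1) s(1) subgroup.m_closed[OF subgroup_N] subgroup.m_inv_closed[OF subgroup_N] by blast
  then show ?case
    by (rule bexI[rotated])
      (simp add: r(2) s(2) frag_sum_diff chain_boundary_diff quadratic_value_N_diff[OF r(1) s(1)] del: One_nat_def)
qed

lemma cup_cycle:
  assumes "singular_relcycle 2 T {} c"
  obtains r where "r \<in> N"
    "\<And>\<phi> \<psi>. \<phi> \<in> cocycle_set 1 T \<Longrightarrow> \<psi> \<in> cocycle_set 1 T \<Longrightarrow>
       frag_sum (cochain_cup 1 1 T \<phi> \<psi>) c = quadratic_value r \<phi> \<psi>"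
proof -
  have c: "singular_chain 2 T c" "chain_boundary 2 c = 0" using assms by (auto simp: singular_cycle)
  obtain r where r: "r \<in> N" "\<forall>\<phi>\<in>cocycle_set 1 T. \<forall>\<psi>\<in>cocycle_set 1 T. frag_sum (cochain_cup 1 1 T \<phi> \<psi>) c =
    quadratic_value r \<phi> \<psi> + frag_sum (cup_correction \<phi> \<psi>) (chain_boundary 2 c)"
    using cup_chain[OF c(1)] by blast
  show thesis by (rule that[OF r(1)]) (simp add: r(2) c(2) del: One_nat_def)
qed

text \<open>A loop p representing r also represents the empty word. The chains that
  \<open>bounds_word\<close> gives for the two words both contain p with coefficient -1 in their
  boundary; the difference is closed, since r has no exponents, and has the quadratic value of
  r.\<close>

lemma cup_relator:
  assumes "r \<in> N"
  obtains c where "singular_relcycle 2 T {} c"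
    "\<And>\<phi> \<psi>. \<phi> \<in> cocycle_set 1 T \<Longrightarrow> \<psi> \<in> cocycle_set 1 T \<Longrightarrow>
       frag_sum (cochain_cup 1 1 T \<phi> \<psi>) c = quadratic_value r \<phi> \<psi>"
proof -
  obtain p where p: "represents r p" using represents_exists[OF N_closed[OF assms]] by blast
  have "word_chain r = 0" using lower_central_2_values(1) assms N_lower_central by blast
  then have "bounds X 0 (quadratic_value r)"
    using bounds_diff[OF bounds_word[OF p] bounds_word[OF represents_N[OF assms p]]]
    by (simp add: word_chain_one quadratic_value_one)
  then show thesis using that unfolding bounds_def singular_cycle by blast
qed

lemma gen_loop_cycle:
  assumes "loop p"
  shows "singular_relcycle 1 T {} (path_chain p)"
proof -
  have s: "singular_simplex 1 T (path_simplex p)" using assms by (intro singular_simplex_path) simp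
  have face: "singular_face 1 k (path_simplex p) = (\<lambda>t\<in>standard_simplex 0. x0)" if "k \<le> 1" for k
  proof -
    have e: "simplical_face k t \<in> standard_simplex 1" "simplical_face k t 1 \<in> {0, 1}" if "t \<in> standard_simplex 0" for t :: "nat \<Rightarrow> real"
      using that \<open>k \<le> 1\<close> simplical_face_in_standard_simplex[of 1 k t]
      by (auto simp: standard_simplex_0 simplical_face_def)
    have "p s = x0" if "s \<in> {0, 1}" for s using assms that by (auto simp: pathstart_def pathfinish_def)
    then show ?thesis
      unfolding singular_face_def path_simplex_def using e by (auto simp: restrict_def fun_eq_iff)
  qed
  have "chain_boundary (Suc 0) (path_chain p) = 0"
    unfolding chain_boundary_1 using face[of 0] face[of 1] by simp
  then show ?thesis using s by (simp add: singular_cycle singular_chain_of)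
qed

lemma coset_value_loop:
  assumes "\<psi> \<in> cochain_coset 1 T \<phi>" "loop p"
  shows "\<psi> (path_simplex p) = \<phi> (path_simplex p)"
proof -
  obtain b where b: "b \<in> coboundary_set (Suc 0) T" "\<psi> = (\<lambda>f. b f + \<phi> f)"
    using assms(1) unfolding mem_cochain_coset by auto
  have "frag_sum b (path_chain p) = 0"
    using coboundary_eval_cycle[OF b(1), of "path_chain p"] gen_loop_cycle[OF assms(2)] by simp
  then show ?thesis by (simp add: b(2))
qed

lemma loop_gen: "i \<in> I \<Longrightarrow> loop (gen_loop i)"
  using represents_gen by (simp add: represents_def)

text \<open>Cohomologous cocycles agree on the generator loops and so have equal quadratic values.
  By \<open>cup_triangle\<close> the two cup products then differ by the coboundary of the
  difference of their corrections.\<close>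

lemma cup_product_coset:
  assumes phi: "\<phi> \<in> cocycle_set 1 T" and psi: "\<psi> \<in> cocycle_set 1 T"
  shows "cup_product 1 1 T (cochain_coset 1 T \<phi>) (cochain_coset 1 T \<psi>) = cochain_coset 2 T (cochain_cup 1 1 T \<phi> \<psi>)"
proof -
  have "cochain_coset 2 T (cochain_cup 1 1 T \<phi>' \<psi>') = cochain_coset 2 T (cochain_cup 1 1 T \<phi> \<psi>)"
    if p': "\<phi>' \<in> cochain_coset 1 T \<phi>" and q': "\<psi>' \<in> cochain_coset 1 T \<psi>" for \<phi>' \<psi>'
  proof -
    have c': "\<phi>' \<in> cocycle_set 1 T" "\<psi>' \<in> cocycle_set 1 T"
      using cochain_coset_cocycle[of _ 0 T] phi psi p' q' by auto
    have q: "quadratic_value w \<phi>' \<psi>' = quadratic_value w \<phi> \<psi>" for w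
      unfolding quadratic_value_def
      by (intro sum.cong) (simp_all add: coset_value_loop[OF p' loop_gen] coset_value_loop[OF q' loop_gen])
    \<comment> \<open>Cochains have to vanish off the singular simplices, which
      \<open>cup_correction\<close> alone does not guarantee.\<close>
    let ?t = "\<lambda>e. if singular_simplex 1 T e then cup_correction \<phi>' \<psi>' e - cup_correction \<phi> \<psi> e else 0"
    have "cochain_cup 1 1 T \<phi>' \<psi>' = (\<lambda>f. coboundary 1 T ?t f + cochain_cup 1 1 T \<phi> \<psi> f)"
    proof
      fix f
      show "cochain_cup 1 1 T \<phi>' \<psi>' f = coboundary 1 T ?t f + cochain_cup 1 1 T \<phi> \<psi> f"
      proof (cases "singular_simplex 2 T f")
        case True
        have "coboundary 1 T ?t f = frag_sum ?t (chain_boundary (Suc 1) (frag_of f))"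
          using True by (simp add: coboundary_def cochain_eval_frag_sum numeral_2_eq_2)
        also have "\<dots> = ?t (singular_face 2 0 f) - ?t (singular_face 2 1 f) + ?t (singular_face 2 2 f)"
          unfolding One_nat_def chain_boundary_2 by (simp add: frag_sum_add frag_sum_diff)
        finally show ?thesis
          using cup_triangle[OF c' True] cup_triangle[OF phi psi True] triangle_face_simplex[OF True] q
          by (simp add: cochain_cup_1[OF True, unfolded One_nat_def])
      next
        case False
        then show ?thesis by (simp add: cochain_cup_def coboundary_def numeral_2_eq_2)
      qed
    qed
    moreover have "coboundary 1 T ?t \<in> coboundary_set (Suc 1) T"
      unfolding coboundary_set_Suc by (intro imageI) simp
    ultimately show ?thesis
      using cochain_coset_eqI[of "coboundary 1 T ?t" 1 T "cochain_cup 1 1 T \<phi>' \<psi>'" "cochain_cup 1 1 T \<phi> \<psi>"]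
      by (simp add: numeral_2_eq_2)
  qed
  note eq = this
  have "cochain_coset 1 T \<phi> \<noteq> {}" "cochain_coset 1 T \<psi> \<noteq> {}"
    using cochain_coset_self[of \<phi> 0 T] cochain_coset_self[of \<psi> 0 T] unfolding One_nat_def by blast+
  then have "(\<Union>\<phi>'\<in>cochain_coset 1 T \<phi>. \<Union>\<psi>'\<in>cochain_coset 1 T \<psi>. cochain_coset 2 T (cochain_cup 1 1 T \<phi>' \<psi>')) =
      cochain_coset 2 T (cochain_cup 1 1 T \<phi> \<psi>)"
    by (rule UN2_const) (rule eq)
  then show ?thesis unfolding cup_product_def one_add_one .
qed

subsection \<open>First homology\<close>

definition dual_cocycle :: "'i \<Rightarrow> ((nat \<Rightarrow> real) \<Rightarrow> 'a) \<Rightarrow> int" where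
  "dual_cocycle k e = (if singular_simplex 1 T e then exponent k (edge_word e) else 0)"

text \<open>Exponent sums of edge words add up along a triangle because its boundary word is a
  relation, and relations lie in the commutator subgroup. Here the commutator hypothesis produces
  cohomology classes.\<close>

lemma dual_cocycle: "dual_cocycle k \<in> cocycle_set 1 T"
proof (rule cocycle_setI)
  fix f assume "singular_simplex (Suc 1) T f"
  then have f: "singular_simplex 2 T f" by (simp add: numeral_2_eq_2)
  show "frag_sum (dual_cocycle k) (chain_boundary (Suc 1) (frag_of f)) = 0"
    unfolding One_nat_def chain_boundary_2 frag_sum_of frag_sum_add frag_sum_diff
    using triangle_face_simplex[OF f] triangle_edges(1)[OF f] by (simp add: dual_cocycle_def)
qed (simp add: dual_cocycle_def)

lemma edge_loop_of_loop:
  assumes "loop p"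
  shows "homotopic_paths X (edge_loop (path_simplex p)) p"
proof -
  have s: "simplex_path (path_simplex p) t = p t" if "t \<in> {0..1}" for t using that by (simp add: simplex_path_simplex)
  have ends: "simplex_path (path_simplex p) 0 = x0" "simplex_path (path_simplex p) 1 = x0"
    using s assms by (auto simp: pathstart_def pathfinish_def)
  let ?q = "simplex_path (path_simplex p)"
  have e: "singular_simplex 1 T (path_simplex p)" using assms by (intro singular_simplex_path) simp
  have q: "path_in X ?q" "pathstart ?q = x0" "pathfinish ?q = x0"
    using path_simplex_path[OF e] ends by (auto simp: pathstart_def pathfinish_def)
  have rev: "reversepath (\<lambda>t. x0) = (\<lambda>t. x0)" by (simp add: reversepath_def)
  have c: "path_in X (\<lambda>t. x0)" using base by (auto simp: path_def path_image_def)
  have eq: "edge_loop (path_simplex p) = (\<lambda>t. x0) +++ (?q +++ (\<lambda>t. x0))"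
    by (simp add: edge_loop_def ends tail_path_def rev)
  have qc: "path_in X (?q +++ (\<lambda>t. x0))"
    using q c by (auto simp: path_image_join pathstart_def)
  have "homotopic_paths X ((\<lambda>t. x0) +++ (?q +++ (\<lambda>t. x0))) (?q +++ (\<lambda>t. x0))"
    using homotopic_paths_const_left[OF qc] q by simp
  also have "homotopic_paths X (?q +++ (\<lambda>t. x0)) ?q"
    using homotopic_paths_const_right[OF q(1)] q by simp
  also have "homotopic_paths X ?q p"
    using q s by (intro homotopic_paths_eq) auto
  finally show ?thesis by (simp only: eq)
qed

text \<open>The edge word of a generator loop is a choice, but it differs from the generator by an
  element of N, on which exponent sums vanish.\<close>

lemma dual_cocycle_gen:
  assumes i: "i \<in> I"
  shows "dual_cocycle k (path_simplex (gen_loop i)) = (if k = i then 1 else 0)"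
proof -
  have e: "singular_simplex 1 T (path_simplex (gen_loop i))" using loop_gen[OF i] by (intro singular_simplex_path) simp
  let ?w = "edge_word (path_simplex (gen_loop i))"
  have "represents ?w (gen_loop i)"
    using represents_cong[OF represents_edge[OF e] edge_loop_of_loop[OF loop_gen[OF i]]] .
  from represents_inj[OF this represents_gen[OF i]]
  have "?w \<otimes>\<^bsub>F\<^esub> inv\<^bsub>F\<^esub> free_group_gen i \<in> lower_central F 2" using N_lower_central by blast
  from lower_central_2_invariants(1)[OF this] have "exponent k ?w = exponent k (free_group_gen i)"
    using edge_word_closed[OF e] free_group_gen_closed[OF i] by (simp add: exponent_mult exponent_inv)
  then show ?thesis using e by (simp add: dual_cocycle_def exponent_gen)
qed

abbreviation "H1 \<equiv> homology_group 1 T"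
abbreviation "C1 \<equiv> cohomology_group 1 T"

definition gen_class :: "'i \<Rightarrow> 'a chain set" where
  "gen_class i = homologous_rel_set 1 T {} (path_chain (gen_loop i))"

definition dual_class :: "'i \<Rightarrow> 'a cochain set" where
  "dual_class k = cochain_coset 1 T (dual_cocycle k)"

lemma carrier_H1: "carrier H1 = homologous_rel_set 1 T {} ` singular_relcycle_set 1 T {}"
  using carrier_relative_homology_group[of 1 T "{}"] by simp

lemma carrier_H2: "carrier (homology_group 2 T) = homologous_rel_set 2 T {} ` singular_relcycle_set 2 T {}"
  using carrier_relative_homology_group[of 2 T "{}"] by simp

lemma carrier_C1: "carrier C1 = cochain_coset 1 T ` cocycle_set 1 T"
  by (rule carrier_cohomology_group)

lemma mult_H1:
  assumes "singular_relcycle 1 T {} a" "singular_relcycle 1 T {} b"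
  shows "homologous_rel_set 1 T {} a \<otimes>\<^bsub>H1\<^esub> homologous_rel_set 1 T {} b = homologous_rel_set 1 T {} (a + b)"
proof -
  have "H1 = relcycle_group 1 T {} Mod singular_relboundary_set 1 T {}"
    using nontrivial_relative_homology_group[of 1 T "{}"] by simp
  then show ?thesis
    using normal.rcos_sum[OF normal_subgroup_singular_relboundary_relcycle, of a 1 T "{}" b] assms
    unfolding right_coset_singular_relboundary by (simp add: FactGroup_def)
qed

lemma kronecker_1:
  assumes "\<phi> \<in> cocycle_set 1 T" "singular_relcycle 1 T {} c"
  shows "kronecker 1 T (homologous_rel_set 1 T {} c) (cochain_coset 1 T \<phi>) = frag_sum \<phi> c"
  using kronecker_eval[of \<phi> 0 T c] assms by simp

lemma kronecker_2:
  assumes "\<phi> \<in> cocycle_set 2 T" "singular_relcycle 2 T {} c"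
  shows "kronecker 2 T (homologous_rel_set 2 T {} c) (cochain_coset 2 T \<phi>) = frag_sum \<phi> c"
  using kronecker_eval[of \<phi> 1 T c] assms by (simp add: numeral_2_eq_2)

lemma gen_class_closed: "i \<in> I \<Longrightarrow> gen_class i \<in> carrier H1"
  unfolding gen_class_def carrier_H1 using gen_loop_cycle[OF loop_gen] by blast

lemma dual_class_closed: "dual_class k \<in> carrier C1"
  unfolding dual_class_def carrier_C1 using dual_cocycle by blast

lemma kronecker_gen: "i \<in> I \<Longrightarrow> \<phi> \<in> cocycle_set 1 T \<Longrightarrow>
    kronecker 1 T (gen_class i) (cochain_coset 1 T \<phi>) = \<phi> (path_simplex (gen_loop i))"
  unfolding gen_class_def using kronecker_1[OF _ gen_loop_cycle[OF loop_gen]] by simp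

lemma kronecker_gen_dual: "i \<in> I \<Longrightarrow> kronecker 1 T (gen_class i) (dual_class k) = (if k = i then 1 else 0)"
  unfolding dual_class_def using kronecker_gen[OF _ dual_cocycle] dual_cocycle_gen by simp

lemma kronecker_mult:
  assumes "a \<in> carrier C1" "x \<in> carrier H1" "y \<in> carrier H1"
  shows "kronecker 1 T (x \<otimes>\<^bsub>H1\<^esub> y) a = kronecker 1 T x a + kronecker 1 T y a"
proof -
  obtain \<phi> c d where "a = cochain_coset 1 T \<phi>" "\<phi> \<in> cocycle_set 1 T"
    and c: "x = homologous_rel_set 1 T {} c" "singular_relcycle 1 T {} c"
    and d: "y = homologous_rel_set 1 T {} d" "singular_relcycle 1 T {} d"
    using assms unfolding carrier_C1 carrier_H1 by blast
  then show ?thesis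
    using mult_H1[OF c(2) d(2)] kronecker_1 singular_relcycle_add[OF c(2) d(2)] by (simp add: frag_sum_add)
qed

lemma hurewicz_gen:
  assumes i: "i \<in> I"
  shows "hurewicz X (\<alpha> (presented_gen I R i)) = gen_class i"
proof -
  have a: "\<alpha> (presented_gen I R i) = cls (gen_loop i)"
    using represents_gen[OF i] by (simp add: represents_def presented_gen_def)
  have "homologous_rel_set 1 T {} (path_chain p) = gen_class i" if "p \<in> cls (gen_loop i)" for p
  proof -
    have "homologous_rel 1 T {} (path_chain (gen_loop i)) (path_chain p)"
      unfolding homologous_rel_def using bounds_relboundary[OF bounds_homotopic] that by blast
    then show ?thesis unfolding gen_class_def by (metis homologous_rel_eq)
  qed
  moreover have "gen_loop i \<in> cls (gen_loop i)" using loop_gen[OF i] by simp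
  ultimately have "(\<Union>p\<in>cls (gen_loop i). homologous_rel_set 1 T {} (path_chain p)) = gen_class i" by blast
  then show ?thesis unfolding hurewicz_def a path_simplex_def by simp
qed

text \<open>The linear extension of \<open>bounds_edge\<close>. The tails are written as a function
  of the boundary of c, so for a cycle they disappear and c is homologous to a combination of
  generator loops.\<close>

lemma bounds_chain:
  assumes "singular_chain 1 T c"
  shows "\<exists>v. bounds X ((\<Sum>i\<in>I. frag_cmul (frag_sum (dual_cocycle i) c) (path_chain (gen_loop i))) - c +
    frag_extend (\<lambda>x. path_chain (tail_path (x (\<lambda>j. if j = 0 then 1 else 0)))) (chain_boundary 1 c)) v"
  using assms unfolding singular_chain_def
proof (induction c rule: frag_induction)
  case zero
  then show ?case using bounds_zero by auto
next
  case (one e)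
  then have e: "singular_simplex 1 T e" by simp
  let ?G = "frag_extend (\<lambda>x. path_chain (tail_path (x (\<lambda>j. if j = 0 then 1 else 0))))"
  \<comment> \<open>The only point of the standard 0-simplex; evaluating a 0-simplex there gives the
    vertex whose tail is meant.\<close>
  have pt: "(\<lambda>j. if j = 0 then 1 else 0) \<in> standard_simplex 0" by (simp add: standard_simplex_0)
  have f0: "simplical_face 0 (\<lambda>j. if j = 0 then 1 else 0) = (\<lambda>i. if i = 0 then 1 - 1 else if i = 1 then 1 else (0::real))"
    by (auto simp: simplical_face_def)
  have f1: "simplical_face 1 (\<lambda>j. if j = 0 then 1 else 0) = (\<lambda>i. if i = 0 then 1 - 0 else if i = 1 then 0 else (0::real))"
    by (auto simp: simplical_face_def)
  have sf: "singular_face 1 k e (\<lambda>j. if j = 0 then 1 else 0) = e (simplical_face k (\<lambda>j. if j = 0 then 1 else 0))" for k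
    unfolding singular_face_def using pt by simp
  have v: "singular_face 1 0 e (\<lambda>j. if j = 0 then 1 else 0) = simplex_path e 1"
    "singular_face 1 1 e (\<lambda>j. if j = 0 then 1 else 0) = simplex_path e 0"
    unfolding sf f0 f1 simplex_path_def by (simp_all only:)
  have "?G (chain_boundary 1 (frag_of e)) = path_chain (tail_path (simplex_path e 1)) - path_chain (tail_path (simplex_path e 0))"
    unfolding One_nat_def chain_boundary_1 frag_extend_diff frag_extend_of v[unfolded One_nat_def] by simp
  moreover have "(\<Sum>i\<in>I. frag_cmul (frag_sum (dual_cocycle i) (frag_of e)) (path_chain (gen_loop i))) = word_chain (edge_word e)"
    using e by (simp add: word_chain_def dual_cocycle_def)
  ultimately show ?case
    using bounds_edge[OF e] by metis
next
  case (diff a b)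
  then obtain u v where "bounds X ((\<Sum>i\<in>I. frag_cmul (frag_sum (dual_cocycle i) a) (path_chain (gen_loop i))) - a +
      frag_extend (\<lambda>x. path_chain (tail_path (x (\<lambda>j. if j = 0 then 1 else 0)))) (chain_boundary 1 a)) u"
    "bounds X ((\<Sum>i\<in>I. frag_cmul (frag_sum (dual_cocycle i) b) (path_chain (gen_loop i))) - b +
      frag_extend (\<lambda>x. path_chain (tail_path (x (\<lambda>j. if j = 0 then 1 else 0)))) (chain_boundary 1 b)) v" by blast
  from bounds_diff[OF this] show ?case
    by (intro exI) (simp add: frag_sum_diff chain_boundary_diff frag_extend_diff frag_cmul_diff_distrib
        sum_subtractf algebra_simps)
qed

text \<open>The generator classes generate first homology: by \<open>bounds_chain\<close> a cycle is
  homologous to its combination with coefficients given by the dual cocycles, so two homomorphisms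
  can be compared on the free abelian group on I.\<close>

lemma H1_hom_eq:
  assumes A: "comm_group A" and f: "f \<in> hom H1 A" and g: "g \<in> hom H1 A"
    and eq: "\<And>i. i \<in> I \<Longrightarrow> f (gen_class i) = g (gen_class i)" and x: "x \<in> carrier H1"
  shows "f x = g x"
proof -
  let ?P = "frag_extend (\<lambda>i. path_chain (gen_loop i))"
  let ?s = "\<lambda>d. homologous_rel_set 1 T {} (?P d)"
  have cyc: "singular_relcycle 1 T {} (?P d)" if "Poly_Mapping.keys d \<subseteq> I" for d
    unfolding frag_extend_def using that gen_loop_cycle[OF loop_gen]
    by (intro singular_relcycle_sum singular_relcycle_cmul) auto
  have s: "?s \<in> hom (free_Abelian_group I) H1"
  proof (rule homI)
    fix c d assume "c \<in> carrier (free_Abelian_group I)" "d \<in> carrier (free_Abelian_group I)"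
    then have "singular_relcycle 1 T {} (?P c)" "singular_relcycle 1 T {} (?P d)" using cyc by auto
    then show "?s c \<in> carrier H1" "?s (c \<otimes>\<^bsub>free_Abelian_group I\<^esub> d) = ?s c \<otimes>\<^bsub>H1\<^esub> ?s d"
      using mult_H1 unfolding carrier_H1 by (auto simp: frag_extend_add)
  qed
  have fs: "(\<lambda>d. h (?s d)) \<in> hom (free_Abelian_group I) A" if "h \<in> hom H1 A" for h
    using hom_compose[OF s that] by (simp add: comp_def)
  obtain c where c: "x = homologous_rel_set 1 T {} c" "singular_relcycle 1 T {} c"
    using x unfolding carrier_H1 by blast
  then have ch: "singular_chain 1 T c" "chain_boundary 1 c = 0" by (auto simp: singular_cycle)
  define d where "d = (\<Sum>i\<in>I. frag_cmul (frag_sum (dual_cocycle i) c) (frag_of i))"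
  have d: "Poly_Mapping.keys d \<subseteq> I"
  proof -
    have "Poly_Mapping.keys d \<subseteq> (\<Union>i\<in>I. Poly_Mapping.keys (frag_cmul (frag_sum (dual_cocycle i) c) (frag_of i)))"
      unfolding d_def by (rule keys_sum)
    also have "\<dots> \<subseteq> I" by (auto simp: keys_frag_of)
    finally show ?thesis .
  qed
  have Pd: "?P d = (\<Sum>i\<in>I. frag_cmul (frag_sum (dual_cocycle i) c) (path_chain (gen_loop i)))"
    unfolding d_def using finite_I by (simp add: frag_extend_sum frag_extend_cmul comp_def)
  obtain v where "bounds X (?P d - c) v"
    using bounds_chain[OF ch(1)] ch(2) unfolding Pd by auto
  then have "homologous_rel 1 T {} (?P d) c"
    unfolding homologous_rel_def by (rule bounds_relboundary)
  then have "x = ?s d" unfolding c(1) by (metis homologous_rel_eq)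
  moreover have "f (?s d) = g (?s d)"
    by (rule hom_free_Abelian_group_eq[OF A fs[OF f] fs[OF g] _ d]) (simp add: eq[unfolded gen_class_def] del: One_nat_def)
  ultimately show ?thesis by simp
qed

section \<open>Second homology classes and relations induce the same pairings\<close>

definition quadratic_pairing ::
    "'i word set \<Rightarrow> 'a cochain set \<Rightarrow> 'a cochain set \<Rightarrow> int" where
  "quadratic_pairing r a b =
     (\<Sum>i\<in>I. \<Sum>j\<in>I. magnus i j r * (kronecker 1 T (gen_class i) a * kronecker 1 T (gen_class j) b))"

lemma quadratic_pairing_coset:
  assumes "\<phi> \<in> cocycle_set 1 T" "\<psi> \<in> cocycle_set 1 T"
  shows "quadratic_pairing r (cochain_coset 1 T \<phi>) (cochain_coset 1 T \<psi>) = quadratic_value r \<phi> \<psi>"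
  unfolding quadratic_pairing_def quadratic_value_def
  by (intro sum.cong) (simp_all add: kronecker_gen[OF _ assms(1)] kronecker_gen[OF _ assms(2)] del: One_nat_def)

lemma cup_kronecker:
  assumes "singular_relcycle 2 T {} c"
    and "\<And>\<phi> \<psi>. \<phi> \<in> cocycle_set 1 T \<Longrightarrow> \<psi> \<in> cocycle_set 1 T \<Longrightarrow>
       frag_sum (cochain_cup 1 1 T \<phi> \<psi>) c = quadratic_value r \<phi> \<psi>"
    and "a \<in> carrier C1" "b \<in> carrier C1"
  shows "kronecker 2 T (homologous_rel_set 2 T {} c) (cup_product 1 1 T a b) = quadratic_pairing r a b"
proof -
  obtain \<phi> \<psi> where phi: "\<phi> \<in> cocycle_set 1 T" "a = cochain_coset 1 T \<phi>"
    and psi: "\<psi> \<in> cocycle_set 1 T" "b = cochain_coset 1 T \<psi>"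
    using assms(3,4) unfolding carrier_C1 by blast
  show ?thesis
    unfolding phi(2) psi(2) cup_product_coset[OF phi(1) psi(1)] quadratic_pairing_coset[OF phi(1) psi(1)]
      kronecker_2[OF cup_cocycle[OF phi(1) psi(1)] assms(1)]
    by (rule assms(2)[OF phi(1) psi(1)])
qed

lemma cup_H2:
  assumes "z \<in> carrier (homology_group 2 T)"
  obtains r where "r \<in> N"
    "\<And>a b. a \<in> carrier C1 \<Longrightarrow> b \<in> carrier C1 \<Longrightarrow> kronecker 2 T z (cup_product 1 1 T a b) = quadratic_pairing r a b"
proof -
  obtain c where c: "z = homologous_rel_set 2 T {} c" "singular_relcycle 2 T {} c"
    using assms unfolding carrier_H2 by blast
  obtain r where r: "r \<in> N" "\<And>\<phi> \<psi>. \<phi> \<in> cocycle_set 1 T \<Longrightarrow> \<psi> \<in> cocycle_set 1 T \<Longrightarrow>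
       frag_sum (cochain_cup 1 1 T \<phi> \<psi>) c = quadratic_value r \<phi> \<psi>"
    using cup_cycle[OF c(2)] by blast
  show thesis by (rule that[OF r(1)]) (simp only: c(1) cup_kronecker[OF c(2) r(2)])
qed

lemma relator_H2:
  assumes "r \<in> N"
  obtains z where "z \<in> carrier (homology_group 2 T)"
    "\<And>a b. a \<in> carrier C1 \<Longrightarrow> b \<in> carrier C1 \<Longrightarrow> kronecker 2 T z (cup_product 1 1 T a b) = quadratic_pairing r a b"
proof -
  obtain c where c: "singular_relcycle 2 T {} c" "\<And>\<phi> \<psi>. \<phi> \<in> cocycle_set 1 T \<Longrightarrow> \<psi> \<in> cocycle_set 1 T \<Longrightarrow>
       frag_sum (cochain_cup 1 1 T \<phi> \<psi>) c = quadratic_value r \<phi> \<psi>"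
    using cup_relator[OF assms] by blast
  show thesis
  proof (rule that)
    show "homologous_rel_set 2 T {} c \<in> carrier (homology_group 2 T)" unfolding carrier_H2 using c(1) by blast
  qed (rule cup_kronecker[OF c])
qed

end

section \<open>Universal properties of free Lie algebras\<close>

lemma (in comm_group) finprod_subgroup:
  assumes S: "subgroup S G" and f: "f \<in> A \<rightarrow> S"
  shows "finprod G f A \<in> S"
  using f
proof (induction A rule: infinite_finite_induct)
  case (insert x A)
  then have "f \<in> A \<rightarrow> carrier G" "f x \<in> carrier G" using subgroup.mem_carrier[OF S] by auto
  then show ?case using insert subgroup.m_closed[OF S] by simp
qed (use subgroup.one_closed[OF S] in auto)

lemma free_lie_quotient_map: "(\<lambda>x. ideal_generated (free_nonassoc I) (lie_identities I) #>\<^bsub>free_nonassoc I\<^esub> x) \<in>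
    nring_hom (free_nonassoc I) (free_lie I)"
  unfolding free_lie_def
  using graded_nring.quotient_map_hom[OF graded_nring_free_nonassoc
      graded_nring.ideal_generated_ideal[OF graded_nring_free_nonassoc lie_identities_carrier]] .

lemma leaf_degree: "i \<in> I \<Longrightarrow> frag_of (Leaf i) \<in> degree_part (free_nonassoc I) 1"
  by (simp add: free_nonassoc_def keys_frag_of)

lemma free_lie_gen_degree: "i \<in> I \<Longrightarrow> free_lie_gen I i \<in> degree_part (free_lie I) 1"
  unfolding free_lie_gen_def by (rule nring_hom_degree[OF free_lie_quotient_map leaf_degree])

lemmas free_lie_gen_closed = graded_nring.degree_closed[OF graded_nring_free_lie free_lie_gen_degree]

lemma free_lie_universal:
  assumes M: "graded_nring M" "lie_law M" and f: "\<And>i. i \<in> I \<Longrightarrow> f i \<in> degree_part M 1"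
  obtains h where "h \<in> nring_hom (free_lie I) M" "\<And>i. i \<in> I \<Longrightarrow> h (free_lie_gen I i) = f i"
proof -
  interpret N: graded_nring "free_nonassoc I" by (rule graded_nring_free_nonassoc)
  obtain g where g: "g \<in> nring_hom (free_nonassoc I) M" "\<And>i. i \<in> I \<Longrightarrow> g (frag_of (Leaf i)) = f i"
    using free_nonassoc_universal[OF M(1), of I f] f by blast
  obtain h where h: "h \<in> nring_hom (lie_quotient (free_nonassoc I) (ideal_generated (free_nonassoc I) (lie_identities I))) M"
    "\<And>x. x \<in> carrier (free_nonassoc I) \<Longrightarrow>
       h (ideal_generated (free_nonassoc I) (lie_identities I) #>\<^bsub>free_nonassoc I\<^esub> x) = g x"
    using N.lie_quotient_factor[OF M(1) g(1) lie_identities_carrier lie_law_hom_identities[OF M(2,1) g(1)]] by blast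
  show thesis
  proof (rule that)
    show "h \<in> nring_hom (free_lie I) M" using h(1) by (simp add: free_lie_def)
    show "h (free_lie_gen I i) = f i" if "i \<in> I" for i
      unfolding free_lie_gen_def using h(2)[OF N.degree_closed[OF leaf_degree[OF that]]] g(2)[OF that] by simp
  qed
qed

lemma free_lie_hom_eq:
  assumes M: "graded_nring M" and f: "f \<in> nring_hom (free_lie I) M" and g: "g \<in> nring_hom (free_lie I) M"
    and eq: "\<And>i. i \<in> I \<Longrightarrow> f (free_lie_gen I i) = g (free_lie_gen I i)" and x: "x \<in> carrier (free_lie I)"
  shows "f x = g x"
proof -
  interpret N: graded_nring "free_nonassoc I" by (rule graded_nring_free_nonassoc)
  obtain c where c: "c \<in> carrier (free_nonassoc I)"
    "x = ideal_generated (free_nonassoc I) (lie_identities I) #>\<^bsub>free_nonassoc I\<^esub> c"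
    using x unfolding free_lie_def N.carrier_lie_quotient by blast
  show ?thesis
    unfolding c(2)
    by (rule free_nonassoc_hom_eq[OF M nring_hom_compose[OF free_lie_quotient_map f]
          nring_hom_compose[OF free_lie_quotient_map g] _ c(1)]) (rule eq[unfolded free_lie_gen_def])
qed

context
  fixes A :: "('a, 'b) monoid_scheme" (structure)
  assumes A: "comm_group A"
begin

interpretation A: comm_group A by (rule A)
interpretation L: graded_nring "free_lie (carrier A)" by (rule graded_nring_free_lie)

lemma additivity_carrier: "additivity A \<subseteq> carrier (free_lie (carrier A))"
  unfolding additivity_def Let_def
  by (auto intro!: L.m_closed L.inv_closed free_lie_gen_closed)

lemmas additivity_ideal = L.ideal_generated_ideal[OF additivity_carrier]

lemma graded_nring_lie_of: "graded_nring (lie_of A)"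
  unfolding lie_of_def by (rule L.graded_nring_lie_quotient[OF additivity_ideal])

lemma lie_law_lie_of: "lie_law (lie_of A)"
  unfolding lie_of_def by (rule lie_law_quotient[OF graded_nring_free_lie additivity_ideal lie_law_free_lie])

lemma lie_of_quotient_map: "(\<lambda>x. ideal_generated (free_lie (carrier A)) (additivity A) #>\<^bsub>free_lie (carrier A)\<^esub> x) \<in>
    nring_hom (free_lie (carrier A)) (lie_of A)"
  unfolding lie_of_def by (rule L.quotient_map_hom[OF additivity_ideal])

lemma lie_of_gen_degree: "x \<in> carrier A \<Longrightarrow> lie_of_gen A x \<in> degree_part (lie_of A) 1"
  unfolding lie_of_gen_def by (rule nring_hom_degree[OF lie_of_quotient_map free_lie_gen_degree])

lemmas lie_of_gen_closed = graded_nring.degree_closed[OF graded_nring_lie_of lie_of_gen_degree]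

lemma lie_of_gen_hom: "lie_of_gen A \<in> hom A (lie_of A)"
proof (rule homI)
  fix x y assume xy: "x \<in> carrier A" "y \<in> carrier A"
  let ?g = "free_lie_gen (carrier A)" and ?J = "ideal_generated (free_lie (carrier A)) (additivity A)"
  have g: "?g x \<in> carrier (free_lie (carrier A))" "?g y \<in> carrier (free_lie (carrier A))"
    "?g (x \<otimes> y) \<in> carrier (free_lie (carrier A))"
    using xy by (auto intro!: free_lie_gen_closed)
  have "?g (x \<otimes> y) \<otimes>\<^bsub>free_lie (carrier A)\<^esub> inv\<^bsub>free_lie (carrier A)\<^esub> (?g x \<otimes>\<^bsub>free_lie (carrier A)\<^esub> ?g y) \<in> additivity A"
    unfolding additivity_def Let_def using xy by blast
  then have "?g (x \<otimes> y) \<otimes>\<^bsub>free_lie (carrier A)\<^esub> inv\<^bsub>free_lie (carrier A)\<^esub> (?g x \<otimes>\<^bsub>free_lie (carrier A)\<^esub> ?g y) \<in> ?J"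
    using L.ideal_generated_incl by blast
  then have "?J #>\<^bsub>free_lie (carrier A)\<^esub> ?g (x \<otimes> y) = ?J #>\<^bsub>free_lie (carrier A)\<^esub> (?g x \<otimes>\<^bsub>free_lie (carrier A)\<^esub> ?g y)"
    using L.ideal_coset_eq_iff[OF additivity_ideal g(3) L.m_closed[OF g(1,2)]] by simp
  then show "lie_of_gen A (x \<otimes> y) = lie_of_gen A x \<otimes>\<^bsub>lie_of A\<^esub> lie_of_gen A y"
    unfolding lie_of_gen_def using nring_hom_mult[OF lie_of_quotient_map g(1,2)] by simp
qed (rule lie_of_gen_closed)

text \<open>On the underlying set of A the map extends by \<open>free_lie_universal\<close>;
  additivity of f says that this extension vanishes on \<open>additivity A\<close>.\<close>

lemma lie_of_universal:
  assumes M: "graded_nring M" "lie_law M" and f: "f \<in> hom A M" "\<And>x. x \<in> carrier A \<Longrightarrow> f x \<in> degree_part M 1"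
  obtains h where "h \<in> nring_hom (lie_of A) M" "\<And>x. x \<in> carrier A \<Longrightarrow> h (lie_of_gen A x) = f x"
proof -
  interpret M: graded_nring M by (rule M(1))
  obtain g where g: "g \<in> nring_hom (free_lie (carrier A)) M"
    "\<And>x. x \<in> carrier A \<Longrightarrow> g (free_lie_gen (carrier A) x) = f x"
    using free_lie_universal[OF M, of "carrier A" f] f(2) by metis
  interpret g: group_hom "free_lie (carrier A)" M g
    using g(1) by unfold_locales (simp add: nring_hom_def)
  have kill: "g s = \<one>\<^bsub>M\<^esub>" if s: "s \<in> additivity A" for s
  proof -
    obtain x y where xy: "x \<in> carrier A" "y \<in> carrier A" and s: "s = free_lie_gen (carrier A) (x \<otimes> y) \<otimes>\<^bsub>free_lie (carrier A)\<^esub>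
        inv\<^bsub>free_lie (carrier A)\<^esub> (free_lie_gen (carrier A) x \<otimes>\<^bsub>free_lie (carrier A)\<^esub> free_lie_gen (carrier A) y)"
      using s unfolding additivity_def Let_def by blast
    have c: "f x \<in> carrier M" "f y \<in> carrier M" using f(1) xy by (auto simp: hom_def)
    have "g s = f (x \<otimes> y) \<otimes>\<^bsub>M\<^esub> inv\<^bsub>M\<^esub> (f x \<otimes>\<^bsub>M\<^esub> f y)"
      unfolding s using xy g(2) by (simp add: free_lie_gen_closed)
    also have "f (x \<otimes> y) = f x \<otimes>\<^bsub>M\<^esub> f y" by (rule hom_mult[OF f(1) xy])
    finally show ?thesis using c by simp
  qed
  obtain h where h: "h \<in> nring_hom (lie_quotient (free_lie (carrier A)) (ideal_generated (free_lie (carrier A)) (additivity A))) M"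
    "\<And>x. x \<in> carrier (free_lie (carrier A)) \<Longrightarrow>
       h (ideal_generated (free_lie (carrier A)) (additivity A) #>\<^bsub>free_lie (carrier A)\<^esub> x) = g x"
    using L.lie_quotient_factor[OF M(1) g(1) additivity_carrier] kill by metis
  show thesis
  proof (rule that)
    show "h \<in> nring_hom (lie_of A) M" using h(1) by (simp add: lie_of_def)
    show "h (lie_of_gen A x) = f x" if "x \<in> carrier A" for x
      unfolding lie_of_gen_def using h(2)[OF free_lie_gen_closed[OF that]] g(2)[OF that] by simp
  qed
qed

lemma lie_of_hom_eq:
  assumes M: "graded_nring M" and f: "f \<in> nring_hom (lie_of A) M" and g: "g \<in> nring_hom (lie_of A) M"
    and eq: "\<And>x. x \<in> carrier A \<Longrightarrow> f (lie_of_gen A x) = g (lie_of_gen A x)" and z: "z \<in> carrier (lie_of A)"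
  shows "f z = g z"
proof -
  obtain c where c: "c \<in> carrier (free_lie (carrier A))"
    "z = ideal_generated (free_lie (carrier A)) (additivity A) #>\<^bsub>free_lie (carrier A)\<^esub> c"
    using z unfolding lie_of_def L.carrier_lie_quotient by blast
  show ?thesis
    unfolding c(2)
    by (rule free_lie_hom_eq[OF M nring_hom_compose[OF lie_of_quotient_map f]
          nring_hom_compose[OF lie_of_quotient_map g] _ c(1)]) (rule eq[unfolded lie_of_gen_def])
qed

end

section \<open>The exterior square\<close>

abbreviation wedge_group :: "('a, 'b) monoid_scheme \<Rightarrow> ('a \<times> 'a \<Rightarrow>\<^sub>0 int) monoid" where
  "wedge_group A \<equiv> free_Abelian_group (carrier A \<times> carrier A)"

abbreviation wedge_class :: "('a, 'b) monoid_scheme \<Rightarrow> ('a \<times> 'a \<Rightarrow>\<^sub>0 int) \<Rightarrow> ('a \<times> 'a \<Rightarrow>\<^sub>0 int) set" where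
  "wedge_class A c \<equiv> generate (wedge_group A) (wedge_relations A) #>\<^bsub>wedge_group A\<^esub> c"

context
  fixes A :: "('a, 'b) monoid_scheme" (structure)
  assumes A: "comm_group A"
begin

interpretation A: comm_group A by (rule A)
interpretation P: comm_group "wedge_group A" by (rule abelian_free_Abelian_group)

lemma wedge_relations_cases:
  assumes "s \<in> wedge_relations A"
  obtains (left) x x' y where "x \<in> carrier A" "x' \<in> carrier A" "y \<in> carrier A"
      "s = frag_of (x \<otimes> x', y) - frag_of (x, y) - frag_of (x', y)"
    | (right) x y y' where "x \<in> carrier A" "y \<in> carrier A" "y' \<in> carrier A"
      "s = frag_of (x, y \<otimes> y') - frag_of (x, y) - frag_of (x, y')"
    | (alt) x where "x \<in> carrier A" "s = frag_of (x, x)"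
  using assms unfolding wedge_relations_def
  by (elim UnE CollectE exE conjE)
    ((rule left, assumption+) | (rule right, assumption+) | (rule alt, assumption+))+

lemma wedge_relations_carrier: "wedge_relations A \<subseteq> carrier (wedge_group A)"
proof -
  have d: "a - b \<in> carrier (wedge_group A)" if "a \<in> carrier (wedge_group A)" "b \<in> carrier (wedge_group A)" for a b
    using keys_diff[of a b] that by (simp del: mem_Times_iff) blast
  have f: "frag_of (x, y) \<in> carrier (wedge_group A)" if "x \<in> carrier A" "y \<in> carrier A" for x y
    using that by simp
  show ?thesis
  proof
    fix s assume "s \<in> wedge_relations A"
    then show "s \<in> carrier (wedge_group A)"
    proof (cases rule: wedge_relations_cases)
      case (left x x' y)
      show ?thesis unfolding left(4) by (rule d[OF d[OF f[OF A.m_closed[OF left(1,2)] left(3)] f[OF left(1,3)]] f[OF left(2,3)]])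
    next
      case (right x y y')
      show ?thesis unfolding right(4) by (rule d[OF d[OF f[OF right(1) A.m_closed[OF right(2,3)]] f[OF right(1,2)]] f[OF right(1,3)]])
    next
      case (alt x)
      show ?thesis unfolding alt(2) by (rule f[OF alt(1,1)])
    qed
  qed
qed

lemmas wedge_relations_subgroup = P.generate_is_subgroup[OF wedge_relations_carrier]

lemma carrier_ext_square: "carrier (ext_square A) = wedge_class A ` carrier (wedge_group A)"
  by (auto simp: ext_square_def FactGroup_def RCOSETS_def Let_def)

lemma comm_group_ext_square: "comm_group (ext_square A)"
  unfolding ext_square_def Let_def by (rule P.abelian_FactGroup[OF wedge_relations_subgroup])

lemma wedge_class_hom: "wedge_class A \<in> hom (wedge_group A) (ext_square A)"
proof (rule homI)
  fix x y assume xy: "x \<in> carrier (wedge_group A)" "y \<in> carrier (wedge_group A)"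
  show "wedge_class A x \<in> carrier (ext_square A)" unfolding carrier_ext_square using xy by blast
  have "generate (wedge_group A) (wedge_relations A) \<lhd> wedge_group A"
    using wedge_relations_subgroup by (simp add: P.normal_iff_subgroup)
  from normal.rcos_sum[OF this xy]
  show "wedge_class A (x \<otimes>\<^bsub>wedge_group A\<^esub> y) = wedge_class A x \<otimes>\<^bsub>ext_square A\<^esub> wedge_class A y"
    by (simp only: ext_square_def Let_def FactGroup_def monoid.simps)
qed

lemma wedge_class_eqI:
  assumes "c - d \<in> wedge_relations A" "d \<in> carrier (wedge_group A)"
  shows "wedge_class A c = wedge_class A d"
proof -
  have "c - d \<in> generate (wedge_group A) (wedge_relations A)" using assms(1) by (rule generate.incl)
  then have "c \<in> wedge_class A d" unfolding r_coset_def by force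
  then show ?thesis using P.repr_independence[OF _ assms(2) wedge_relations_subgroup] by simp
qed

text \<open>Both \<open>wedge_pairing\<close> and \<open>wedge_to_lie\<close> are a
  \<open>the_elem\<close> of the image of such a coset; they are well defined once h kills the wedge
  relations.\<close>

lemma hom_wedge_class:
  assumes M: "comm_group M" and h: "h \<in> hom (wedge_group A) M"
    and rel: "\<And>s. s \<in> wedge_relations A \<Longrightarrow> h s = \<one>\<^bsub>M\<^esub>" and c: "c \<in> carrier (wedge_group A)"
  shows "the_elem (h ` wedge_class A c) = h c"
proof -
  interpret M: comm_group M by (rule M)
  interpret h: group_hom "wedge_group A" M h
    by (simp add: group_hom_def group_hom_axioms_def M.group_axioms h)
  have ker: "h s = \<one>\<^bsub>M\<^esub> \<and> s \<in> carrier (wedge_group A)" if "s \<in> generate (wedge_group A) (wedge_relations A)" for s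
  proof -
    have "generate (wedge_group A) (wedge_relations A) \<subseteq> kernel (wedge_group A) M h"
    proof (rule P.generate_subgroup_incl[OF _ h.subgroup_kernel])
      show "wedge_relations A \<subseteq> kernel (wedge_group A) M h"
        unfolding kernel_def using wedge_relations_carrier rel by blast
    qed
    then show ?thesis using that by (auto simp: kernel_def)
  qed
  have "h d = h c" if "d \<in> wedge_class A c" for d
  proof -
    obtain s where s: "s \<in> generate (wedge_group A) (wedge_relations A)" "d = s \<otimes>\<^bsub>wedge_group A\<^esub> c"
      using \<open>d \<in> wedge_class A c\<close> unfolding r_coset_def by blast
    show ?thesis unfolding s(2) using ker[OF s(1)] h.hom_mult[of s c] h.hom_closed[OF c] c by simp
  qed
  moreover have "c \<in> wedge_class A c" using P.rcos_self[OF c wedge_relations_subgroup] .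
  ultimately have "h ` wedge_class A c = {h c}" by blast
  then show ?thesis by simp
qed

lemma hom_wedge_relations:
  assumes M: "comm_group M" and h: "h \<in> hom (wedge_group A) M"
    and left: "\<And>x x' y. x \<in> carrier A \<Longrightarrow> x' \<in> carrier A \<Longrightarrow> y \<in> carrier A \<Longrightarrow>
      h (frag_of (x \<otimes> x', y)) = h (frag_of (x, y)) \<otimes>\<^bsub>M\<^esub> h (frag_of (x', y))"
    and right: "\<And>x y y'. x \<in> carrier A \<Longrightarrow> y \<in> carrier A \<Longrightarrow> y' \<in> carrier A \<Longrightarrow>
      h (frag_of (x, y \<otimes> y')) = h (frag_of (x, y)) \<otimes>\<^bsub>M\<^esub> h (frag_of (x, y'))"
    and alt: "\<And>x. x \<in> carrier A \<Longrightarrow> h (frag_of (x, x)) = \<one>\<^bsub>M\<^esub>"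
    and s: "s \<in> wedge_relations A"
  shows "h s = \<one>\<^bsub>M\<^esub>"
proof -
  interpret M: comm_group M by (rule M)
  interpret h: group_hom "wedge_group A" M h
    by (simp add: group_hom_def group_hom_axioms_def M.group_axioms h)
  have of: "frag_of (x, y) \<in> carrier (wedge_group A)" if "x \<in> carrier A" "y \<in> carrier A" for x y
    using that by simp
  have diff: "h (a - b - c) = h a \<otimes>\<^bsub>M\<^esub> inv\<^bsub>M\<^esub> h b \<otimes>\<^bsub>M\<^esub> inv\<^bsub>M\<^esub> h c"
    if "a \<in> carrier (wedge_group A)" "b \<in> carrier (wedge_group A)" "c \<in> carrier (wedge_group A)" for a b c
  proof -
    have "a - b - c = a \<otimes>\<^bsub>wedge_group A\<^esub> inv\<^bsub>wedge_group A\<^esub> b \<otimes>\<^bsub>wedge_group A\<^esub> inv\<^bsub>wedge_group A\<^esub> c" using that by simp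
    then show ?thesis using that by (simp only: h.hom_mult h.hom_inv P.m_closed P.inv_closed)
  qed
  from s show ?thesis
  proof (cases rule: wedge_relations_cases)
    case (left x x' y)
    have c: "h (frag_of (x, y)) \<in> carrier M" "h (frag_of (x', y)) \<in> carrier M"
      using h.hom_closed[OF of] left by auto
    show ?thesis
      unfolding left(4) diff[OF of[OF A.m_closed[OF left(1,2)] left(3)] of[OF left(1,3)] of[OF left(2,3)]]
        assms(3)[OF left(1-3)]
      using c by (simp add: M.m_ac)
  next
    case (right x y y')
    have c: "h (frag_of (x, y)) \<in> carrier M" "h (frag_of (x, y')) \<in> carrier M"
      using h.hom_closed[OF of] right by auto
    show ?thesis
      unfolding right(4) diff[OF of[OF right(1) A.m_closed[OF right(2,3)]] of[OF right(1,2)] of[OF right(1,3)]]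
        assms(4)[OF right(1-3)]
      using c by (simp add: M.m_ac)
  next
    case (alt x)
    then show ?thesis using assms(5) by simp
  qed
qed

end

section \<open>The holonomy Lie algebra\<close>

lemma frag_sum_combination: "frag_sum g (\<Sum>p\<in>A. frag_cmul (m p) (frag_of (u p))) = (\<Sum>p\<in>A. m p * g (u p))"
  by (simp add: frag_sum_sum frag_sum_cmul)

text \<open>The diagonal vanishes because the integers have no 2-torsion, and the entries below it
  fold onto those above. The right side is the pairing with the sum over i < j of m i j times the
  wedge of the i-th and j-th generator.\<close>

lemma antisymmetric_double_sum:
  fixes I :: "'i::linorder set" and m :: "'i \<Rightarrow> 'i \<Rightarrow> int"
  assumes I: "finite I" and m: "\<And>i j. m j i = - m i j"
  shows "(\<Sum>i\<in>I. \<Sum>j\<in>I. m i j * (a i * b j)) = (\<Sum>(i, j)\<in>ordered_pairs I. m i j * (a i * b j - a j * b i))"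
proof -
  have diag: "m i i = 0" for i using m[of i i] by simp
  have "(\<Sum>i\<in>I. \<Sum>j\<in>I. m i j * (a i * b j)) =
      (\<Sum>i\<in>I. \<Sum>j\<in>I. if i < j then m i j * (a i * b j) else 0) +
      (\<Sum>i\<in>I. \<Sum>j\<in>I. if j < i then m i j * (a i * b j) else 0)"
    unfolding sum.distrib[symmetric]
  proof (intro sum.cong HOL.refl)
    fix i j
    show "m i j * (a i * b j) = (if i < j then m i j * (a i * b j) else 0) + (if j < i then m i j * (a i * b j) else 0)"
      by (cases i j rule: linorder_cases) (auto simp: diag dest: order.asym)
  qed
  also have "(\<Sum>i\<in>I. \<Sum>j\<in>I. if j < i then m i j * (a i * b j) else 0) =
      (\<Sum>i\<in>I. \<Sum>j\<in>I. if i < j then m j i * (a j * b i) else 0)"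
    by (rule sum.swap)
  also have "(\<Sum>i\<in>I. \<Sum>j\<in>I. if i < j then m i j * (a i * b j) else 0) + \<dots> =
      (\<Sum>i\<in>I. \<Sum>j\<in>I. if i < j then m i j * (a i * b j - a j * b i) else 0)"
    unfolding sum.distrib[symmetric]
  proof (intro sum.cong HOL.refl)
    fix i j
    show "(if i < j then m i j * (a i * b j) else 0) + (if i < j then m j i * (a j * b i) else 0) =
        (if i < j then m i j * (a i * b j - a j * b i) else 0)"
      unfolding m[of j i] by (simp add: algebra_simps)
  qed
  also have "\<dots> = (\<Sum>p\<in>I \<times> I. if fst p < snd p then (case p of (i, j) \<Rightarrow> m i j * (a i * b j - a j * b i)) else 0)"
    unfolding sum.cartesian_product by (intro sum.cong HOL.refl) (simp add: case_prod_beta)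
  also have "\<dots> = (\<Sum>(i, j)\<in>{p \<in> I \<times> I. fst p < snd p}. m i j * (a i * b j - a j * b i))"
    using I by (intro sum.inter_filter[symmetric]) simp
  also have "{p \<in> I \<times> I. fst p < snd p} = ordered_pairs I"
    by (auto simp: ordered_pairs_def)
  finally show ?thesis .
qed

lemma delta_antisym:
  "(if i = k then 1 else 0) * (if j = l then 1 else 0) - (if j = k then 1 else 0) * (if i = l then 1 else 0) =
    (if i = k \<and> j = l then 1 else 0) - (if i = l \<and> j = k then 1 else (0::int))"
  by (cases "i = k"; cases "j = k"; cases "i = l"; cases "j = l";
      simp only: simp_thms if_True if_False mult_1 mult_zero_left mult_1_right mult_zero_right)

locale ordered_presented_space = presented_space I R X x0 \<alpha>
  for I :: "'i::linorder set" and R and X :: "'a::topological_space set" and x0 and \<alpha>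
begin

declare One_nat_def [simp del]

section \<open>Coordinates on first homology and its exterior square\<close>

lemma comm_group_H1: "comm_group H1"
  by (rule abelian_homology_group)

sublocale H1: comm_group H1 by (rule comm_group_H1)

text \<open>The basis dual to the generator classes: \<open>coord_gen\<close> gives their
  independence and \<open>H1_hom_eq\<close> generation, so first homology is free on them.\<close>

definition coord :: "'i \<Rightarrow> 'a chain set \<Rightarrow> int" where
  "coord i x = kronecker 1 T x (dual_class i)"

lemma coord_mult: "x \<in> carrier H1 \<Longrightarrow> y \<in> carrier H1 \<Longrightarrow> coord i (x \<otimes>\<^bsub>H1\<^esub> y) = coord i x + coord i y"
  unfolding coord_def by (rule kronecker_mult[OF dual_class_closed])

lemma coord_gen: "k \<in> I \<Longrightarrow> coord i (gen_class k) = (if i = k then 1 else 0)"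
  unfolding coord_def by (rule kronecker_gen_dual)

text \<open>Both sides are additive in x and in y, so \<open>H1_hom_eq\<close> reduces first one and
  then the other argument to generator classes. There the coordinates form an antisymmetrized unit
  matrix, which \<open>alt_sum_single\<close> evaluates.\<close>

lemma alternating_expansion:
  assumes A: "comm_group A"
    and closed: "\<And>x y. x \<in> carrier H1 \<Longrightarrow> y \<in> carrier H1 \<Longrightarrow> f x y \<in> carrier A"
    and left: "\<And>x x' y. x \<in> carrier H1 \<Longrightarrow> x' \<in> carrier H1 \<Longrightarrow> y \<in> carrier H1 \<Longrightarrow> f (x \<otimes>\<^bsub>H1\<^esub> x') y = f x y \<otimes>\<^bsub>A\<^esub> f x' y"
    and right: "\<And>x y y'. x \<in> carrier H1 \<Longrightarrow> y \<in> carrier H1 \<Longrightarrow> y' \<in> carrier H1 \<Longrightarrow> f x (y \<otimes>\<^bsub>H1\<^esub> y') = f x y \<otimes>\<^bsub>A\<^esub> f x y'"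
    and alt: "\<And>x. x \<in> carrier H1 \<Longrightarrow> f x x = \<one>\<^bsub>A\<^esub>"
    and x: "x \<in> carrier H1" and y: "y \<in> carrier H1"
  shows "f x y = alt_sum A (\<lambda>i j. f (gen_class i) (gen_class j)) I
    (\<lambda>i j. coord i x * coord j y - coord j x * coord i y)"
proof -
  interpret A: comm_group A by (rule A)
  let ?b = "\<lambda>i j. f (gen_class i) (gen_class j)"
  have b: "?b i j \<in> carrier A" if "i \<in> I" "j \<in> I" for i j
    using that by (intro closed gen_class_closed)
  have self: "?b i i = \<one>\<^bsub>A\<^esub>" if "i \<in> I" for i using that by (intro alt gen_class_closed)
  have swap: "?b j i = inv\<^bsub>A\<^esub> ?b i j" if ij: "i \<in> I" "j \<in> I" for i j
  proof -
    let ?x = "gen_class i" and ?y = "gen_class j"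
    have c: "?x \<in> carrier H1" "?y \<in> carrier H1" using gen_class_closed ij by auto
    have "\<one>\<^bsub>A\<^esub> = f (?x \<otimes>\<^bsub>H1\<^esub> ?y) (?x \<otimes>\<^bsub>H1\<^esub> ?y)" using alt[OF H1.m_closed[OF c]] by simp
    also have "\<dots> = (f ?x ?x \<otimes>\<^bsub>A\<^esub> f ?x ?y) \<otimes>\<^bsub>A\<^esub> (f ?y ?x \<otimes>\<^bsub>A\<^esub> f ?y ?y)"
      unfolding left[OF c H1.m_closed[OF c]] right[OF c(1) c] right[OF c(2) c] ..
    also have "\<dots> = f ?x ?y \<otimes>\<^bsub>A\<^esub> f ?y ?x"
      using alt[OF c(1)] alt[OF c(2)] closed[OF c(1) c(2)] closed[OF c(2) c(1)] by simp
    finally have "f ?y ?x \<otimes>\<^bsub>A\<^esub> f ?x ?y = \<one>\<^bsub>A\<^esub>" using closed[OF c(1) c(2)] closed[OF c(2) c(1)] A.m_comm by simp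
    then show ?thesis using A.inv_equality[OF _ closed[OF c(1) c(2)] closed[OF c(2) c(1)]] by simp
  qed
  have hom: "(\<lambda>z. alt_sum A ?b I (m z)) \<in> hom H1 A"
    if "\<And>z w i j. z \<in> carrier H1 \<Longrightarrow> w \<in> carrier H1 \<Longrightarrow> m (z \<otimes>\<^bsub>H1\<^esub> w) i j = m z i j + m w i j" for m
  proof (rule homI)
    fix z w assume zw: "z \<in> carrier H1" "w \<in> carrier H1"
    show "alt_sum A ?b I (m z) \<in> carrier A" using b by (rule A.alt_sum_closed)
    have "m (z \<otimes>\<^bsub>H1\<^esub> w) = (\<lambda>i j. m z i j + m w i j)" using that[OF zw] by blast
    then show "alt_sum A ?b I (m (z \<otimes>\<^bsub>H1\<^esub> w)) = alt_sum A ?b I (m z) \<otimes>\<^bsub>A\<^esub> alt_sum A ?b I (m w)"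
      using A.alt_sum_add[of I ?b "m z" "m w"] b by simp
  qed
  have gen: "f z (gen_class l) = alt_sum A ?b I (\<lambda>i j. coord i z * coord j (gen_class l) - coord j z * coord i (gen_class l))"
    if l: "l \<in> I" and z: "z \<in> carrier H1" for l z
  proof (rule H1_hom_eq[OF A _ _ _ z])
    show "(\<lambda>z. f z (gen_class l)) \<in> hom H1 A"
      using closed left gen_class_closed[OF l] by (intro homI) auto
    show "(\<lambda>z. alt_sum A ?b I (\<lambda>i j. coord i z * coord j (gen_class l) - coord j z * coord i (gen_class l))) \<in> hom H1 A"
      by (rule hom[where m = "\<lambda>z i j. coord i z * coord j (gen_class l) - coord j z * coord i (gen_class l)"])
        (simp only: coord_mult distrib_right add_diff_add)
    fix k assume k: "k \<in> I"
    have "(\<lambda>i j. coord i (gen_class k) * coord j (gen_class l) - coord j (gen_class k) * coord i (gen_class l)) =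
        (\<lambda>i j. (if i = k \<and> j = l then 1 else 0) - (if i = l \<and> j = k then 1 else 0))"
      unfolding coord_gen[OF k] coord_gen[OF l] delta_antisym ..
    then show "f (gen_class k) (gen_class l) =
      alt_sum A ?b I (\<lambda>i j. coord i (gen_class k) * coord j (gen_class l) - coord j (gen_class k) * coord i (gen_class l))"
      using A.alt_sum_single[where b = ?b, OF finite_I k l b self swap] by (simp only:)
  qed
  show ?thesis
  proof (rule H1_hom_eq[OF A _ _ _ y])
    show "f x \<in> hom H1 A" using closed right x by (intro homI) auto
    show "(\<lambda>y. alt_sum A ?b I (\<lambda>i j. coord i x * coord j y - coord j x * coord i y)) \<in> hom H1 A"
      by (rule hom[where m = "\<lambda>y i j. coord i x * coord j y - coord j x * coord i y"])
        (simp only: coord_mult distrib_left add_diff_add)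
  qed (rule gen[OF _ x])
qed

definition wedge_coord :: "('a chain set \<times> 'a chain set \<Rightarrow>\<^sub>0 int) \<Rightarrow> 'i \<Rightarrow> 'i \<Rightarrow> int" where
  "wedge_coord c i j = frag_sum (\<lambda>(x, y). coord i x * coord j y - coord j x * coord i y) c"

lemma hom_wedge_expansion:
  assumes A: "comm_group A" and h: "h \<in> hom (wedge_group H1) A"
    and left: "\<And>x x' y. x \<in> carrier H1 \<Longrightarrow> x' \<in> carrier H1 \<Longrightarrow> y \<in> carrier H1 \<Longrightarrow>
      h (frag_of (x \<otimes>\<^bsub>H1\<^esub> x', y)) = h (frag_of (x, y)) \<otimes>\<^bsub>A\<^esub> h (frag_of (x', y))"
    and right: "\<And>x y y'. x \<in> carrier H1 \<Longrightarrow> y \<in> carrier H1 \<Longrightarrow> y' \<in> carrier H1 \<Longrightarrow>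
      h (frag_of (x, y \<otimes>\<^bsub>H1\<^esub> y')) = h (frag_of (x, y)) \<otimes>\<^bsub>A\<^esub> h (frag_of (x, y'))"
    and alt: "\<And>x. x \<in> carrier H1 \<Longrightarrow> h (frag_of (x, x)) = \<one>\<^bsub>A\<^esub>"
    and c: "c \<in> carrier (wedge_group H1)"
  shows "h c = alt_sum A (\<lambda>i j. h (frag_of (gen_class i, gen_class j))) I (wedge_coord c)"
proof -
  interpret A: comm_group A by (rule A)
  let ?f = "\<lambda>x y. h (frag_of (x, y))"
  have closed: "?f x y \<in> carrier A" if "x \<in> carrier H1" "y \<in> carrier H1" for x y
    using hom_in_carrier[OF h, of "frag_of (x, y)"] that by simp
  have b: "?f (gen_class i) (gen_class j) \<in> carrier A" if "i \<in> I" "j \<in> I" for i j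
    using that by (intro closed gen_class_closed)
  have keys: "Poly_Mapping.keys c \<subseteq> carrier H1 \<times> carrier H1" using c by (simp del: mem_Times_iff)
  show ?thesis
  proof (rule hom_free_Abelian_group_eq[OF A h _ _ keys])
    show "(\<lambda>c. alt_sum A (\<lambda>i j. h (frag_of (gen_class i, gen_class j))) I (wedge_coord c)) \<in> hom (wedge_group H1) A"
    proof (rule homI)
      fix u v
      show "alt_sum A (\<lambda>i j. h (frag_of (gen_class i, gen_class j))) I (wedge_coord u) \<in> carrier A"
        using b by (rule A.alt_sum_closed)
      have "wedge_coord (u \<otimes>\<^bsub>wedge_group H1\<^esub> v) = (\<lambda>i j. wedge_coord u i j + wedge_coord v i j)"
        by (intro ext) (simp add: wedge_coord_def frag_sum_add)
      then show "alt_sum A (\<lambda>i j. h (frag_of (gen_class i, gen_class j))) I (wedge_coord (u \<otimes>\<^bsub>wedge_group H1\<^esub> v)) =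
          alt_sum A (\<lambda>i j. h (frag_of (gen_class i, gen_class j))) I (wedge_coord u) \<otimes>\<^bsub>A\<^esub>
          alt_sum A (\<lambda>i j. h (frag_of (gen_class i, gen_class j))) I (wedge_coord v)"
        using A.alt_sum_add[of I "\<lambda>i j. h (frag_of (gen_class i, gen_class j))" "wedge_coord u" "wedge_coord v"] b by simp
    qed
    fix s assume "s \<in> carrier H1 \<times> carrier H1"
    then obtain x y where s: "s = (x, y)" "x \<in> carrier H1" "y \<in> carrier H1" by blast
    have "wedge_coord (frag_of s) = (\<lambda>i j. coord i x * coord j y - coord j x * coord i y)"
      by (intro ext) (simp add: wedge_coord_def s(1))
    then show "h (frag_of s) = alt_sum A (\<lambda>i j. h (frag_of (gen_class i, gen_class j))) I (wedge_coord (frag_of s))"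
      using alternating_expansion[where f = ?f, OF A closed left right alt s(2,3)] by (simp only: s(1))
  qed
qed

text \<open>The quotient map is itself biadditive and alternating, so
  \<open>hom_wedge_expansion\<close> may be applied to it.\<close>

lemma wedge_class_relations:
  shows "x \<in> carrier H1 \<Longrightarrow> x' \<in> carrier H1 \<Longrightarrow> y \<in> carrier H1 \<Longrightarrow>
      wedge_class H1 (frag_of (x \<otimes>\<^bsub>H1\<^esub> x', y)) = wedge_class H1 (frag_of (x, y)) \<otimes>\<^bsub>ext_square H1\<^esub> wedge_class H1 (frag_of (x', y))"
    and "x \<in> carrier H1 \<Longrightarrow> y \<in> carrier H1 \<Longrightarrow> y' \<in> carrier H1 \<Longrightarrow>
      wedge_class H1 (frag_of (x, y \<otimes>\<^bsub>H1\<^esub> y')) = wedge_class H1 (frag_of (x, y)) \<otimes>\<^bsub>ext_square H1\<^esub> wedge_class H1 (frag_of (x, y'))"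
    and "x \<in> carrier H1 \<Longrightarrow> wedge_class H1 (frag_of (x, x)) = \<one>\<^bsub>ext_square H1\<^esub>"
proof -
  have of: "frag_of (x, y) \<in> carrier (wedge_group H1)" if "x \<in> carrier H1" "y \<in> carrier H1" for x y
    using that by simp
  have add: "a + b \<in> carrier (wedge_group H1)" if "a \<in> carrier (wedge_group H1)" "b \<in> carrier (wedge_group H1)" for a b
    using keys_add[of a b] that by (simp del: mem_Times_iff) blast
  note hom = wedge_class_hom[OF comm_group_H1]
  have mult: "wedge_class H1 (a + b) = wedge_class H1 a \<otimes>\<^bsub>ext_square H1\<^esub> wedge_class H1 b"
    if "a \<in> carrier (wedge_group H1)" "b \<in> carrier (wedge_group H1)" for a b
    using hom_mult[OF hom that] by simp
  {
    assume x: "x \<in> carrier H1" "x' \<in> carrier H1" "y \<in> carrier H1"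
    have "frag_of (x \<otimes>\<^bsub>H1\<^esub> x', y) - frag_of (x, y) - frag_of (x', y) \<in> wedge_relations H1"
      unfolding wedge_relations_def using x by blast
    then have "wedge_class H1 (frag_of (x \<otimes>\<^bsub>H1\<^esub> x', y)) = wedge_class H1 (frag_of (x, y) + frag_of (x', y))"
      by (intro wedge_class_eqI[OF comm_group_H1] add of x) (simp only: diff_diff_add)
    then show "wedge_class H1 (frag_of (x \<otimes>\<^bsub>H1\<^esub> x', y)) = wedge_class H1 (frag_of (x, y)) \<otimes>\<^bsub>ext_square H1\<^esub> wedge_class H1 (frag_of (x', y))"
      using mult[OF of[OF x(1,3)] of[OF x(2,3)]] by simp
  }
  {
    assume x: "x \<in> carrier H1" "y \<in> carrier H1" "y' \<in> carrier H1"
    have "frag_of (x, y \<otimes>\<^bsub>H1\<^esub> y') - frag_of (x, y) - frag_of (x, y') \<in> wedge_relations H1"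
      unfolding wedge_relations_def using x by blast
    then have "wedge_class H1 (frag_of (x, y \<otimes>\<^bsub>H1\<^esub> y')) = wedge_class H1 (frag_of (x, y) + frag_of (x, y'))"
      by (intro wedge_class_eqI[OF comm_group_H1] add of x) (simp only: diff_diff_add)
    then show "wedge_class H1 (frag_of (x, y \<otimes>\<^bsub>H1\<^esub> y')) = wedge_class H1 (frag_of (x, y)) \<otimes>\<^bsub>ext_square H1\<^esub> wedge_class H1 (frag_of (x, y'))"
      using mult[OF of[OF x(1,2)] of[OF x(1,3)]] by simp
  }
  {
    assume x: "x \<in> carrier H1"
    have "frag_of (x, x) - 0 \<in> wedge_relations H1"
      unfolding wedge_relations_def diff_0_right using x by blast
    then have "wedge_class H1 (frag_of (x, x)) = wedge_class H1 0"
      by (rule wedge_class_eqI[OF comm_group_H1]) simp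
    also have "\<dots> = \<one>\<^bsub>ext_square H1\<^esub>"
      using hom_one[OF hom] comm_group_ext_square[OF comm_group_H1] by (simp add: comm_group.axioms(2))
    finally show "wedge_class H1 (frag_of (x, x)) = \<one>\<^bsub>ext_square H1\<^esub>" .
  }
qed

text \<open>Expanding the quotient map writes every class as a sum over i < j of wedges of
  generators, with coefficients that depend on the coordinates alone. This is the uniqueness that
  \<open>cup_dual\<close> demands.\<close>

lemma wedge_class_determined:
  assumes "c \<in> carrier (wedge_group H1)" "d \<in> carrier (wedge_group H1)"
    and "\<And>i j. i \<in> I \<Longrightarrow> j \<in> I \<Longrightarrow> wedge_coord c i j = wedge_coord d i j"
  shows "wedge_class H1 c = wedge_class H1 d"
proof -
  interpret E: comm_group "ext_square H1" by (rule comm_group_ext_square[OF comm_group_H1])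
  note hom = wedge_class_hom[OF comm_group_H1]
  have ex: "wedge_class H1 c = alt_sum (ext_square H1) (\<lambda>i j. wedge_class H1 (frag_of (gen_class i, gen_class j))) I (wedge_coord c)"
    if "c \<in> carrier (wedge_group H1)" for c
    by (rule hom_wedge_expansion[OF E.comm_group_axioms hom wedge_class_relations(1) wedge_class_relations(2)
          wedge_class_relations(3) that])
  have b: "wedge_class H1 (frag_of (gen_class i, gen_class j)) \<in> carrier (ext_square H1)" if "i \<in> I" "j \<in> I" for i j
    using hom_in_carrier[OF hom, of "frag_of (gen_class i, gen_class j)"] gen_class_closed that by simp
  show ?thesis unfolding ex[OF assms(1)] ex[OF assms(2)] by (rule E.alt_sum_cong[OF b assms(3)])
qed

lemma wedge_pairing_class:
  assumes a: "a \<in> carrier C1" and b: "b \<in> carrier C1" and c: "c \<in> carrier (wedge_group H1)"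
  shows "wedge_pairing T a b (wedge_class H1 c) =
    frag_sum (\<lambda>(x, y). kronecker 1 T x a * kronecker 1 T y b - kronecker 1 T y a * kronecker 1 T x b) c"
proof -
  let ?g = "\<lambda>(x, y). kronecker 1 T x a * kronecker 1 T y b - kronecker 1 T y a * kronecker 1 T x b"
  have hom: "frag_sum ?g \<in> hom (wedge_group H1) integer_group"
    by (intro homI) (auto simp: frag_sum_add)
  have Z: "comm_group integer_group" by (rule abelian_integer_group)
  have rel: "frag_sum ?g s = \<one>\<^bsub>integer_group\<^esub>" if s: "s \<in> wedge_relations H1" for s
  proof (rule hom_wedge_relations[OF comm_group_H1 Z hom _ _ _ s])
  qed (simp_all add: kronecker_mult[OF a] kronecker_mult[OF b] algebra_simps)
  have "(\<lambda>c. \<Sum>(x, y)\<in>Poly_Mapping.keys c. Poly_Mapping.lookup c (x, y) *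
      (kronecker 1 T x a * kronecker 1 T y b - kronecker 1 T y a * kronecker 1 T x b)) = frag_sum ?g"
    by (intro ext) (simp add: frag_sum_def case_prod_beta)
  then have "wedge_pairing T a b (wedge_class H1 c) = the_elem (frag_sum ?g ` wedge_class H1 c)"
    by (simp only: wedge_pairing_def)
  also have "\<dots> = frag_sum ?g c" by (rule hom_wedge_class[OF comm_group_H1 Z hom rel c])
  finally show ?thesis .
qed

section \<open>The dual cup product expressed through relations\<close>

definition relator_chain :: "'i word set \<Rightarrow> 'a chain set \<times> 'a chain set \<Rightarrow>\<^sub>0 int" where
  "relator_chain r = (\<Sum>p\<in>ordered_pairs I. frag_cmul (magnus (fst p) (snd p) r) (frag_of (gen_class (fst p), gen_class (snd p))))"

lemma relator_chain_closed: "relator_chain r \<in> carrier (wedge_group H1)"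
proof -
  have "Poly_Mapping.keys (relator_chain r) \<subseteq> (\<Union>p\<in>ordered_pairs I. Poly_Mapping.keys (frag_cmul (magnus (fst p) (snd p) r) (frag_of (gen_class (fst p), gen_class (snd p)))))"
    unfolding relator_chain_def by (rule keys_sum)
  also have "\<dots> \<subseteq> carrier H1 \<times> carrier H1"
    using gen_class_closed by (auto simp: keys_frag_of ordered_pairs_def)
  finally show ?thesis by (simp del: mem_Times_iff)
qed

lemma wedge_pairing_relator:
  assumes r: "r \<in> lower_central F 2" and a: "a \<in> carrier C1" and b: "b \<in> carrier C1"
  shows "wedge_pairing T a b (wedge_class H1 (relator_chain r)) = quadratic_pairing r a b"
  unfolding wedge_pairing_class[OF a b relator_chain_closed] quadratic_pairing_def
    antisymmetric_double_sum[OF finite_I lower_central_2_invariants(2)[OF r]]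
  unfolding relator_chain_def frag_sum_combination by (simp add: case_prod_beta mult.commute)

lemma wedge_pairing_dual:
  assumes "c \<in> carrier (wedge_group H1)"
  shows "wedge_pairing T (dual_class i) (dual_class j) (wedge_class H1 c) = wedge_coord c i j"
  unfolding wedge_pairing_class[OF dual_class_closed dual_class_closed assms] wedge_coord_def coord_def
  by (simp add: mult.commute)

text \<open>Only pairs i < j occur in the chain; the remaining coordinates are right because Magnus
  coefficients are antisymmetric on the commutator subgroup, which enters through
  \<open>wedge_pairing_relator\<close>.\<close>

lemma wedge_coord_relator:
  assumes r: "r \<in> lower_central F 2" and ij: "i \<in> I" "j \<in> I"
  shows "wedge_coord (relator_chain r) i j = magnus i j r"
proof -
  have "wedge_coord (relator_chain r) i j = quadratic_pairing r (dual_class i) (dual_class j)"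
    using wedge_pairing_relator[OF r dual_class_closed dual_class_closed] wedge_pairing_dual[OF relator_chain_closed] by metis
  also have "\<dots> = (\<Sum>k\<in>I. \<Sum>l\<in>I. if l = j then if k = i then magnus i j r else 0 else 0)"
    unfolding quadratic_pairing_def by (intro sum.cong) (auto simp: kronecker_gen_dual)
  also have "\<dots> = magnus i j r" using finite_I ij by simp
  finally show ?thesis .
qed

text \<open>The wedge of r has the required pairings by \<open>wedge_pairing_relator\<close>. Any
  other candidate has the same pairings with the dual classes, hence the same coordinates, and
  \<open>wedge_class_determined\<close> applies.\<close>

lemma holonomy_boundary_eq:
  assumes r: "r \<in> lower_central F 2"
    and cup: "\<And>a b. a \<in> carrier C1 \<Longrightarrow> b \<in> carrier C1 \<Longrightarrow> kronecker 2 T z (cup_product 1 1 T a b) = quadratic_pairing r a b"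
  shows "holonomy_boundary T z = wedge_class H1 (relator_chain r)"
  unfolding holonomy_boundary_def cup_dual_def
proof (rule the_equality)
  show "wedge_class H1 (relator_chain r) \<in> carrier (ext_square H1) \<and>
      (\<forall>a\<in>carrier C1. \<forall>b\<in>carrier C1. wedge_pairing T a b (wedge_class H1 (relator_chain r)) = kronecker 2 T z (cup_product 1 1 T a b))"
    using wedge_pairing_relator[OF r] cup hom_in_carrier[OF wedge_class_hom[OF comm_group_H1] relator_chain_closed] by simp
  fix w assume w: "w \<in> carrier (ext_square H1) \<and>
      (\<forall>a\<in>carrier C1. \<forall>b\<in>carrier C1. wedge_pairing T a b w = kronecker 2 T z (cup_product 1 1 T a b))"
  then obtain c where c: "c \<in> carrier (wedge_group H1)" "w = wedge_class H1 c"
    unfolding carrier_ext_square[OF comm_group_H1] by blast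
  have "wedge_coord c i j = wedge_coord (relator_chain r) i j" for i j
    using w[unfolded c(2)] dual_class_closed cup wedge_pairing_relator[OF r]
    unfolding wedge_pairing_dual[OF c(1), symmetric] wedge_pairing_dual[OF relator_chain_closed, symmetric] by simp
  then show "w = wedge_class H1 (relator_chain r)"
    unfolding c(2) by (intro wedge_class_determined[OF c(1) relator_chain_closed])
qed

abbreviation "M1 \<equiv> lie_of H1"

definition lie_relator :: "'i word set \<Rightarrow> ('a chain set bracketing \<Rightarrow>\<^sub>0 int) set set" where
  "lie_relator r = alt_sum M1 (\<lambda>i j. bracket M1 (lie_of_gen H1 (gen_class i)) (lie_of_gen H1 (gen_class j))) I (\<lambda>i j. magnus i j r)"

sublocale M1: graded_nring M1 by (rule graded_nring_lie_of[OF comm_group_H1])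

text \<open>The bracket of generators of \<open>M1\<close> is biadditive and alternating in the
  homology classes, so \<open>hom_wedge_expansion\<close> applies to the map behind
  \<open>wedge_to_lie\<close>.\<close>

lemma wedge_to_lie_relator:
  assumes r: "r \<in> lower_central F 2"
  shows "wedge_to_lie H1 (wedge_class H1 (relator_chain r)) = lie_relator r"
proof -
  let ?g = "lie_of_gen H1" and ?f = "\<lambda>(x, y). bracket M1 (lie_of_gen H1 x) (lie_of_gen H1 y)"
  note gcl = lie_of_gen_closed[OF comm_group_H1]
  have f: "?f \<in> carrier H1 \<times> carrier H1 \<rightarrow> carrier M1" using gcl by auto
  have hom: "frag_lift M1 ?f \<in> hom (wedge_group H1) M1" by (rule M1.frag_lift_hom[OF f])
  have of: "frag_lift M1 ?f (frag_of (x, y)) = bracket M1 (?g x) (?g y)" if "x \<in> carrier H1" "y \<in> carrier H1" for x y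
    using M1.frag_lift_of[of ?f "(x, y)"] gcl[OF that(1)] gcl[OF that(2)] by simp
  have add: "?g (x \<otimes>\<^bsub>H1\<^esub> y) = ?g x \<otimes>\<^bsub>M1\<^esub> ?g y" if "x \<in> carrier H1" "y \<in> carrier H1" for x y
    by (rule hom_mult[OF lie_of_gen_hom[OF comm_group_H1] that])
  have left: "frag_lift M1 ?f (frag_of (x \<otimes>\<^bsub>H1\<^esub> x', y)) = frag_lift M1 ?f (frag_of (x, y)) \<otimes>\<^bsub>M1\<^esub> frag_lift M1 ?f (frag_of (x', y))"
    if "x \<in> carrier H1" "x' \<in> carrier H1" "y \<in> carrier H1" for x x' y
    unfolding of[OF H1.m_closed[OF that(1,2)] that(3)] of[OF that(1,3)] of[OF that(2,3)] add[OF that(1,2)]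
    by (rule M1.bracket_mult_left[OF gcl[OF that(1)] gcl[OF that(2)] gcl[OF that(3)]])
  have right: "frag_lift M1 ?f (frag_of (x, y \<otimes>\<^bsub>H1\<^esub> y')) = frag_lift M1 ?f (frag_of (x, y)) \<otimes>\<^bsub>M1\<^esub> frag_lift M1 ?f (frag_of (x, y'))"
    if "x \<in> carrier H1" "y \<in> carrier H1" "y' \<in> carrier H1" for x y y'
    unfolding of[OF that(1) H1.m_closed[OF that(2,3)]] of[OF that(1,2)] of[OF that(1,3)] add[OF that(2,3)]
    by (rule M1.bracket_mult_right[OF gcl[OF that(2)] gcl[OF that(3)] gcl[OF that(1)]])
  have alt: "frag_lift M1 ?f (frag_of (x, x)) = \<one>\<^bsub>M1\<^esub>" if "x \<in> carrier H1" for x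
    unfolding of[OF that that] using lie_law_lie_of[OF comm_group_H1] gcl[OF that] by (simp add: lie_law_def)
  note M = M1.comm_group_axioms
  have "wedge_to_lie H1 (wedge_class H1 (relator_chain r)) = frag_lift M1 ?f (relator_chain r)"
    unfolding wedge_to_lie_def
    by (rule hom_wedge_class[OF comm_group_H1 M hom hom_wedge_relations[OF comm_group_H1 M hom left right alt] relator_chain_closed])
  also have "\<dots> = alt_sum M1 (\<lambda>i j. frag_lift M1 ?f (frag_of (gen_class i, gen_class j))) I (wedge_coord (relator_chain r))"
    by (rule hom_wedge_expansion[OF M hom left right alt relator_chain_closed])
  also have "\<dots> = alt_sum M1 (\<lambda>i j. frag_lift M1 ?f (frag_of (gen_class i, gen_class j))) I (\<lambda>i j. magnus i j r)"
  proof (rule M1.alt_sum_cong)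
    fix i j assume ij: "i \<in> I" "j \<in> I"
    show "frag_lift M1 ?f (frag_of (gen_class i, gen_class j)) \<in> carrier M1"
      unfolding of[OF gen_class_closed[OF ij(1)] gen_class_closed[OF ij(2)]]
      by (intro M1.bracket_closed gcl gen_class_closed ij)
    show "wedge_coord (relator_chain r) i j = magnus i j r" by (rule wedge_coord_relator[OF r ij])
  qed
  also have "\<dots> = lie_relator r"
    unfolding lie_relator_def alt_sum_def
    by (intro M1.finprod_cong') (auto simp: ordered_pairs_def of gen_class_closed gcl)
  finally show ?thesis .
qed

lemma holonomy_relators:
  "wedge_to_lie H1 ` holonomy_boundary T ` carrier (homology_group 2 T) = lie_relator ` N"
proof
  show "wedge_to_lie H1 ` holonomy_boundary T ` carrier (homology_group 2 T) \<subseteq> lie_relator ` N"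
  proof clarify
    fix z assume z: "z \<in> carrier (homology_group 2 T)"
    obtain r where r: "r \<in> N" "\<And>a b. a \<in> carrier C1 \<Longrightarrow> b \<in> carrier C1 \<Longrightarrow>
        kronecker 2 T z (cup_product 1 1 T a b) = quadratic_pairing r a b"
      using cup_H2[OF z] by blast
    have r2: "r \<in> lower_central F 2" using r(1) N_lower_central by blast
    have "holonomy_boundary T z = wedge_class H1 (relator_chain r)" by (rule holonomy_boundary_eq[OF r2 r(2)])
    then have "wedge_to_lie H1 (holonomy_boundary T z) = lie_relator r" by (simp only: wedge_to_lie_relator[OF r2])
    then show "wedge_to_lie H1 (holonomy_boundary T z) \<in> lie_relator ` N" using r(1) by (simp only: imageI)
  qed
  show "lie_relator ` N \<subseteq> wedge_to_lie H1 ` holonomy_boundary T ` carrier (homology_group 2 T)"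
  proof clarify
    fix r assume r: "r \<in> N"
    then have r2: "r \<in> lower_central F 2" using N_lower_central by blast
    obtain z where z: "z \<in> carrier (homology_group 2 T)" "\<And>a b. a \<in> carrier C1 \<Longrightarrow> b \<in> carrier C1 \<Longrightarrow>
        kronecker 2 T z (cup_product 1 1 T a b) = quadratic_pairing r a b"
      using relator_H2[OF r] by blast
    have "holonomy_boundary T z = wedge_class H1 (relator_chain r)" by (rule holonomy_boundary_eq[OF r2 z(2)])
    then have "wedge_to_lie H1 (holonomy_boundary T z) = lie_relator r" by (simp only: wedge_to_lie_relator[OF r2])
    then show "lie_relator r \<in> wedge_to_lie H1 ` holonomy_boundary T ` carrier (homology_group 2 T)"
      using z(1) by (metis imageI)
  qed
qed

end

section \<open>Comparison of the two quotient Lie algebras\<close>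

context ordered_presented_space
begin

abbreviation "L \<equiv> free_lie I"
abbreviation "J \<equiv> ideal_generated L (quadratic_part I ` R)"
abbreviation "Q \<equiv> lie_quotient L J"

sublocale L: graded_nring L by (rule graded_nring_free_lie)

lemma lie_relator_closed: "lie_relator r \<in> carrier M1"
  unfolding lie_relator_def
  by (intro M1.alt_sum_closed M1.bracket_closed lie_of_gen_closed[OF comm_group_H1] gen_class_closed)

lemma quadratic_part_closed: "r \<in> lower_central F 2 \<Longrightarrow> quadratic_part I r \<in> carrier L"
  unfolding quadratic_part_alt_sum[OF finite_I]
  by (intro L.alt_sum_closed L.bracket_closed free_lie_gen_closed)

lemma quadratic_relators_closed: "quadratic_part I ` R \<subseteq> carrier L"
  using quadratic_part_closed relators by blast

lemmas J_ideal = L.ideal_generated_ideal[OF quadratic_relators_closed]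

sublocale Q: graded_nring Q by (rule L.graded_nring_lie_quotient[OF J_ideal])

lemma lie_law_Q: "lie_law Q"
  by (rule lie_law_quotient[OF graded_nring_free_lie J_ideal lie_law_free_lie])

lemma holonomy_ideal_eq: "holonomy_ideal T = ideal_generated M1 (lie_relator ` N)"
  unfolding holonomy_ideal_def holonomy_relators ..

lemma lie_relators_closed: "lie_relator ` N \<subseteq> carrier M1"
  using lie_relator_closed by blast

lemma holonomy_lie_ideal: "lie_ideal (holonomy_ideal T) M1"
  unfolding holonomy_ideal_eq by (rule M1.ideal_generated_ideal[OF lie_relators_closed])

sublocale H: graded_nring "holonomy_lie T"
  unfolding holonomy_lie_def by (rule M1.graded_nring_lie_quotient[OF holonomy_lie_ideal])

lemma lie_law_holonomy_lie: "lie_law (holonomy_lie T)"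
  unfolding holonomy_lie_def
  by (rule lie_law_quotient[OF graded_nring_lie_of[OF comm_group_H1] holonomy_lie_ideal lie_law_lie_of[OF comm_group_H1]])

definition holonomy_class :: "('a chain set bracketing \<Rightarrow>\<^sub>0 int) set set \<Rightarrow> ('a chain set bracketing \<Rightarrow>\<^sub>0 int) set set set" where
  "holonomy_class z = holonomy_ideal T #>\<^bsub>M1\<^esub> z"

lemma holonomy_class_hom: "holonomy_class \<in> nring_hom M1 (holonomy_lie T)"
  unfolding holonomy_class_def[abs_def] holonomy_lie_def by (rule M1.quotient_map_hom[OF holonomy_lie_ideal])

definition quadratic_class :: "('i bracketing \<Rightarrow>\<^sub>0 int) set \<Rightarrow> ('i bracketing \<Rightarrow>\<^sub>0 int) set set" where
  "quadratic_class z = J #>\<^bsub>L\<^esub> z"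

lemma quadratic_class_hom: "quadratic_class \<in> nring_hom L Q"
  unfolding quadratic_class_def[abs_def] by (rule L.quotient_map_hom[OF J_ideal])

lemma holonomy_class_relator:
  assumes "r \<in> N"
  shows "holonomy_class (lie_relator r) = \<one>\<^bsub>holonomy_lie T\<^esub>"
proof -
  have "lie_relator r \<in> holonomy_ideal T"
    unfolding holonomy_ideal_eq using M1.ideal_generated_incl assms by blast
  moreover have "subgroup (holonomy_ideal T) M1" using holonomy_lie_ideal by (simp add: lie_ideal_def)
  ultimately have "holonomy_ideal T #>\<^bsub>M1\<^esub> lie_relator r = holonomy_ideal T"
    using M1.coset_join2[OF lie_relator_closed] by blast
  then show ?thesis unfolding holonomy_class_def holonomy_lie_def M1.one_lie_quotient .
qed

lemma quadratic_class_relator: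
  assumes "r \<in> R"
  shows "quadratic_class (quadratic_part I r) = \<one>\<^bsub>Q\<^esub>"
proof -
  have "quadratic_part I r \<in> J" using L.ideal_generated_incl assms by blast
  moreover have "subgroup J L" using J_ideal by (simp add: lie_ideal_def)
  moreover have "quadratic_part I r \<in> carrier L" using quadratic_relators_closed assms by blast
  ultimately have "J #>\<^bsub>L\<^esub> quadratic_part I r = J" using L.coset_join2 by blast
  then show ?thesis unfolding quadratic_class_def L.one_lie_quotient .
qed

lemma nring_hom_alt_sum_bracket:
  assumes A: "graded_nring A" and B: "graded_nring B" and h: "h \<in> nring_hom A B" and f: "\<And>i. i \<in> I \<Longrightarrow> f i \<in> carrier A"
  shows "h (alt_sum A (\<lambda>i j. bracket A (f i) (f j)) I m) = alt_sum B (\<lambda>i j. bracket B (h (f i)) (h (f j))) I m"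
proof -
  interpret A: graded_nring A by (rule A)
  interpret B: graded_nring B by (rule B)
  have hom: "h \<in> hom A B" using h by (simp add: nring_hom_def)
  have "h (alt_sum A (\<lambda>i j. bracket A (f i) (f j)) I m) = alt_sum B (\<lambda>i j. h (bracket A (f i) (f j))) I m"
    by (rule hom_alt_sum[OF A.comm_group_axioms B.comm_group_axioms hom]) (intro A.bracket_closed f)
  also have "\<dots> = alt_sum B (\<lambda>i j. bracket B (h (f i)) (h (f j))) I m"
    unfolding alt_sum_def
  proof (rule B.finprod_cong')
    show "(\<lambda>(i, j). bracket B (h (f i)) (h (f j)) [^]\<^bsub>B\<^esub> m i j) \<in> ordered_pairs I \<rightarrow> carrier B"
      using nring_hom_closed[OF h f] by (auto simp: ordered_pairs_def)
    fix p assume "p \<in> ordered_pairs I"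
    then show "(case p of (i, j) \<Rightarrow> h (bracket A (f i) (f j)) [^]\<^bsub>B\<^esub> m i j) =
        (case p of (i, j) \<Rightarrow> bracket B (h (f i)) (h (f j)) [^]\<^bsub>B\<^esub> m i j)"
      using nring_hom_bracket[OF h f f] by (auto simp: ordered_pairs_def)
  qed (rule HOL.refl)
  finally show ?thesis .
qed

text \<open>Quadratic part and \<open>lie_relator\<close> are alternating sums with the same
  coefficients \<open>magnus i j r\<close>, so a quadratic relator is sent to the class of a
  \<open>lie_relator\<close>, which is zero.\<close>

lemma forward_hom:
  obtains \<Phi> where "\<Phi> \<in> nring_hom Q (holonomy_lie T)"
    "\<And>i. i \<in> I \<Longrightarrow> \<Phi> (quadratic_class (free_lie_gen I i)) = holonomy_class (lie_of_gen H1 (gen_class i))"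
proof -
  let ?f = "\<lambda>i. holonomy_class (lie_of_gen H1 (gen_class i))"
  have deg: "?f i \<in> degree_part (holonomy_lie T) 1" if "i \<in> I" for i
    by (rule nring_hom_degree[OF holonomy_class_hom lie_of_gen_degree[OF comm_group_H1 gen_class_closed[OF that]]])
  obtain h where h: "h \<in> nring_hom L (holonomy_lie T)" "\<And>i. i \<in> I \<Longrightarrow> h (free_lie_gen I i) = ?f i"
    using free_lie_universal[OF H.graded_nring_axioms lie_law_holonomy_lie, of I ?f] deg by metis
  have kill: "h s = \<one>\<^bsub>holonomy_lie T\<^esub>" if "s \<in> quadratic_part I ` R" for s
  proof -
    obtain r where r: "r \<in> R" "s = quadratic_part I r" using \<open>s \<in> _\<close> by blast
    have r2: "r \<in> lower_central F 2" using relators r(1) by blast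
    have "h s = alt_sum (holonomy_lie T) (\<lambda>i j. bracket (holonomy_lie T) (h (free_lie_gen I i)) (h (free_lie_gen I j))) I (\<lambda>i j. magnus i j r)"
      unfolding r(2) quadratic_part_alt_sum[OF finite_I r2]
      by (rule nring_hom_alt_sum_bracket[OF L.graded_nring_axioms H.graded_nring_axioms h(1) free_lie_gen_closed])
    also have "\<dots> = alt_sum (holonomy_lie T) (\<lambda>i j. bracket (holonomy_lie T) (?f i) (?f j)) I (\<lambda>i j. magnus i j r)"
      unfolding alt_sum_def
    proof (rule H.finprod_cong')
      show "(\<lambda>(i, j). bracket (holonomy_lie T) (?f i) (?f j) [^]\<^bsub>holonomy_lie T\<^esub> magnus i j r) \<in> ordered_pairs I \<rightarrow> carrier (holonomy_lie T)"
        using H.degree_closed[OF deg] by (auto simp: ordered_pairs_def)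
    qed (auto simp: ordered_pairs_def h(2))
    also have "\<dots> = holonomy_class (lie_relator r)"
      unfolding lie_relator_def
      by (rule nring_hom_alt_sum_bracket[OF M1.graded_nring_axioms H.graded_nring_axioms holonomy_class_hom, symmetric])
        (rule lie_of_gen_closed[OF comm_group_H1 gen_class_closed])
    also have "\<dots> = \<one>\<^bsub>holonomy_lie T\<^esub>"
      using r(1) relators_N by (intro holonomy_class_relator) blast
    finally show ?thesis .
  qed
  obtain \<Phi> where \<Phi>: "\<Phi> \<in> nring_hom Q (holonomy_lie T)" "\<And>z. z \<in> carrier L \<Longrightarrow> \<Phi> (J #>\<^bsub>L\<^esub> z) = h z"
    using L.lie_quotient_factor[OF H.graded_nring_axioms h(1) quadratic_relators_closed kill] by metis
  have "\<Phi> (quadratic_class (free_lie_gen I i)) = ?f i" if "i \<in> I" for i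
    unfolding quadratic_class_def \<Phi>(2)[OF free_lie_gen_closed[OF that]] by (rule h(2)[OF that])
  then show ?thesis using that \<Phi>(1) by blast
qed

text \<open>A map out of \<open>lie_of\<close> has to be prescribed on all homology classes. This is
  the additive map that sends the generator classes to the classes of the free generators.\<close>

definition coord_lift :: "'a chain set \<Rightarrow> ('i bracketing \<Rightarrow>\<^sub>0 int) set set" where
  "coord_lift z = finprod Q (\<lambda>i. quadratic_class (free_lie_gen I i) [^]\<^bsub>Q\<^esub> coord i z) I"

lemma quadratic_class_gen_degree: "i \<in> I \<Longrightarrow> quadratic_class (free_lie_gen I i) \<in> degree_part Q 1"
  by (rule nring_hom_degree[OF quadratic_class_hom free_lie_gen_degree])

lemmas quadratic_class_gen_closed = Q.degree_closed[OF quadratic_class_gen_degree]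

lemma coord_lift_degree: "coord_lift z \<in> degree_part Q 1"
  unfolding coord_lift_def
  by (intro Q.finprod_subgroup[OF Q.degree_subgroup] Pi_I Q.subgroup_int_pow_closed[OF Q.degree_subgroup] quadratic_class_gen_degree)

lemma coord_lift_hom: "coord_lift \<in> hom H1 Q"
proof (rule homI)
  show "coord_lift z \<in> carrier Q" for z by (rule Q.degree_closed[OF coord_lift_degree])
  fix z w assume zw: "z \<in> carrier H1" "w \<in> carrier H1"
  have "coord_lift (z \<otimes>\<^bsub>H1\<^esub> w) = finprod Q (\<lambda>i. quadratic_class (free_lie_gen I i) [^]\<^bsub>Q\<^esub> coord i z \<otimes>\<^bsub>Q\<^esub> quadratic_class (free_lie_gen I i) [^]\<^bsub>Q\<^esub> coord i w) I"
    unfolding coord_lift_def coord_mult[OF zw]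
    by (intro Q.finprod_cong' HOL.refl Pi_I Q.m_closed Q.int_pow_closed quadratic_class_gen_closed)
      (assumption | rule Q.int_pow_mult[OF quadratic_class_gen_closed])+
  also have "\<dots> = coord_lift z \<otimes>\<^bsub>Q\<^esub> coord_lift w"
    unfolding coord_lift_def by (intro Q.finprod_multf Pi_I Q.int_pow_closed quadratic_class_gen_closed)
  finally show "coord_lift (z \<otimes>\<^bsub>H1\<^esub> w) = coord_lift z \<otimes>\<^bsub>Q\<^esub> coord_lift w" .
qed

lemma coord_lift_gen:
  assumes k: "k \<in> I"
  shows "coord_lift (gen_class k) = quadratic_class (free_lie_gen I k)"
proof -
  have "coord_lift (gen_class k) = finprod Q (\<lambda>i. if k = i then quadratic_class (free_lie_gen I i) else \<one>\<^bsub>Q\<^esub>) I"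
    unfolding coord_lift_def
    by (intro Q.finprod_cong' HOL.refl Pi_I)
      (auto simp: coord_gen[OF k] quadratic_class_gen_closed)
  also have "\<dots> = quadratic_class (free_lie_gen I k)"
    by (rule Q.finprod_singleton[OF k finite_I]) (intro Pi_I quadratic_class_gen_closed)
  finally show ?thesis .
qed

lemma quadratic_relator_normal_closure:
  assumes r: "r \<in> N"
  shows "alt_sum Q (\<lambda>i j. bracket Q (quadratic_class (free_lie_gen I i)) (quadratic_class (free_lie_gen I j))) I (\<lambda>i j. magnus i j r) = \<one>\<^bsub>Q\<^esub>"
proof -
  let ?b = "\<lambda>i j. bracket Q (quadratic_class (free_lie_gen I i)) (quadratic_class (free_lie_gen I j))"
  \<comment> \<open>Confined to the commutator subgroup, where Magnus coefficients are additive and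
    conjugation invariant. That makes this set a normal subgroup of the free group, so that
    containing R it contains N.\<close>
  let ?K = "{r \<in> lower_central F 2. alt_sum Q ?b I (\<lambda>i j. magnus i j r) = \<one>\<^bsub>Q\<^esub>}"
  have b: "?b i j \<in> carrier Q" if "i \<in> I" "j \<in> I" for i j
    using that by (intro Q.bracket_closed quadratic_class_gen_closed)
  have sub: "subgroup ?K F"
  proof (rule F.subgroupI)
    show "?K \<subseteq> carrier F" using F.lower_central_2_closed by blast
    have "\<one>\<^bsub>F\<^esub> \<in> ?K" using subgroup.one_closed[OF F.subgroup_lower_central_2] Q.alt_sum_zero[where b = ?b and I = I, OF b] by (simp add: magnus_one)
    then show "?K \<noteq> {}" by blast
  next
    fix a assume "a \<in> ?K"
    then have a: "a \<in> lower_central F 2" "alt_sum Q ?b I (\<lambda>i j. magnus i j a) = \<one>\<^bsub>Q\<^esub>" by auto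
    show "inv\<^bsub>F\<^esub> a \<in> ?K"
      using subgroup.m_inv_closed[OF F.subgroup_lower_central_2 a(1)] Q.alt_sum_neg[where b = ?b and I = I, OF b] a(2)
      by (simp add: magnus_inv_2[OF a(1)])
    fix c assume "c \<in> ?K"
    then have c: "c \<in> lower_central F 2" "alt_sum Q ?b I (\<lambda>i j. magnus i j c) = \<one>\<^bsub>Q\<^esub>" by auto
    show "a \<otimes>\<^bsub>F\<^esub> c \<in> ?K"
      using subgroup.m_closed[OF F.subgroup_lower_central_2 a(1) c(1)] Q.alt_sum_add[where b = ?b and I = I, OF b] a(2) c(2)
      by (simp add: magnus_mult_2[OF a(1) F.lower_central_2_closed[OF c(1)]])
  qed
  have "?K \<lhd> F"
    unfolding F.normal_inv_iff
  proof (intro conjI ballI sub)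
    fix g a assume g: "g \<in> carrier F" and "a \<in> ?K"
    then have a: "a \<in> lower_central F 2" "alt_sum Q ?b I (\<lambda>i j. magnus i j a) = \<one>\<^bsub>Q\<^esub>" by auto
    show "g \<otimes>\<^bsub>F\<^esub> a \<otimes>\<^bsub>F\<^esub> inv\<^bsub>F\<^esub> g \<in> ?K"
      using normal.inv_op_closed2[OF F.normal_lower_central_2 g a(1)] a(2) by (simp add: magnus_conj_2[OF a(1) g])
  qed
  moreover have "R \<subseteq> ?K"
  proof
    fix r assume r: "r \<in> R"
    then have r2: "r \<in> lower_central F 2" using relators by blast
    have "alt_sum Q ?b I (\<lambda>i j. magnus i j r) = quadratic_class (quadratic_part I r)"
      unfolding quadratic_part_alt_sum[OF finite_I r2]
      by (rule nring_hom_alt_sum_bracket[OF L.graded_nring_axioms Q.graded_nring_axioms quadratic_class_hom free_lie_gen_closed, symmetric])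
    then show "r \<in> ?K" using quadratic_class_relator[OF r] r2 by simp
  qed
  ultimately have "N \<subseteq> ?K" by (rule N_minimal)
  then show ?thesis using r by blast
qed

text \<open>The holonomy ideal is generated by the images of all relations, so vanishing is owed on
  the whole of N, whereas \<open>forward_hom\<close> has to kill the given relators.\<close>

lemma backward_hom:
  obtains \<Psi> where "\<Psi> \<in> nring_hom (holonomy_lie T) Q"
    "\<And>z. z \<in> carrier H1 \<Longrightarrow> \<Psi> (holonomy_class (lie_of_gen H1 z)) = coord_lift z"
proof -
  obtain h where h: "h \<in> nring_hom M1 Q" "\<And>z. z \<in> carrier H1 \<Longrightarrow> h (lie_of_gen H1 z) = coord_lift z"
    using lie_of_universal[OF comm_group_H1 Q.graded_nring_axioms lie_law_Q coord_lift_hom coord_lift_degree] by metis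
  have kill: "h s = \<one>\<^bsub>Q\<^esub>" if "s \<in> lie_relator ` N" for s
  proof -
    obtain r where r: "r \<in> N" "s = lie_relator r" using \<open>s \<in> _\<close> by blast
    let ?g = "\<lambda>i. h (lie_of_gen H1 (gen_class i))"
    have g: "?g i = quadratic_class (free_lie_gen I i)" if "i \<in> I" for i
      unfolding h(2)[OF gen_class_closed[OF that]] by (rule coord_lift_gen[OF that])
    have "h s = alt_sum Q (\<lambda>i j. bracket Q (?g i) (?g j)) I (\<lambda>i j. magnus i j r)"
      unfolding r(2) lie_relator_def
      by (rule nring_hom_alt_sum_bracket[OF M1.graded_nring_axioms Q.graded_nring_axioms h(1)])
        (rule lie_of_gen_closed[OF comm_group_H1 gen_class_closed])
    also have "\<dots> = alt_sum Q (\<lambda>i j. bracket Q (quadratic_class (free_lie_gen I i)) (quadratic_class (free_lie_gen I j))) I (\<lambda>i j. magnus i j r)"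
      unfolding alt_sum_def
      by (rule Q.finprod_cong') (auto simp: ordered_pairs_def g quadratic_class_gen_closed)
    also have "\<dots> = \<one>\<^bsub>Q\<^esub>" by (rule quadratic_relator_normal_closure[OF r(1)])
    finally show ?thesis .
  qed
  obtain \<Psi> where \<Psi>: "\<Psi> \<in> nring_hom (lie_quotient M1 (ideal_generated M1 (lie_relator ` N))) Q"
    "\<And>z. z \<in> carrier M1 \<Longrightarrow> \<Psi> (ideal_generated M1 (lie_relator ` N) #>\<^bsub>M1\<^esub> z) = h z"
    using M1.lie_quotient_factor[OF Q.graded_nring_axioms h(1) lie_relators_closed kill] by metis
  have "\<Psi> (holonomy_class (lie_of_gen H1 z)) = coord_lift z" if "z \<in> carrier H1" for z
    unfolding holonomy_class_def holonomy_ideal_eq \<Psi>(2)[OF lie_of_gen_closed[OF comm_group_H1 that]] by (rule h(2)[OF that])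
  then show ?thesis using that \<Psi>(1) unfolding holonomy_lie_def holonomy_ideal_eq by blast
qed

theorem holonomy_lie_iso:
  "\<exists>\<Phi>\<in>graded_lie_iso Q (holonomy_lie T). \<forall>i\<in>I.
     \<Phi> (J #>\<^bsub>L\<^esub> free_lie_gen I i) = holonomy_ideal T #>\<^bsub>M1\<^esub> lie_of_gen H1 (hurewicz X (\<alpha> (presented_gen I R i)))"
proof -
  obtain \<Phi> where \<Phi>: "\<Phi> \<in> nring_hom Q (holonomy_lie T)"
    "\<And>i. i \<in> I \<Longrightarrow> \<Phi> (quadratic_class (free_lie_gen I i)) = holonomy_class (lie_of_gen H1 (gen_class i))"
    using forward_hom by blast
  obtain \<Psi> where \<Psi>: "\<Psi> \<in> nring_hom (holonomy_lie T) Q"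
    "\<And>z. z \<in> carrier H1 \<Longrightarrow> \<Psi> (holonomy_class (lie_of_gen H1 z)) = coord_lift z"
    using backward_hom by blast
  have "\<Psi> (\<Phi> c) = c" if c: "c \<in> carrier Q" for c
  proof -
    obtain z where z: "z \<in> carrier L" "c = quadratic_class z"
      using c unfolding L.carrier_lie_quotient quadratic_class_def by blast
    have "\<Psi> (\<Phi> (quadratic_class z)) = quadratic_class z"
    proof (rule free_lie_hom_eq[OF Q.graded_nring_axioms _ quadratic_class_hom _ z(1)])
      show "(\<lambda>z. \<Psi> (\<Phi> (quadratic_class z))) \<in> nring_hom L Q"
        by (rule nring_hom_compose[OF nring_hom_compose[OF quadratic_class_hom \<Phi>(1)] \<Psi>(1)])
      fix i assume i: "i \<in> I"
      show "\<Psi> (\<Phi> (quadratic_class (free_lie_gen I i))) = quadratic_class (free_lie_gen I i)"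
        unfolding \<Phi>(2)[OF i] \<Psi>(2)[OF gen_class_closed[OF i]] by (rule coord_lift_gen[OF i])
    qed
    then show ?thesis by (simp only: z(2))
  qed
  moreover have "\<Phi> (\<Psi> c) = c" if c: "c \<in> carrier (holonomy_lie T)" for c
  proof -
    obtain z where z: "z \<in> carrier M1" "c = holonomy_class z"
      using c unfolding holonomy_lie_def M1.carrier_lie_quotient holonomy_class_def by blast
    have \<Phi>': "\<Phi> \<in> hom Q (holonomy_lie T)" using \<Phi>(1) by (simp add: nring_hom_def)
    have h': "holonomy_class \<in> hom M1 (holonomy_lie T)" using holonomy_class_hom by (simp add: nring_hom_def)
    have "\<Phi> (\<Psi> (holonomy_class z)) = holonomy_class z"
    proof (rule lie_of_hom_eq[OF comm_group_H1 H.graded_nring_axioms _ holonomy_class_hom _ z(1)])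
      show "(\<lambda>z. \<Phi> (\<Psi> (holonomy_class z))) \<in> nring_hom M1 (holonomy_lie T)"
        by (rule nring_hom_compose[OF nring_hom_compose[OF holonomy_class_hom \<Psi>(1)] \<Phi>(1)])
      fix w assume w: "w \<in> carrier H1"
      \<comment> \<open>The generators of the holonomy algebra are indexed by all homology classes
        w. Both sides are additive in w, so it suffices to compare them on the generator
        classes.\<close>
      have "\<Phi> (coord_lift w) = holonomy_class (lie_of_gen H1 w)"
      proof (rule H1_hom_eq[OF H.comm_group_axioms _ _ _ w])
        show "(\<lambda>w. \<Phi> (coord_lift w)) \<in> hom H1 (holonomy_lie T)"
          using hom_compose[OF coord_lift_hom \<Phi>'] by (simp only: o_def)
        show "(\<lambda>w. holonomy_class (lie_of_gen H1 w)) \<in> hom H1 (holonomy_lie T)"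
          using hom_compose[OF lie_of_gen_hom[OF comm_group_H1] h'] by (simp only: o_def)
        fix i assume i: "i \<in> I"
        show "\<Phi> (coord_lift (gen_class i)) = holonomy_class (lie_of_gen H1 (gen_class i))"
          unfolding coord_lift_gen[OF i] by (rule \<Phi>(2)[OF i])
      qed
      then show "\<Phi> (\<Psi> (holonomy_class (lie_of_gen H1 w))) = holonomy_class (lie_of_gen H1 w)"
        unfolding \<Psi>(2)[OF w] .
    qed
    then show ?thesis by (simp only: z(2))
  qed
  ultimately have "\<Phi> \<in> graded_lie_iso Q (holonomy_lie T)"
    by (rule inverse_nring_homs_iso[OF Q.graded_nring_axioms H.graded_nring_axioms \<Phi>(1) \<Psi>(1)])
  then show ?thesis
    using \<Phi>(2) hurewicz_gen unfolding quadratic_class_def holonomy_class_def by (intro bexI[of _ \<Phi>]) simp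
qed

end

theorem proposition7p2:
  fixes n m :: nat
    and r :: "nat \<Rightarrow> nat word set"
    and X :: "'a::topological_space set" and x0 :: 'a
    and \<K> :: "(nat \<times> ((nat \<Rightarrow> real) \<Rightarrow> 'a)) set"
    and \<alpha> :: "nat word set set \<Rightarrow> (real \<Rightarrow> 'a) set"
  assumes "\<And>j. j \<in> {1..m} \<Longrightarrow> r j \<in> derived (free_group {1..n}) (carrier (free_group {1..n}))"
    and "eilenberg_maclane_1 (presented_group {1..n} (r ` {1..m})) X x0 \<alpha>"
    and "cw_structure (top_of_set X) \<K>"
    and "finite_2_skeleton \<K>"
  shows "let L = free_lie {1..n};
             J = ideal_generated L (quadratic_part {1..n} ` r ` {1..m});
             H = homology_group 1 (top_of_set X)
         in \<exists>\<Psi> \<in> graded_lie_iso (lie_quotient L J) (holonomy_lie (top_of_set X)).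
              \<forall>i\<in>{1..n}. \<Psi> (J #>\<^bsub>L\<^esub> free_lie_gen {1..n} i) =
                holonomy_ideal (top_of_set X) #>\<^bsub>lie_of H\<^esub>
                  lie_of_gen H (hurewicz X (\<alpha> (presented_gen {1..n} (r ` {1..m}) i)))"
proof -
  \<comment> \<open>The relators are given in the derived subgroup, which is the second term of the
    lower central series used throughout.\<close>
  have "r ` {1..m} \<subseteq> lower_central (free_group {1..n}) 2"
    using assms(1) unfolding group.derived_eq_lower_central_2[OF group_free_group] by blast
  with assms(2) interpret ordered_presented_space "{1..n}" "r ` {1..m}" X x0 \<alpha>
    by unfold_locales (simp_all add: eilenberg_maclane_1_def)
  show ?thesis unfolding Let_def by (rule holonomy_lie_iso)
qed

end
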